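(* Let $b\in C^1((0,\infty))$, let $\rho(x)=\exp\left(-\int_1^x2b(s)\,ds\right)$, let $(X_t)_{t\ge0}$ be the diffusion $dX_t=dB_t-b(X_t)\,dt$ on $(0,\infty)$ absorbed at $0$, let $L$ be its generator and $\lambda_0=\inf\operatorname{spec}(L)$. Assume that $0$ is an exit boundary and that absorption is certain. Then $\lambda_0>0$ if and only if for some $a\in(0,\infty)$ $$A(b,a):=\sup_{x>a}\left(\int_a^x\rho(y)^{-1}\,dy\right)\left(\int_x^\infty\rho(y)\,dy\right)<\infty .$$ In particular, $\lambda_0>0$ implies $\int_1^\infty\rho(y)\,dy<\infty$.
   Context: $B$ is a standard one-dimensional Brownian motion and $T_0=\inf\{t\ge0:X_t=0\}$. Absorption is certain if $\mathbb P^x(T_0<\infty)=1$ for every starting point $x\in(0,\infty)$. $0$ is an exit boundary if (for fixed $c\in(0,\infty)$) $\int_0^c\rho(x)^{-1}\int_x^c\rho(y)\,dy\,dx<\infty$ and $\int_0^c\rho(x)\int_x^c\rho(y)^{-1}\,dy\,dx=\infty$. With $\rho(dx)=\rho(x)\,dx$, $L$ is the non-negative selfadjoint operator in $L^2((0,\infty),\rho)$ associated with the closure of the quadratic form $\phi\mapsto\frac12\int_0^\infty|\phi'(x)|^2\rho(dx)$, $\phi\in C_c^\infty((0,\infty))$; it is a realization of $-\frac12\frac{d^2}{dx^2}+b(x)\frac{d}{dx}$. *)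

theory Defs
  imports "HOL-Probability.Probability"
begin

section \<open>The speed density and the boundary conditions\<close>

text \<open>The interval integral is oriented, so for \<open>x < 1\<close> it equals minus the integral over
  \<open>(x, 1)\<close>. Only the values at \<open>x > 0\<close> matter.\<close>

definition rho :: "(real \<Rightarrow> real) \<Rightarrow> real \<Rightarrow> real" where
  "rho b x = exp (- (LBINT s=ereal 1..ereal x. 2 * b s))"

definition rho_measure :: "(real \<Rightarrow> real) \<Rightarrow> real measure" where
  "rho_measure b = density (restrict_space lborel {0<..}) (\<lambda>x. ennreal (rho b x))"

text \<open>Since \<open>rho b\<close> is continuous and positive on \<open>(0, \<infinity>)\<close>, neither condition depends on \<open>c\<close>.\<close>

definition exit_boundary :: "(real \<Rightarrow> real) \<Rightarrow> bool" where
  "exit_boundary b \<longleftrightarrow> (\<exists>c>0.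
     (\<integral>\<^sup>+x\<in>{0<..<c}. ennreal (1 / rho b x) *
        (\<integral>\<^sup>+y\<in>{x<..<c}. ennreal (rho b y) \<partial>lborel) \<partial>lborel) < \<infinity> \<and>
     (\<integral>\<^sup>+x\<in>{0<..<c}. ennreal (rho b x) *
        (\<integral>\<^sup>+y\<in>{x<..<c}. ennreal (1 / rho b y) \<partial>lborel) \<partial>lborel) = \<infinity>)"

definition A_const :: "(real \<Rightarrow> real) \<Rightarrow> real \<Rightarrow> ennreal" where
  "A_const b a = (SUP x\<in>{a<..}.
     (\<integral>\<^sup>+y\<in>{a<..<x}. ennreal (1 / rho b y) \<partial>lborel) *
     (\<integral>\<^sup>+y\<in>{x<..}. ennreal (rho b y) \<partial>lborel))"


section \<open>Brownian motion and the absorbed diffusion\<close>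

text \<open>Only times \<open>t \<ge> 0\<close> are relevant. Any finite increasing family of times extends to a strictly
  increasing sequence, so the quantification over sequences loses nothing.\<close>

definition brownian_motion :: "'w measure \<Rightarrow> (real \<Rightarrow> 'w \<Rightarrow> real) \<Rightarrow> bool" where
  "brownian_motion M B \<longleftrightarrow>
     prob_space M \<and>
     (\<forall>t\<ge>0. B t \<in> borel_measurable M) \<and>
     (AE \<omega> in M. B 0 \<omega> = 0) \<and>
     (AE \<omega> in M. continuous_on {0..} (\<lambda>t. B t \<omega>)) \<and>
     (\<forall>(\<tau>::nat \<Rightarrow> real) n. 0 \<le> \<tau> 0 \<and> strict_mono \<tau> \<longrightarrow>
        prob_space.indep_vars M (\<lambda>_. borel) (\<lambda>i \<omega>. B (\<tau> (Suc i)) \<omega> - B (\<tau> i) \<omega>) {..<n}) \<and>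
     (\<forall>s t. 0 \<le> s \<and> s < t \<longrightarrow>
        distributed M lborel (\<lambda>\<omega>. B t \<omega> - B s \<omega>)
          (\<lambda>x. ennreal (normal_density 0 (sqrt (t - s)) x)))"

text \<open>Solution of \<open>dX = dB - b(X) dt\<close> started at \<open>x\<close> and run until it leaves \<open>(0, \<infinity>)\<close>. The state
  space is \<open>[0, \<infinity>]\<close>: the process is absorbed at \<open>0\<close>, and since no growth condition on \<open>b\<close> is
  imposed it may explode, in which case it stays at the cemetery \<open>\<infinity>\<close> and never reaches \<open>0\<close>. The
  noise is additive, so the equation is understood pathwise in integrated form.\<close>

definition absorbed_diffusion ::
  "'w measure \<Rightarrow> (real \<Rightarrow> 'w \<Rightarrow> real) \<Rightarrow> (real \<Rightarrow> real) \<Rightarrow> real \<Rightarrow> (real \<Rightarrow> 'w \<Rightarrow> ereal) \<Rightarrow> bool" where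
  "absorbed_diffusion M B b x X \<longleftrightarrow>
     (\<forall>t\<ge>0. X t \<in> borel_measurable M) \<and>
     (AE \<omega> in M.
        X 0 \<omega> = ereal x \<and>
        (\<forall>t\<ge>0. 0 \<le> X t \<omega>) \<and>
        continuous_on {0..} (\<lambda>t. X t \<omega>) \<and>
        (\<forall>t\<ge>0. (\<forall>s\<in>{0..t}. 0 < X s \<omega> \<and> X s \<omega> < \<infinity>) \<longrightarrow>
           X t \<omega> = ereal (x + B t \<omega> - (LBINT s=ereal 0..ereal t. b (real_of_ereal (X s \<omega>))))) \<and>
        (\<forall>s t. 0 \<le> s \<and> s \<le> t \<and> (X s \<omega> = 0 \<or> X s \<omega> = \<infinity>) \<longrightarrow> X t \<omega> = X s \<omega>))"

definition hitting_time_0 :: "(real \<Rightarrow> 'w \<Rightarrow> ereal) \<Rightarrow> 'w \<Rightarrow> ereal" where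
  "hitting_time_0 X \<omega> = Inf {ereal t |t. 0 \<le> t \<and> X t \<omega> = 0}"

text \<open>The first argument of the family \<open>X\<close> is the starting point.\<close>

definition absorption_certain :: "'w measure \<Rightarrow> (real \<Rightarrow> real \<Rightarrow> 'w \<Rightarrow> ereal) \<Rightarrow> bool" where
  "absorption_certain M X \<longleftrightarrow> (\<forall>x>0. AE \<omega> in M. hitting_time_0 (X x) \<omega> < \<infinity>)"


section \<open>Operators associated with forms on complex \<open>L\<^sup>2\<close>\<close>

text \<open>Elements of \<open>L\<^sup>2\<close> are represented by square-integrable functions, equality being equality
  almost everywhere; an unbounded operator is represented by its graph, a relation
  invariant under almost everywhere equality.\<close>

definition L2 :: "'a measure \<Rightarrow> ('a \<Rightarrow> complex) set" where
  "L2 M = {f \<in> borel_measurable M. integrable M (\<lambda>x. (cmod (f x))\<^sup>2)}"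

definition L2_inner :: "'a measure \<Rightarrow> ('a \<Rightarrow> complex) \<Rightarrow> ('a \<Rightarrow> complex) \<Rightarrow> complex" where
  "L2_inner M f g = (LINT x|M. f x * cnj (g x))"

definition L2_norm :: "'a measure \<Rightarrow> ('a \<Rightarrow> complex) \<Rightarrow> real" where
  "L2_norm M f = sqrt (LINT x|M. (cmod (f x))\<^sup>2)"

text \<open>Closure of a sesquilinear form \<open>q\<close> with core \<open>D\<close>: \<open>form_approx M D q \<phi> u\<close> says that the
  sequence \<open>\<phi>\<close> in \<open>D\<close> converges to \<open>u\<close> in \<open>L\<^sup>2\<close> and is Cauchy with respect to \<open>q\<close>.\<close>

definition form_approx ::
  "'a measure \<Rightarrow> ('a \<Rightarrow> complex) set \<Rightarrow> (('a \<Rightarrow> complex) \<Rightarrow> ('a \<Rightarrow> complex) \<Rightarrow> complex)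
    \<Rightarrow> (nat \<Rightarrow> 'a \<Rightarrow> complex) \<Rightarrow> ('a \<Rightarrow> complex) \<Rightarrow> bool" where
  "form_approx M D q \<phi> u \<longleftrightarrow>
     (\<forall>n. \<phi> n \<in> D) \<and> u \<in> L2 M \<and>
     (\<lambda>n. L2_norm M (\<lambda>x. \<phi> n x - u x)) \<longlonglongrightarrow> 0 \<and>
     (\<forall>e>0. \<exists>N. \<forall>m\<ge>N. \<forall>n\<ge>N. cmod (q (\<lambda>x. \<phi> m x - \<phi> n x) (\<lambda>x. \<phi> m x - \<phi> n x)) < e)"

definition closure_dom ::
  "'a measure \<Rightarrow> ('a \<Rightarrow> complex) set \<Rightarrow> (('a \<Rightarrow> complex) \<Rightarrow> ('a \<Rightarrow> complex) \<Rightarrow> complex)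
    \<Rightarrow> ('a \<Rightarrow> complex) set" where
  "closure_dom M D q = {u. \<exists>\<phi>. form_approx M D q \<phi> u}"

text \<open>For a closable non-negative form the limit exists and does not depend on the approximating
  sequences.\<close>

definition closure_form ::
  "'a measure \<Rightarrow> ('a \<Rightarrow> complex) set \<Rightarrow> (('a \<Rightarrow> complex) \<Rightarrow> ('a \<Rightarrow> complex) \<Rightarrow> complex)
    \<Rightarrow> ('a \<Rightarrow> complex) \<Rightarrow> ('a \<Rightarrow> complex) \<Rightarrow> complex" where
  "closure_form M D q u v =
     (THE l. \<exists>\<phi> \<psi>. form_approx M D q \<phi> u \<and> form_approx M D q \<psi> v \<and>
        (\<lambda>n. q (\<phi> n) (\<psi> n)) \<longlonglongrightarrow> l)"

text \<open>The operator associated with the closed form: \<open>form_operator M D q u g\<close> says that \<open>u\<close> is in its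
  domain and is mapped to \<open>g\<close>.\<close>

definition form_operator ::
  "'a measure \<Rightarrow> ('a \<Rightarrow> complex) set \<Rightarrow> (('a \<Rightarrow> complex) \<Rightarrow> ('a \<Rightarrow> complex) \<Rightarrow> complex)
    \<Rightarrow> ('a \<Rightarrow> complex) \<Rightarrow> ('a \<Rightarrow> complex) \<Rightarrow> bool" where
  "form_operator M D q u g \<longleftrightarrow>
     u \<in> closure_dom M D q \<and> g \<in> L2 M \<and>
     (\<forall>v\<in>closure_dom M D q. closure_form M D q u v = L2_inner M g v)"

text \<open>\<open>z\<close> is in the resolvent set of the operator \<open>T\<close> iff \<open>T - z\<close> maps its domain onto \<open>L\<^sup>2\<close> and is
  injective with bounded inverse; the last two properties amount to the norm estimate.\<close>

definition resolvent_set ::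
  "'a measure \<Rightarrow> (('a \<Rightarrow> complex) \<Rightarrow> ('a \<Rightarrow> complex) \<Rightarrow> bool) \<Rightarrow> complex set" where
  "resolvent_set M T = {z.
     (\<forall>f\<in>L2 M. \<exists>u g. T u g \<and> (AE x in M. g x - z * u x = f x)) \<and>
     (\<exists>C. \<forall>u g. T u g \<longrightarrow> L2_norm M u \<le> C * L2_norm M (\<lambda>x. g x - z * u x))}"

definition spectrum ::
  "'a measure \<Rightarrow> (('a \<Rightarrow> complex) \<Rightarrow> ('a \<Rightarrow> complex) \<Rightarrow> bool) \<Rightarrow> complex set" where
  "spectrum M T = - resolvent_set M T"


section \<open>The generator and the bottom of its spectrum\<close>

text \<open>\<open>C\<^sub>c\<^sup>\<infinity>((0, \<infinity>))\<close>, its elements being extended by zero to the real line.\<close>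

definition test_functions :: "(real \<Rightarrow> complex) set" where
  "test_functions = {\<phi>.
     (\<forall>n x. ((\<lambda>f y. vector_derivative f (at y)) ^^ n) \<phi> differentiable (at x)) \<and>
     (\<exists>r R. 0 < r \<and> (\<forall>x. x \<notin> {r..R} \<longrightarrow> \<phi> x = 0))}"

definition energy :: "(real \<Rightarrow> real) \<Rightarrow> (real \<Rightarrow> complex) \<Rightarrow> (real \<Rightarrow> complex) \<Rightarrow> complex" where
  "energy b \<phi> \<psi> =
     1 / 2 * (LINT x|rho_measure b. vector_derivative \<phi> (at x) * cnj (vector_derivative \<psi> (at x)))"

definition generator :: "(real \<Rightarrow> real) \<Rightarrow> (real \<Rightarrow> complex) \<Rightarrow> (real \<Rightarrow> complex) \<Rightarrow> bool" where
  "generator b = form_operator (rho_measure b) test_functions (energy b)"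

text \<open>The generator is selfadjoint, so its spectrum is real and \<open>Re\<close> only changes the type.\<close>

definition lambda0 :: "(real \<Rightarrow> real) \<Rightarrow> ereal" where
  "lambda0 b = (INF z\<in>spectrum (rho_measure b) (generator b). ereal (Re z))"

end

(* By the form method, 0 < lambda0 says that the energy form dominates a multiple of the square of the
   L2 norm on test functions: if 0 is in the resolvent set and T u = v, then the Cauchy-Schwarz
   inequality for the closed form bounds |v|^2 by a multiple of the energy of v; conversely a lower
   bound c puts {Re z < c} into the resolvent set.  This is a weighted Hardy inequality on the half
   line.  With s(x) = int_0^x 1/rho and R(x) = int_x^oo rho it follows from sup s R < oo, which holds
   near 0 by the exit condition and near oo by A(b,a) < oo.  Conversely, testing it with integrals of
   k/rho, k = 1 on (a,x) and a small negative constant far out, gives A(b,a) < oo, provided that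
   int_1^oo 1/rho = oo.  This last fact is where certain absorption enters: if the scale function were
   bounded, it would be nearly a submartingale along the Euler scheme of the equation, and the
   probability of reaching 1 from 2 would be bounded away from 1. *)
theory Submission
  imports Defs
begin


section \<open>Nonnegative sesquilinear forms\<close>

text \<open>Neither the spectral theorem nor stochastic calculus enters. The spectral bound comes
  from solving (T - z) u = f by a contraction for every complex z to the left of the lower bound of
  the form. On the analytic side the obstacle is that a trial function must return to 0 far out.
  Descending by S over a stretch of scale length S2 adds about S^2 / S2 to the integral of rho f'^2,
  which can be made negligible because the scale function is unbounded. On the probabilistic side
  the process is known only through its paths and a pathwise equation. As the noise is additive, an
  Euler scheme driven by the same noise follows each path with an error of Gronwall type, and
  expectations are needed for the scheme alone, where independence and normality of the increments
  suffice. How fine the scheme must be and how high its barrier depend on the path, hence the upper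
  limits of events. The scheme starts at 2 and is stopped at 1, while the path is followed down to
  1/2: this gap pays for the discretisation error.\<close>

locale nonneg_form =
  fixes D :: "('a \<Rightarrow> complex) set" and q :: "('a \<Rightarrow> complex) \<Rightarrow> ('a \<Rightarrow> complex) \<Rightarrow> complex"
  assumes add_mem: "\<And>f g. f \<in> D \<Longrightarrow> g \<in> D \<Longrightarrow> (\<lambda>x. f x + g x) \<in> D"
    and scale_mem: "\<And>f c. f \<in> D \<Longrightarrow> (\<lambda>x. c * f x) \<in> D"
    and add_left: "\<And>f g h. f \<in> D \<Longrightarrow> g \<in> D \<Longrightarrow> h \<in> D \<Longrightarrow> q (\<lambda>x. f x + g x) h = q f h + q g h"
    and scale_left: "\<And>f g c. f \<in> D \<Longrightarrow> g \<in> D \<Longrightarrow> q (\<lambda>x. c * f x) g = c * q f g"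
    and hermitian: "\<And>f g. f \<in> D \<Longrightarrow> g \<in> D \<Longrightarrow> q g f = cnj (q f g)"
    and nonneg: "\<And>f. f \<in> D \<Longrightarrow> 0 \<le> Re (q f f)"
begin

lemma diff_mem: "f \<in> D \<Longrightarrow> g \<in> D \<Longrightarrow> (\<lambda>x. f x - g x) \<in> D"
  using add_mem[OF _ scale_mem[of g "-1"], of f] by simp

lemma diff_left: "f \<in> D \<Longrightarrow> g \<in> D \<Longrightarrow> h \<in> D \<Longrightarrow> q (\<lambda>x. f x - g x) h = q f h - q g h"
  using add_left[OF _ scale_mem[of g "-1"], of f h] scale_left[of g h "-1"] by simp

lemma add_right: "f \<in> D \<Longrightarrow> g \<in> D \<Longrightarrow> h \<in> D \<Longrightarrow> q h (\<lambda>x. f x + g x) = q h f + q h g"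
  using hermitian[OF add_mem, of f g h] hermitian[of f h] hermitian[of g h] add_left[of f g h] by simp

lemma scale_right: "f \<in> D \<Longrightarrow> g \<in> D \<Longrightarrow> q g (\<lambda>x. c * f x) = cnj c * q g f"
  using hermitian[OF scale_mem, of f g c] hermitian[of f g] scale_left[of f g c] by simp

lemma diff_right: "f \<in> D \<Longrightarrow> g \<in> D \<Longrightarrow> h \<in> D \<Longrightarrow> q h (\<lambda>x. f x - g x) = q h f - q h g"
  using add_right[OF _ scale_mem[of g "-1"], of f h] scale_right[of g h "-1"] by simp

lemma diag_real: "f \<in> D \<Longrightarrow> q f f = of_real (Re (q f f))"
  using hermitian[of f f] by (simp add: complex_eq_iff)

lemma cmod_diag: "f \<in> D \<Longrightarrow> cmod (q f f) = Re (q f f)"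
  using diag_real[of f] nonneg[of f] by (metis abs_of_nonneg norm_of_real)

lemma diag_add_scale:
  assumes f: "f \<in> D" and g: "g \<in> D"
  shows "Re (q (\<lambda>x. f x + c * g x) (\<lambda>x. f x + c * g x))
    = Re (q f f) + 2 * Re (cnj c * q f g) + (cmod c)\<^sup>2 * Re (q g g)"
proof -
  note cg = scale_mem[OF g, of c]
  have "q (\<lambda>x. f x + c * g x) (\<lambda>x. f x + c * g x)
      = q f f + cnj c * q f g + (c * cnj (q f g) + c * cnj c * q g g)"
    using f g cg add_mem[OF f cg]
    by (simp add: add_left add_right scale_left scale_right hermitian[of f g] algebra_simps)
  also have "c * cnj c = of_real ((cmod c)\<^sup>2)"
    by (simp only: complex_norm_square)
  finally show ?thesis by (simp add: algebra_simps)
qed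

text \<open>The form is nonnegative at f - k q(f,g) g; putting the phase of q(f,g) into the
  coefficient lets k stay real. As q may be degenerate, the optimal k = 1 / q(g,g) need not
  exist.\<close>

lemma cauchy_schwarz_sq:
  assumes f: "f \<in> D" and g: "g \<in> D"
  shows "(cmod (q f g))\<^sup>2 \<le> Re (q f f) * Re (q g g)"
proof -
  define n where "n = (cmod (q f g))\<^sup>2"
  have key: "0 \<le> Re (q f f) - 2 * k * n + k\<^sup>2 * n * Re (q g g)" for k :: real
  proof -
    define c where "c = of_real (- k) * q f g"
    have "0 \<le> Re (q f f) + 2 * Re (cnj c * q f g) + (cmod c)\<^sup>2 * Re (q g g)"
      using nonneg[OF add_mem[OF f scale_mem[OF g, of c]]] diag_add_scale[OF f g, of c] by simp
    moreover have "cnj c * q f g = of_real (- k * n)"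
      unfolding c_def n_def of_real_mult complex_norm_square by simp
    moreover have "(cmod c)\<^sup>2 = k\<^sup>2 * n" by (simp add: c_def n_def norm_mult power_mult_distrib)
    ultimately show ?thesis by simp
  qed
  show ?thesis
  proof (cases "Re (q g g) = 0")
    case True
    show ?thesis
    proof (cases "n = 0")
      case False
      \<comment> \<open>The expression is linear in k here, and this k gives it the value
        -1.\<close>
      have "0 \<le> Re (q f f) - 2 * ((Re (q f f) + 1) / (2 * n)) * n"
        using key[of "(Re (q f f) + 1) / (2 * n)"] True by simp
      then show ?thesis using False by (simp add: field_simps)
    qed (use True n_def in simp)
  next
    case False
    then have d: "Re (q g g) > 0" using nonneg[OF g] by simp
    have "0 \<le> Re (q f f) - n / Re (q g g)"
      using key[of "1 / Re (q g g)"] d by (simp add: power2_eq_square field_simps)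
    then show ?thesis using d by (simp add: n_def field_simps)
  qed
qed

text \<open>Only a seminorm: for \<open>L2_inner\<close> it vanishes on all functions that are zero
  almost everywhere.\<close>

definition nrm where "nrm f = sqrt (Re (q f f))"

lemma nrm_nonneg: "f \<in> D \<Longrightarrow> 0 \<le> nrm f"
  by (simp add: nrm_def nonneg)

lemma nrm_sq: "f \<in> D \<Longrightarrow> (nrm f)\<^sup>2 = Re (q f f)"
  by (simp add: nrm_def nonneg)

lemma cauchy_schwarz: "f \<in> D \<Longrightarrow> g \<in> D \<Longrightarrow> cmod (q f g) \<le> nrm f * nrm g"
  using real_sqrt_le_mono[OF cauchy_schwarz_sq[of f g]] by (simp add: nrm_def real_sqrt_mult)

lemma nrm_triangle:
  assumes f: "f \<in> D" and g: "g \<in> D"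
  shows "nrm (\<lambda>x. f x + g x) \<le> nrm f + nrm g"
proof (rule power2_le_imp_le)
  have "Re (q f g) \<le> nrm f * nrm g"
    using cauchy_schwarz[OF f g] complex_Re_le_cmod order_trans by blast
  then show "(nrm (\<lambda>x. f x + g x))\<^sup>2 \<le> (nrm f + nrm g)\<^sup>2"
    using diag_add_scale[OF f g, of 1] f g
    by (simp add: nrm_sq add_mem power2_sum)
qed (use f g nrm_nonneg in simp)

lemma nrm_minus_commute:
  assumes f: "f \<in> D" and g: "g \<in> D"
  shows "nrm (\<lambda>x. f x - g x) = nrm (\<lambda>x. g x - f x)"
  unfolding nrm_def using assms by (simp add: diff_left diff_right diff_mem algebra_simps)

lemma nrm_triangle_diff:
  assumes f: "f \<in> D" and g: "g \<in> D" and h: "h \<in> D"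
  shows "nrm (\<lambda>x. f x - h x) \<le> nrm (\<lambda>x. f x - g x) + nrm (\<lambda>x. g x - h x)"
  using nrm_triangle[OF diff_mem[OF f g] diff_mem[OF g h]] by simp

lemma nrm_triangle_sub:
  assumes f: "f \<in> D" and g: "g \<in> D"
  shows "nrm f \<le> nrm (\<lambda>x. f x - g x) + nrm g"
  using nrm_triangle[OF diff_mem[OF f g] g] by simp

lemma form_diff_le:
  assumes "f \<in> D" "g \<in> D" "f' \<in> D" "g' \<in> D"
  shows "cmod (q f g - q f' g') \<le> nrm (\<lambda>x. f x - f' x) * nrm g + nrm f' * nrm (\<lambda>x. g x - g' x)"
proof -
  have "q f g - q f' g' = q (\<lambda>x. f x - f' x) g + q f' (\<lambda>x. g x - g' x)"
    using assms by (simp add: diff_left diff_right)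
  then show ?thesis
    using norm_triangle_le[OF add_mono[OF cauchy_schwarz cauchy_schwarz]] assms diff_mem by simp
qed

lemma form_diff_tendsto_0:
  assumes mem: "\<And>n. f n \<in> D" "\<And>n. g n \<in> D" "\<And>n. f' n \<in> D" "\<And>n. g' n \<in> D"
    and f: "(\<lambda>n. nrm (\<lambda>x. f n x - f' n x)) \<longlonglongrightarrow> 0"
    and g: "(\<lambda>n. nrm (\<lambda>x. g n x - g' n x)) \<longlonglongrightarrow> 0"
    and bdd: "\<And>n. nrm (g n) \<le> K" "\<And>n. nrm (f' n) \<le> K"
  shows "(\<lambda>n. q (f n) (g n) - q (f' n) (g' n)) \<longlonglongrightarrow> 0"
proof (rule Lim_null_comparison)
  show "\<forall>\<^sub>F n in sequentially. cmod (q (f n) (g n) - q (f' n) (g' n))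
      \<le> nrm (\<lambda>x. f n x - f' n x) * K + K * nrm (\<lambda>x. g n x - g' n x)"
  proof (intro always_eventually allI)
    fix n
    show "cmod (q (f n) (g n) - q (f' n) (g' n))
      \<le> nrm (\<lambda>x. f n x - f' n x) * K + K * nrm (\<lambda>x. g n x - g' n x)"
      by (intro order_trans[OF form_diff_le] add_mono mult_left_mono mult_right_mono
          mem bdd nrm_nonneg diff_mem)
  qed
  show "(\<lambda>n. nrm (\<lambda>x. f n x - f' n x) * K + K * nrm (\<lambda>x. g n x - g' n x)) \<longlonglongrightarrow> 0"
    using tendsto_add[OF tendsto_mult_right[OF f, of K] tendsto_mult_left[OF g, of K]]
    by (simp add: mult.commute)
qed

definition cauchy_seq :: "(nat \<Rightarrow> 'a \<Rightarrow> complex) \<Rightarrow> bool" where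
  "cauchy_seq f \<longleftrightarrow> (\<forall>n. f n \<in> D) \<and>
     (\<forall>e>0. \<exists>N. \<forall>m\<ge>N. \<forall>n\<ge>N. nrm (\<lambda>x. f m x - f n x) < e)"

lemma cauchy_seq_bounded:
  assumes "cauchy_seq f"
  obtains K where "\<And>n. nrm (f n) \<le> K" "0 \<le> K"
proof -
  have mem: "f n \<in> D" for n using assms by (simp add: cauchy_seq_def)
  obtain N where N: "\<And>m n. m \<ge> N \<Longrightarrow> n \<ge> N \<Longrightarrow> nrm (\<lambda>x. f m x - f n x) < 1"
    using assms unfolding cauchy_seq_def by (meson zero_less_one)
  define K where "K = (\<Sum>i\<le>N. nrm (f i)) + 1"
  have le: "nrm (f i) \<le> (\<Sum>i\<le>N. nrm (f i))" if "i \<le> N" for i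
    by (rule member_le_sum) (use that mem nrm_nonneg in auto)
  have "nrm (f n) \<le> K" for n
  proof (cases "n \<le> N")
    case False
    then have "nrm (f n) \<le> 1 + nrm (f N)"
      using nrm_triangle_sub[OF mem mem, of n N] N[of n N] by simp
    then show ?thesis using le[of N] by (simp add: K_def)
  qed (use le K_def in fastforce)
  moreover have "0 \<le> K" using calculation nrm_nonneg[OF mem] order_trans by blast
  ultimately show thesis using that by blast
qed

lemma cauchy_seq_convergent:
  assumes f: "cauchy_seq f" and g: "cauchy_seq g"
  shows "convergent (\<lambda>n. q (f n) (g n))"
proof -
  have mem: "f n \<in> D" "g n \<in> D" for n using assms by (simp_all add: cauchy_seq_def)
  obtain K1 where K1: "\<And>n. nrm (f n) \<le> K1" "0 \<le> K1" using cauchy_seq_bounded[OF f] by blast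
  obtain K2 where K2: "\<And>n. nrm (g n) \<le> K2" "0 \<le> K2" using cauchy_seq_bounded[OF g] by blast
  define K where "K = K1 + K2 + 1"
  have K: "nrm (f n) \<le> K" "nrm (g n) \<le> K" "0 < K" for n
    using K1 K2 by (simp_all add: K_def add_increasing add_increasing2 add.commute)
  have "Cauchy (\<lambda>n. q (f n) (g n))"
  proof (rule CauchyI)
    fix e :: real assume e: "0 < e"
    then have e': "0 < e / (2 * K)" using K by simp
    obtain N1 where N1: "\<And>m n. m \<ge> N1 \<Longrightarrow> n \<ge> N1 \<Longrightarrow> nrm (\<lambda>x. f m x - f n x) < e / (2 * K)"
      using f e' unfolding cauchy_seq_def by meson
    obtain N2 where N2: "\<And>m n. m \<ge> N2 \<Longrightarrow> n \<ge> N2 \<Longrightarrow> nrm (\<lambda>x. g m x - g n x) < e / (2 * K)"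
      using g e' unfolding cauchy_seq_def by meson
    have "cmod (q (f m) (g m) - q (f n) (g n)) < e" if "m \<ge> max N1 N2" "n \<ge> max N1 N2" for m n
    proof -
      have "cmod (q (f m) (g m) - q (f n) (g n))
          \<le> nrm (\<lambda>x. f m x - f n x) * nrm (g m) + nrm (f n) * nrm (\<lambda>x. g m x - g n x)"
        by (intro form_diff_le mem)
      also have "\<dots> \<le> nrm (\<lambda>x. f m x - f n x) * K + K * nrm (\<lambda>x. g m x - g n x)"
        by (intro add_mono mult_left_mono mult_right_mono mem K nrm_nonneg diff_mem)
      also have "\<dots> < e / (2 * K) * K + K * (e / (2 * K))"
        by (intro add_strict_mono mult_strict_right_mono mult_strict_left_mono N1 N2)
           (use that K in auto)
      also have "\<dots> = e" using K by (simp add: field_simps)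
      finally show ?thesis .
    qed
    then show "\<exists>M. \<forall>m\<ge>M. \<forall>n\<ge>M. cmod (q (f m) (g m) - q (f n) (g n)) < e" by blast
  qed
  then show ?thesis by (simp add: Cauchy_convergent_iff)
qed

lemma cauchy_seq_const: "f \<in> D \<Longrightarrow> nrm (\<lambda>x. 0) = 0 \<Longrightarrow> cauchy_seq (\<lambda>_. f)"
  by (simp add: cauchy_seq_def)

lemma nrm_zero: "D \<noteq> {} \<Longrightarrow> nrm (\<lambda>x. 0) = 0"
proof -
  assume "D \<noteq> {}" then obtain f where f: "f \<in> D" by blast
  show ?thesis using scale_left[OF f scale_mem[OF f, of 0], of 0] by (simp add: nrm_def)
qed

end

section \<open>The space \<open>L\<^sup>2\<close>\<close>

lemma borel_measurable_cnj [measurable (raw)]: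
  "f \<in> borel_measurable M \<Longrightarrow> (\<lambda>x. cnj (f x)) \<in> borel_measurable M"
  by (rule borel_measurable_continuous_on[where f = cnj]) (auto intro: continuous_intros)

lemma L2_measurable [measurable_dest]: "f \<in> L2 M \<Longrightarrow> f \<in> borel_measurable M"
  and L2_integrable: "f \<in> L2 M \<Longrightarrow> integrable M (\<lambda>x. (cmod (f x))\<^sup>2)"
  by (simp_all add: L2_def)

lemma L2_mult_integrable:
  assumes f: "f \<in> L2 M" and g: "g \<in> L2 M"
  shows "integrable M (\<lambda>x. f x * cnj (g x))"
proof (rule Bochner_Integration.integrable_bound)
  show "integrable M (\<lambda>x. (cmod (f x))\<^sup>2 + (cmod (g x))\<^sup>2)"
    using L2_integrable[OF f] L2_integrable[OF g] by simp
  show "(\<lambda>x. f x * cnj (g x)) \<in> borel_measurable M"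
    using L2_measurable[OF f] L2_measurable[OF g] by measurable
  have "a * c \<le> a\<^sup>2 + c\<^sup>2" for a c :: real
    using zero_le_power2[of "a + c"] zero_le_power2[of "a - c"] sum_squares_ge_zero[of a c]
    unfolding power2_sum power2_diff by (simp add: power2_eq_square)
  then show "AE x in M. norm (f x * cnj (g x)) \<le> norm ((cmod (f x))\<^sup>2 + (cmod (g x))\<^sup>2)"
    by (simp add: norm_mult)
qed

lemma cmod_add_sq_le: "(cmod (a + c))\<^sup>2 \<le> 2 * (cmod a)\<^sup>2 + 2 * (cmod c)\<^sup>2"
proof -
  have "(cmod (a + c))\<^sup>2 \<le> (cmod a + cmod c)\<^sup>2"
    by (intro power_mono norm_triangle_ineq) simp
  also have "\<dots> \<le> 2 * (cmod a)\<^sup>2 + 2 * (cmod c)\<^sup>2"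
    using zero_le_power2[of "cmod a - cmod c"] by (simp add: power2_eq_square algebra_simps)
  finally show ?thesis .
qed

lemma L2_add:
  assumes f: "f \<in> L2 M" and g: "g \<in> L2 M"
  shows "(\<lambda>x. f x + g x) \<in> L2 M"
proof -
  have [measurable]: "f \<in> borel_measurable M" "g \<in> borel_measurable M"
    using f g by (simp_all add: L2_measurable)
  have "integrable M (\<lambda>x. (cmod (f x + g x))\<^sup>2)"
  proof (rule Bochner_Integration.integrable_bound)
    show "integrable M (\<lambda>x. 2 * (cmod (f x))\<^sup>2 + 2 * (cmod (g x))\<^sup>2)"
      using L2_integrable[OF f] L2_integrable[OF g] by simp
    show "AE x in M. norm ((cmod (f x + g x))\<^sup>2) \<le> norm (2 * (cmod (f x))\<^sup>2 + 2 * (cmod (g x))\<^sup>2)"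
      by (intro always_eventually allI) (simp add: cmod_add_sq_le)
  qed measurable
  then show ?thesis by (simp add: L2_def)
qed

lemma L2_scale: "f \<in> L2 M \<Longrightarrow> (\<lambda>x. c * f x) \<in> L2 M"
  by (auto simp: L2_def norm_mult power_mult_distrib)

lemma L2_zero: "(\<lambda>x. 0) \<in> L2 M"
  by (simp add: L2_def)

interpretation L2: nonneg_form "L2 M" "L2_inner M" for M
proof
  fix f g :: "'a \<Rightarrow> complex" and c :: complex
  assume f: "f \<in> L2 M" and g: "g \<in> L2 M"
  show "L2_inner M (\<lambda>x. f x + g x) h = L2_inner M f h + L2_inner M g h" if "h \<in> L2 M" for h
    using L2_mult_integrable[OF f that] L2_mult_integrable[OF g that]
    by (simp add: L2_inner_def distrib_right)
  show "L2_inner M (\<lambda>x. c * f x) g = c * L2_inner M f g"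
    by (simp add: L2_inner_def mult.assoc)
  show "L2_inner M g f = cnj (L2_inner M f g)"
    using Bochner_Integration.integral_cnj[of M "\<lambda>x. f x * cnj (g x)"] unfolding L2_inner_def
    by (simp add: mult.commute del: Bochner_Integration.integral_cnj)
next
  fix f :: "'a \<Rightarrow> complex" assume f: "f \<in> L2 M"
  have "f x * cnj (f x) = of_real ((cmod (f x))\<^sup>2)" for x
    by (simp only: complex_norm_square)
  then show "0 \<le> Re (L2_inner M f f)" by (simp add: L2_inner_def del: of_real_power)
qed (auto intro: L2_add L2_scale)

lemma L2_norm_eq_nrm: "L2_norm M f = L2.nrm M f"
proof -
  have "f x * cnj (f x) = of_real ((cmod (f x))\<^sup>2)" for x
    by (simp only: complex_norm_square)
  then show ?thesis by (simp add: L2_inner_def L2_norm_def L2.nrm_def del: of_real_power)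
qed

lemma L2_norm_sq: "(L2_norm M f)\<^sup>2 = (LINT x|M. (cmod (f x))\<^sup>2)"
  by (simp add: L2_norm_def)

lemma L2_norm_nonneg: "0 \<le> L2_norm M f"
  by (simp add: L2_norm_def)

lemma L2_norm_cong_AE:
  assumes "AE x in M. f x = g x" "f \<in> borel_measurable M" "g \<in> borel_measurable M"
  shows "L2_norm M f = L2_norm M g"
  unfolding L2_norm_def using assms by (intro arg_cong[of _ _ sqrt] integral_cong_AE) auto

lemma L2_inner_cong_AE:
  assumes "AE x in M. f x = g x" "f \<in> borel_measurable M" "g \<in> borel_measurable M" "h \<in> borel_measurable M"
  shows "L2_inner M f h = L2_inner M g h"
  unfolding L2_inner_def using assms by (intro integral_cong_AE) auto

lemma L2_norm_0_AE:
  assumes "f \<in> L2 M" "L2_norm M f = 0"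
  shows "AE x in M. f x = 0"
proof -
  have "(LINT x|M. (cmod (f x))\<^sup>2) = 0" using assms(2) by (simp add: L2_norm_def)
  then show ?thesis
    using integral_nonneg_eq_0_iff_AE[OF L2_integrable[OF assms(1)]] by simp
qed

lemma L2_inner_tendsto:
  assumes f: "\<And>n. f n \<in> L2 M" "(\<lambda>n. L2_norm M (\<lambda>x. f n x - u x)) \<longlonglongrightarrow> 0" "u \<in> L2 M"
    and g: "\<And>n. g n \<in> L2 M" "(\<lambda>n. L2_norm M (\<lambda>x. g n x - v x)) \<longlonglongrightarrow> 0" "v \<in> L2 M"
  shows "(\<lambda>n. L2_inner M (f n) (g n)) \<longlonglongrightarrow> L2_inner M u v"
proof -
  have "Bseq (\<lambda>n. L2_norm M (\<lambda>x. g n x - v x))"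
    using g(2) by (intro convergent_imp_Bseq convergentI)
  then obtain K where K: "\<And>n. L2_norm M (\<lambda>x. g n x - v x) \<le> K"
    unfolding Bseq_def real_norm_def using abs_le_D1 by blast
  define C where "C = max (K + L2_norm M v) (L2_norm M u)"
  have "L2_norm M (g n) \<le> C" for n
    using L2.nrm_triangle_sub[OF g(1) g(3), of n] K[of n] unfolding L2_norm_eq_nrm C_def by simp
  moreover have "L2_norm M u \<le> C" by (simp add: C_def)
  ultimately have "(\<lambda>n. L2_inner M (f n) (g n) - L2_inner M u v) \<longlonglongrightarrow> 0"
    by (intro L2.form_diff_tendsto_0[where K = C])
       (use f g in \<open>simp_all add: L2_norm_eq_nrm\<close>)
  then show ?thesis by (simp add: LIM_zero_iff)
qed

lemma nn_integral_cmod_sq: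
  "f \<in> L2 M \<Longrightarrow> (\<integral>\<^sup>+x. ennreal ((cmod (f x))\<^sup>2) \<partial>M) = ennreal ((L2_norm M f)\<^sup>2)"
  using nn_integral_eq_integral[OF L2_integrable] by (simp add: L2_norm_sq)

text \<open>Riesz-Fischer: a subsequence with summable increments converges almost everywhere, and
  Fatou's lemma shows that its limit is the limit in norm.\<close>

theorem L2_complete:
  assumes "L2.cauchy_seq M f"
  obtains u where "u \<in> L2 M" "(\<lambda>n. L2_norm M (\<lambda>x. f n x - u x)) \<longlonglongrightarrow> 0"
proof -
  have mem: "f n \<in> L2 M" for n using assms by (simp add: L2.cauchy_seq_def)
  have [measurable]: "f n \<in> borel_measurable M" for n by (rule L2_measurable[OF mem])
  have C: "\<exists>N. \<forall>m\<ge>N. \<forall>n\<ge>N. L2_norm M (\<lambda>x. f m x - f n x) < e" if "e > 0" for e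
    using assms that unfolding L2.cauchy_seq_def L2_norm_eq_nrm by blast
  \<comment> \<open>The rate 1/8 leaves room for the weight \<open>4^k\<close> below: the weighted
    squares stay summable, and once a weighted square is below 1 the increment is at most
    \<open>(1/2)^k\<close>.\<close>
  have "\<exists>N. \<forall>k. \<forall>m\<ge>N k. \<forall>n\<ge>N k. L2_norm M (\<lambda>x. f m x - f n x) < (1/8)^k"
    by (intro choice allI C) simp
  then obtain N where N: "\<And>k m n. m \<ge> N k \<Longrightarrow> n \<ge> N k \<Longrightarrow> L2_norm M (\<lambda>x. f m x - f n x) < (1/8)^k"
    by blast
  \<comment> \<open>The sum makes r monotone and at least N k; the summand k makes r tend to
    infinity, which Fatou's lemma needs.\<close>
  define r where "r k = (\<Sum>i\<le>k. N i) + k" for k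
  have rN: "N k \<le> r k" for k
    using member_le_sum[of k "{..k}" N] by (simp add: r_def)
  have rS: "r k \<le> r (Suc k)" for k by (simp add: r_def)
  have rk: "k \<le> r k" for k by (simp add: r_def)
  have Nr: "N k \<le> r (Suc k)" for k using rN[of k] rS[of k] by simp
  define d where "d k x = f (r (Suc k)) x - f (r k) x" for k x
  have d_mem: "d k \<in> L2 M" for k unfolding d_def by (intro L2.diff_mem mem)
  have [measurable]: "d k \<in> borel_measurable M" for k by (rule L2_measurable[OF d_mem])
  have d_norm: "(L2_norm M (d k))\<^sup>2 \<le> (1/8)^k" for k
  proof -
    have "L2_norm M (d k) \<le> (1/8)^k"
      using N[of k "r (Suc k)" "r k", OF Nr rN] unfolding d_def by simp
    then have "(L2_norm M (d k))\<^sup>2 \<le> ((1/8)^k)\<^sup>2"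
      by (intro power_mono) (simp_all add: L2_norm_nonneg)
    also have "\<dots> \<le> (1/8)^k"
      by (simp add: power2_eq_square mult_left_le power_le_one)
    finally show ?thesis .
  qed
  have "(\<integral>\<^sup>+x. (\<Sum>k. ennreal (4^k * (cmod (d k x))\<^sup>2)) \<partial>M)
      = (\<Sum>k. \<integral>\<^sup>+x. ennreal (4^k * (cmod (d k x))\<^sup>2) \<partial>M)"
    by (intro nn_integral_suminf) measurable
  also have "\<dots> = (\<Sum>k. ennreal (4^k * (L2_norm M (d k))\<^sup>2))"
    by (simp add: ennreal_mult nn_integral_cmult nn_integral_cmod_sq[OF d_mem])
  also have "\<dots> \<le> (\<Sum>k. ennreal ((1/2)^k))"
  proof (intro suminf_le summableI)
    fix k
    have "4^k * (L2_norm M (d k))\<^sup>2 \<le> 4^k * (1/8)^k"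
      by (intro mult_left_mono d_norm) simp
    also have "\<dots> = (4 * (1/8))^k" by (rule power_mult_distrib[symmetric])
    also have "\<dots> = (1/2)^k" by simp
    finally show "ennreal (4^k * (L2_norm M (d k))\<^sup>2) \<le> ennreal ((1/2)^k)" by (rule ennreal_leI)
  qed
  also have "\<dots> = ennreal (\<Sum>k. (1/2)^k)" by (intro suminf_ennreal2) auto
  also have "\<dots> < \<infinity>" by simp
  finally have fin: "(\<integral>\<^sup>+x. (\<Sum>k. ennreal (4^k * (cmod (d k x))\<^sup>2)) \<partial>M) \<noteq> \<infinity>" by simp
  have "AE x in M. (\<Sum>k. ennreal (4^k * (cmod (d k x))\<^sup>2)) \<noteq> \<infinity>"
    by (intro nn_integral_PInf_AE fin) measurable
  then have conv: "AE x in M. convergent (\<lambda>k. f (r k) x)"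
  proof eventually_elim
    fix x assume "(\<Sum>k. ennreal (4^k * (cmod (d k x))\<^sup>2)) \<noteq> \<infinity>"
    then have "summable (\<lambda>k. 4^k * (cmod (d k x))\<^sup>2)"
      by (intro summable_suminf_not_top) auto
    then have "(\<lambda>k. 4^k * (cmod (d k x))\<^sup>2) \<longlonglongrightarrow> 0" by (rule summable_LIMSEQ_zero)
    then have "eventually (\<lambda>k. 4^k * (cmod (d k x))\<^sup>2 < 1) sequentially"
      by (rule order_tendstoD) simp
    then have "eventually (\<lambda>k. norm (d k x) \<le> (1/2)^k) sequentially"
    proof eventually_elim
      case (elim k)
      have "(cmod (d k x))\<^sup>2 \<le> ((1/2)^k)\<^sup>2"
      proof -
        have "((1/2::real)^k)\<^sup>2 = (1/2 * (1/2))^k"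
          by (simp only: power2_eq_square power_mult_distrib)
        also have "\<dots> = 1 / 4^k" by (simp add: power_one_over)
        finally show ?thesis using elim by (simp add: field_simps)
      qed
      then show ?case by (rule power2_le_imp_le) simp
    qed
    then have "summable (\<lambda>k. d k x)"
      by (rule summable_comparison_test_ev) (simp add: summable_geometric)
    then have "convergent (\<lambda>n. \<Sum>k<n. d k x)" by (simp add: summable_iff_convergent)
    moreover have "(\<Sum>k<n. d k x) = f (r n) x - f (r 0) x" for n
      unfolding d_def by (rule sum_lessThan_telescope)
    ultimately have "convergent (\<lambda>n. f (r n) x - f (r 0) x)" by simp
    from convergent_add[OF this convergent_const[of "f (r 0) x"]]
    show "convergent (\<lambda>k. f (r k) x)" by simp
  qed
  define u where "u x = lim (\<lambda>k. f (r k) x)" for x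
  have [measurable]: "u \<in> borel_measurable M" unfolding u_def by measurable
  \<comment> \<open>Fatou's lemma in k with n fixed. Besides convergence it gives the square
    integrability of u, through the difference from a single term of the sequence.\<close>
  have bound: "(\<integral>\<^sup>+x. ennreal ((cmod (f n x - u x))\<^sup>2) \<partial>M) \<le> ennreal (e\<^sup>2)"
    if "e > 0" and K: "\<forall>m\<ge>K. \<forall>n\<ge>K. L2_norm M (\<lambda>x. f m x - f n x) < e" and n: "n \<ge> K" for e K n
  proof -
    have "(\<integral>\<^sup>+x. ennreal ((cmod (f n x - u x))\<^sup>2) \<partial>M)
        = (\<integral>\<^sup>+x. liminf (\<lambda>k. ennreal ((cmod (f n x - f (r k) x))\<^sup>2)) \<partial>M)"
    proof (intro nn_integral_cong_AE, use conv in eventually_elim)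
      fix x assume "convergent (\<lambda>k. f (r k) x)"
      then have "(\<lambda>k. f (r k) x) \<longlonglongrightarrow> u x" by (simp add: u_def convergent_LIMSEQ_iff)
      then have "(\<lambda>k. ennreal ((cmod (f n x - f (r k) x))\<^sup>2)) \<longlonglongrightarrow> ennreal ((cmod (f n x - u x))\<^sup>2)"
        by (intro tendsto_ennrealI tendsto_intros)
      then show "ennreal ((cmod (f n x - u x))\<^sup>2) = liminf (\<lambda>k. ennreal ((cmod (f n x - f (r k) x))\<^sup>2))"
        by (rule lim_imp_Liminf[OF sequentially_bot, symmetric])
    qed
    also have "\<dots> \<le> liminf (\<lambda>k. \<integral>\<^sup>+x. ennreal ((cmod (f n x - f (r k) x))\<^sup>2) \<partial>M)"
      by (intro nn_integral_liminf) measurable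
    also have "\<dots> \<le> ennreal (e\<^sup>2)"
    proof (rule Liminf_le)
      show "\<forall>\<^sub>F k in sequentially. (\<integral>\<^sup>+x. ennreal ((cmod (f n x - f (r k) x))\<^sup>2) \<partial>M) \<le> ennreal (e\<^sup>2)"
      proof (rule eventually_sequentiallyI)
        fix k assume "k \<ge> K"
        then have "L2_norm M (\<lambda>x. f n x - f (r k) x) \<le> e"
          using K[rule_format, of n "r k"] n rk[of k] by simp
        then show "(\<integral>\<^sup>+x. ennreal ((cmod (f n x - f (r k) x))\<^sup>2) \<partial>M) \<le> ennreal (e\<^sup>2)"
          using nn_integral_cmod_sq[OF L2.diff_mem[OF mem mem]]
          by (simp add: ennreal_leI power_mono L2_norm_nonneg)
      qed
    qed simp
    finally show ?thesis .
  qed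
  obtain K1 where K1: "\<forall>m\<ge>K1. \<forall>n\<ge>K1. L2_norm M (\<lambda>x. f m x - f n x) < 1" using C[of 1] by auto
  have "(\<integral>\<^sup>+x. ennreal ((cmod (f K1 x - u x))\<^sup>2) \<partial>M) < \<infinity>"
    using le_less_trans[OF bound[OF zero_less_one K1 order_refl] ennreal_less_top] by simp
  then have "integrable M (\<lambda>x. (cmod (f K1 x - u x))\<^sup>2)"
    by (intro integrableI_bounded) auto
  then have "(\<lambda>x. f K1 x - u x) \<in> L2 M" by (simp add: L2_def)
  from L2.diff_mem[OF mem this, of K1] have u: "u \<in> L2 M" by simp
  have "(\<lambda>n. L2_norm M (\<lambda>x. f n x - u x)) \<longlonglongrightarrow> 0"
  proof (rule LIMSEQ_I)
    fix e :: real assume e: "0 < e"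
    then have e2: "e / 2 > 0" by simp
    obtain K where K: "\<forall>m\<ge>K. \<forall>n\<ge>K. L2_norm M (\<lambda>x. f m x - f n x) < e / 2"
      using C[OF e2] by blast
    have "L2_norm M (\<lambda>x. f n x - u x) < e" if "n \<ge> K" for n
    proof -
      have "ennreal ((L2_norm M (\<lambda>x. f n x - u x))\<^sup>2) \<le> ennreal ((e / 2)\<^sup>2)"
        using bound[OF e2 K that] unfolding nn_integral_cmod_sq[OF L2.diff_mem[OF mem u]] .
      then have "(L2_norm M (\<lambda>x. f n x - u x))\<^sup>2 \<le> (e / 2)\<^sup>2"
        by (rule ennreal_le_iff[THEN iffD1, rotated]) (rule zero_le_power2)
      then have "L2_norm M (\<lambda>x. f n x - u x) \<le> e / 2"
        by (rule power2_le_imp_le) (use e in simp)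
      then show ?thesis using e by simp
    qed
    then have "\<forall>n\<ge>K. norm (L2_norm M (\<lambda>x. f n x - u x) - 0) < e"
      by (simp add: L2_norm_nonneg)
    then show "\<exists>K. \<forall>n\<ge>K. norm (L2_norm M (\<lambda>x. f n x - u x) - 0) < e" ..
  qed
  then show thesis by (rule that[OF u])
qed

section \<open>Closable forms and their operators\<close>

locale closable_form = nonneg_form D q
  for M :: "'a measure" and D :: "('a \<Rightarrow> complex) set" and q +
  assumes sub_L2: "D \<subseteq> L2 M" and nonempty: "D \<noteq> {}"
    and closable: "\<And>\<phi>. form_approx M D q \<phi> (\<lambda>_. 0) \<Longrightarrow> (\<lambda>n. q (\<phi> n) (\<phi> n)) \<longlonglongrightarrow> 0"
begin

abbreviation "approx \<equiv> form_approx M D q"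
abbreviation "cdom \<equiv> closure_dom M D q"
abbreviation "cl \<equiv> closure_form M D q"

lemma in_L2: "f \<in> D \<Longrightarrow> f \<in> L2 M"
  using sub_L2 by blast

lemma approx_iff:
  "approx \<phi> u \<longleftrightarrow> cauchy_seq \<phi> \<and> u \<in> L2 M \<and> (\<lambda>n. L2_norm M (\<lambda>x. \<phi> n x - u x)) \<longlonglongrightarrow> 0"
proof -
  have "(\<forall>e>0. \<exists>N. \<forall>m\<ge>N. \<forall>n\<ge>N. cmod (q (\<lambda>x. \<phi> m x - \<phi> n x) (\<lambda>x. \<phi> m x - \<phi> n x)) < e)
    \<longleftrightarrow> (\<forall>e>0. \<exists>N. \<forall>m\<ge>N. \<forall>n\<ge>N. nrm (\<lambda>x. \<phi> m x - \<phi> n x) < e)" (is "?L \<longleftrightarrow> ?R")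
    if mem: "\<forall>n. \<phi> n \<in> D"
  proof -
    have eq: "cmod (q (\<lambda>x. \<phi> m x - \<phi> n x) (\<lambda>x. \<phi> m x - \<phi> n x)) = (nrm (\<lambda>x. \<phi> m x - \<phi> n x))\<^sup>2" for m n
      using mem by (simp add: cmod_diag nrm_sq diff_mem)
    have lt: "(nrm (\<lambda>x. \<phi> m x - \<phi> n x))\<^sup>2 < e \<longleftrightarrow> nrm (\<lambda>x. \<phi> m x - \<phi> n x) < sqrt e" for m n e
    proof -
      have "sqrt ((nrm (\<lambda>x. \<phi> m x - \<phi> n x))\<^sup>2) = nrm (\<lambda>x. \<phi> m x - \<phi> n x)"
        using mem by (simp add: diff_mem nrm_nonneg)
      then show ?thesis
        using real_sqrt_less_iff[of "(nrm (\<lambda>x. \<phi> m x - \<phi> n x))\<^sup>2" e] by simp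
    qed
    show ?thesis
      unfolding eq lt
    proof
      assume L: "\<forall>e>0. \<exists>N. \<forall>m\<ge>N. \<forall>n\<ge>N. nrm (\<lambda>x. \<phi> m x - \<phi> n x) < sqrt e"
      show ?R
      proof (intro allI impI)
        fix e :: real assume e: "e > 0"
        then have "e\<^sup>2 > 0" "sqrt (e\<^sup>2) = e" by simp_all
        with L show "\<exists>N. \<forall>m\<ge>N. \<forall>n\<ge>N. nrm (\<lambda>x. \<phi> m x - \<phi> n x) < e" by metis
      qed
    qed simp
  qed
  then show ?thesis unfolding form_approx_def cauchy_seq_def by blast
qed

lemma approx_mem: "approx \<phi> u \<Longrightarrow> \<phi> n \<in> D"
  by (simp add: form_approx_def)

lemma approx_L2: "approx \<phi> u \<Longrightarrow> u \<in> L2 M"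
  by (simp add: form_approx_def)

lemma approx_const: "f \<in> D \<Longrightarrow> approx (\<lambda>_. f) f"
  by (simp add: approx_iff cauchy_seq_const nrm_zero[OF nonempty] in_L2 L2_norm_def)

lemma approx_add_scale:
  assumes u: "approx \<phi> u" and v: "approx \<psi> v"
  shows "approx (\<lambda>n x. \<phi> n x + c * \<psi> n x) (\<lambda>x. u x + c * v x)"
proof -
  note mem = approx_mem[OF u] approx_mem[OF v]
  note L = approx_L2[OF u] approx_L2[OF v]
  have nc: "nrm (\<lambda>x. c * f x) = cmod c * nrm f" if "f \<in> D" for f
  proof -
    have "q (\<lambda>x. c * f x) (\<lambda>x. c * f x) = (c * cnj c) * q f f"
      using that by (simp add: scale_left scale_right scale_mem)
    also have "c * cnj c = of_real ((cmod c)\<^sup>2)" by (simp only: complex_norm_square)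
    finally show ?thesis by (simp add: nrm_def real_sqrt_mult del: of_real_power)
  qed
  have nc2: "L2_norm M (\<lambda>x. c * f x) = cmod c * L2_norm M f" for f
    by (simp add: L2_norm_def norm_mult power_mult_distrib real_sqrt_mult)
  have "cauchy_seq (\<lambda>n x. \<phi> n x + c * \<psi> n x)"
    unfolding cauchy_seq_def
  proof (intro conjI allI impI add_mem scale_mem mem)
    fix e :: real assume e: "e > 0"
    define d where "d = e / (2 * (1 + cmod c))"
    have d: "d > 0" using e by (simp add: d_def add_pos_nonneg)
    obtain N1 where N1: "\<And>m n. m \<ge> N1 \<Longrightarrow> n \<ge> N1 \<Longrightarrow> nrm (\<lambda>x. \<phi> m x - \<phi> n x) < d"
      using u d unfolding approx_iff cauchy_seq_def by meson
    obtain N2 where N2: "\<And>m n. m \<ge> N2 \<Longrightarrow> n \<ge> N2 \<Longrightarrow> nrm (\<lambda>x. \<psi> m x - \<psi> n x) < d"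
      using v d unfolding approx_iff cauchy_seq_def by meson
    have "nrm (\<lambda>x. (\<phi> m x + c * \<psi> m x) - (\<phi> n x + c * \<psi> n x)) < e"
      if "m \<ge> max N1 N2" "n \<ge> max N1 N2" for m n
    proof -
      have "nrm (\<lambda>x. (\<phi> m x + c * \<psi> m x) - (\<phi> n x + c * \<psi> n x))
          = nrm (\<lambda>x. (\<phi> m x - \<phi> n x) + c * (\<psi> m x - \<psi> n x))"
        by (simp add: algebra_simps)
      also have "\<dots> \<le> nrm (\<lambda>x. \<phi> m x - \<phi> n x) + cmod c * nrm (\<lambda>x. \<psi> m x - \<psi> n x)"
        using nrm_triangle[OF diff_mem[OF mem(1) mem(1)] scale_mem[OF diff_mem[OF mem(2) mem(2)]], of m n c m n]
        by (simp add: nc diff_mem mem)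
      also have "\<dots> \<le> d + cmod c * d"
        using N1[of m n] N2[of m n] that by (intro add_mono mult_left_mono) auto
      also have "\<dots> = (1 + cmod c) * d" by (simp add: algebra_simps)
      also have "\<dots> = e / 2"
      proof -
        have "1 + cmod c > 0" using norm_ge_zero[of c] by linarith
        then show ?thesis by (simp add: d_def field_simps)
      qed
      also have "\<dots> < e" using e by simp
      finally show ?thesis .
    qed
    then show "\<exists>N. \<forall>m\<ge>N. \<forall>n\<ge>N. nrm (\<lambda>x. (\<phi> m x + c * \<psi> m x) - (\<phi> n x + c * \<psi> n x)) < e" by blast
  qed
  moreover have "(\<lambda>n. L2_norm M (\<lambda>x. (\<phi> n x + c * \<psi> n x) - (u x + c * v x))) \<longlonglongrightarrow> 0"
  proof (rule Lim_null_comparison)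
    have "L2_norm M (\<lambda>x. (\<phi> n x + c * \<psi> n x) - (u x + c * v x))
        \<le> L2_norm M (\<lambda>x. \<phi> n x - u x) + cmod c * L2_norm M (\<lambda>x. \<psi> n x - v x)" for n
    proof -
      have "L2_norm M (\<lambda>x. (\<phi> n x + c * \<psi> n x) - (u x + c * v x))
          = L2_norm M (\<lambda>x. (\<phi> n x - u x) + c * (\<psi> n x - v x))" by (simp add: algebra_simps)
      also have "\<dots> \<le> L2_norm M (\<lambda>x. \<phi> n x - u x) + L2_norm M (\<lambda>x. c * (\<psi> n x - v x))"
        unfolding L2_norm_eq_nrm
        by (intro L2.nrm_triangle L2_scale L2.diff_mem in_L2 mem L)
      finally show ?thesis by (simp add: nc2)
    qed
    then show "\<forall>\<^sub>F n in sequentially. norm (L2_norm M (\<lambda>x. (\<phi> n x + c * \<psi> n x) - (u x + c * v x)))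
        \<le> L2_norm M (\<lambda>x. \<phi> n x - u x) + cmod c * L2_norm M (\<lambda>x. \<psi> n x - v x)"
      by (simp add: L2_norm_nonneg)
    show "(\<lambda>n. L2_norm M (\<lambda>x. \<phi> n x - u x) + cmod c * L2_norm M (\<lambda>x. \<psi> n x - v x)) \<longlonglongrightarrow> 0"
      using u v unfolding approx_iff by (auto intro!: tendsto_eq_intros)
  qed
  ultimately show ?thesis by (simp add: approx_iff L L2_add L2_scale)
qed

lemma approx_diff_nrm:
  assumes "approx \<phi> u" "approx \<phi>' u"
  shows "(\<lambda>n. nrm (\<lambda>x. \<phi> n x - \<phi>' n x)) \<longlonglongrightarrow> 0"
proof -
  have "approx (\<lambda>n x. \<phi> n x - \<phi>' n x) (\<lambda>_. 0)"
    using approx_add_scale[OF assms, of "-1"] by simp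
  from tendsto_real_sqrt[OF tendsto_Re[OF closable[OF this]]]
  show ?thesis by (simp add: nrm_def)
qed

text \<open>This turns the definite description into a limit along any approximating sequences.
  Existence is Cauchy-Schwarz; uniqueness is closability, applied to the difference of two sequences
  with the same limit.\<close>

lemma closure_form_tendsto:
  assumes u: "approx \<phi> u" and v: "approx \<psi> v"
  shows "(\<lambda>n. q (\<phi> n) (\<psi> n)) \<longlonglongrightarrow> cl u v"
proof -
  have cs: "cauchy_seq \<phi>" "cauchy_seq \<psi>" using u v by (simp_all add: approx_iff)
  obtain l where l: "(\<lambda>n. q (\<phi> n) (\<psi> n)) \<longlonglongrightarrow> l"
    using cauchy_seq_convergent[OF cs] by (auto simp: convergent_def)
  have uniq: "l' = l" if u': "approx \<phi>' u" and v': "approx \<psi>' v"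
    and l': "(\<lambda>n. q (\<phi>' n) (\<psi>' n)) \<longlonglongrightarrow> l'" for \<phi>' \<psi>' l'
  proof -
    have cs': "cauchy_seq \<phi>'" using u' by (simp add: approx_iff)
    obtain K1 where K1: "\<And>n. nrm (\<phi>' n) \<le> K1" "0 \<le> K1" using cauchy_seq_bounded[OF cs'] by blast
    obtain K2 where K2: "\<And>n. nrm (\<psi> n) \<le> K2" "0 \<le> K2" using cauchy_seq_bounded[OF cs(2)] by blast
    have "nrm (\<psi> n) \<le> K1 + K2" "nrm (\<phi>' n) \<le> K1 + K2" for n
      using K1 K2 by (simp_all add: add_increasing add_increasing2)
    then have "(\<lambda>n. q (\<phi> n) (\<psi> n) - q (\<phi>' n) (\<psi>' n)) \<longlonglongrightarrow> 0"
      by (intro form_diff_tendsto_0 approx_diff_nrm[OF u u'] approx_diff_nrm[OF v v']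
          approx_mem[OF u] approx_mem[OF v] approx_mem[OF u'] approx_mem[OF v'])
    moreover have "(\<lambda>n. q (\<phi> n) (\<psi> n) - q (\<phi>' n) (\<psi>' n)) \<longlonglongrightarrow> l - l'"
      by (intro tendsto_diff l l')
    ultimately have "0 = l - l'" by (rule LIMSEQ_unique)
    then show ?thesis by simp
  qed
  have "cl u v = l"
    unfolding closure_form_def
  proof (rule the_equality)
    show "\<exists>\<phi> \<psi>. approx \<phi> u \<and> approx \<psi> v \<and> (\<lambda>n. q (\<phi> n) (\<psi> n)) \<longlonglongrightarrow> l"
      using u v l by (intro exI conjI)
  next
    fix l' assume "\<exists>\<phi> \<psi>. approx \<phi> u \<and> approx \<psi> v \<and> (\<lambda>n. q (\<phi> n) (\<psi> n)) \<longlonglongrightarrow> l'"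
    then show "l' = l" by (elim exE conjE) (rule uniq)
  qed
  with l show ?thesis by simp
qed

lemma cdom_approx: "u \<in> cdom \<Longrightarrow> \<exists>\<phi>. approx \<phi> u"
  by (simp add: closure_dom_def)

lemma dom_L2: "u \<in> cdom \<Longrightarrow> u \<in> L2 M"
  using cdom_approx approx_L2 by blast

lemma D_sub_dom: "f \<in> D \<Longrightarrow> f \<in> cdom"
  using approx_const by (auto simp: closure_dom_def)

lemma cl_eq: "f \<in> D \<Longrightarrow> g \<in> D \<Longrightarrow> cl f g = q f g"
  using LIMSEQ_unique[OF closure_form_tendsto[OF approx_const approx_const] tendsto_const] by simp

lemma dom_add_scale: "u \<in> cdom \<Longrightarrow> v \<in> cdom \<Longrightarrow> (\<lambda>x. u x + c * v x) \<in> cdom"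
  unfolding closure_dom_def using approx_add_scale[of _ u _ v c] by blast

lemma dom_zero: "(\<lambda>_. 0) \<in> cdom"
proof -
  obtain f where "f \<in> D" using nonempty by blast
  then show ?thesis using D_sub_dom[OF scale_mem[of f 0]] by simp
qed

lemma cl_add_scale:
  assumes "u \<in> cdom" "v \<in> cdom" "w \<in> cdom"
  shows "cl (\<lambda>x. u x + c * v x) w = cl u w + c * cl v w"
proof -
  obtain \<phi> \<psi> \<eta> where ap: "approx \<phi> u" "approx \<psi> v" "approx \<eta> w" using assms cdom_approx by metis
  have "(\<lambda>n. q (\<lambda>x. \<phi> n x + c * \<psi> n x) (\<eta> n)) \<longlonglongrightarrow> cl (\<lambda>x. u x + c * v x) w"
    by (rule closure_form_tendsto[OF approx_add_scale[OF ap(1,2)] ap(3)])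
  moreover have "q (\<lambda>x. \<phi> n x + c * \<psi> n x) (\<eta> n) = q (\<phi> n) (\<eta> n) + c * q (\<psi> n) (\<eta> n)" for n
    using ap[THEN approx_mem] by (simp add: add_left scale_left scale_mem)
  moreover have "(\<lambda>n. q (\<phi> n) (\<eta> n) + c * q (\<psi> n) (\<eta> n)) \<longlonglongrightarrow> cl u w + c * cl v w"
    by (intro tendsto_intros closure_form_tendsto ap)
  ultimately show ?thesis by (intro LIMSEQ_unique[of "\<lambda>n. q (\<phi> n) (\<eta> n) + c * q (\<psi> n) (\<eta> n)"]) simp_all
qed

sublocale cl: nonneg_form cdom cl
proof
  fix u v assume u: "u \<in> cdom" and v: "v \<in> cdom"
  obtain \<phi> \<psi> where ap: "approx \<phi> u" "approx \<psi> v" using u v cdom_approx by metis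
  show "(\<lambda>x. u x + v x) \<in> cdom" using dom_add_scale[OF u v, of 1] by simp
  show "cl (\<lambda>x. u x + v x) w = cl u w + cl v w" if "w \<in> cdom" for w
    using cl_add_scale[OF u v that, of 1] by simp
  \<comment> \<open>The second instance says cl 0 v = cl 0 v + cl 0 v, so that cl 0 v = 0.\<close>
  show "cl (\<lambda>x. c * u x) v = c * cl u v" for c
    using cl_add_scale[OF dom_zero u v, of c] cl_add_scale[OF dom_zero dom_zero v, of "1"] by simp
  have "q (\<psi> n) (\<phi> n) = cnj (q (\<phi> n) (\<psi> n))" for n
    by (rule hermitian[OF approx_mem[OF ap(1)] approx_mem[OF ap(2)]])
  then have "(\<lambda>n. q (\<psi> n) (\<phi> n)) \<longlonglongrightarrow> cnj (cl u v)"
    using tendsto_cnj[OF closure_form_tendsto[OF ap]] by simp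
  then show "cl v u = cnj (cl u v)"
    by (rule LIMSEQ_unique[OF closure_form_tendsto[OF ap(2,1)]])
next
  fix u assume u: "u \<in> cdom"
  show "(\<lambda>x. c * u x) \<in> cdom" for c using dom_add_scale[OF dom_zero u, of c] by simp
  obtain \<phi> where ap: "approx \<phi> u" using u cdom_approx by metis
  show "0 \<le> Re (cl u u)"
    by (rule LIMSEQ_le_const[OF tendsto_Re[OF closure_form_tendsto[OF ap ap]]])
       (use nonneg[OF approx_mem[OF ap]] in blast)
qed

text \<open>The core is dense in the domain of the closure for the form seminorm, because for fixed
  n the sequence \<phi> n - \<phi> m, m \<rightarrow> \<infinity>, approximates \<phi> n - u.
  Identities proved on the core thereby extend to the closure.\<close>

lemma approx_cl_nrm:
  assumes ap: "approx \<phi> u"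
  shows "(\<lambda>n. cl.nrm (\<lambda>x. \<phi> n x - u x)) \<longlonglongrightarrow> 0"
proof (rule LIMSEQ_I)
  fix e :: real assume e: "e > 0"
  note mem = approx_mem[OF ap]
  obtain N where N: "\<And>m n. m \<ge> N \<Longrightarrow> n \<ge> N \<Longrightarrow> nrm (\<lambda>x. \<phi> m x - \<phi> n x) < e / 2"
    using ap e unfolding approx_iff cauchy_seq_def by (meson half_gt_zero)
  have "cl.nrm (\<lambda>x. \<phi> n x - u x) \<le> e / 2" if n: "n \<ge> N" for n
  proof -
    have ap2: "approx (\<lambda>m x. \<phi> n x - \<phi> m x) (\<lambda>x. \<phi> n x - u x)"
      using approx_add_scale[OF approx_const[OF mem] ap, of n "-1"] by simp
    have "(\<lambda>m. nrm (\<lambda>x. \<phi> n x - \<phi> m x)) \<longlonglongrightarrow> cl.nrm (\<lambda>x. \<phi> n x - u x)"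
      unfolding nrm_def cl.nrm_def
      by (intro tendsto_real_sqrt tendsto_Re closure_form_tendsto[OF ap2 ap2])
    then show ?thesis by (rule LIMSEQ_le_const2) (use N[OF n] less_imp_le in blast)
  qed
  moreover have "u \<in> cdom" using ap by (auto simp: closure_dom_def)
  then have "cl.nrm (\<lambda>x. \<phi> n x - u x) \<ge> 0" for n
    by (intro cl.nrm_nonneg cl.diff_mem D_sub_dom[OF mem])
  ultimately have "norm (cl.nrm (\<lambda>x. \<phi> n x - u x) - 0) < e" if "n \<ge> N" for n
    using e that by (metis abs_of_nonneg diff_zero field_sum_of_halves le_less_trans less_add_same_cancel1
        half_gt_zero real_norm_def)
  then show "\<exists>N. \<forall>n\<ge>N. norm (cl.nrm (\<lambda>x. \<phi> n x - u x) - 0) < e" by blast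
qed

lemma cl_tendsto_right:
  assumes w: "w \<in> cdom" and ap: "approx \<phi> u"
  shows "(\<lambda>n. cl w (\<phi> n)) \<longlonglongrightarrow> cl w u"
proof -
  have u: "u \<in> cdom" using ap by (auto simp: closure_dom_def)
  have "(\<lambda>n. cl w (\<phi> n) - cl w u) \<longlonglongrightarrow> 0"
  proof (rule Lim_null_comparison)
    show "\<forall>\<^sub>F n in sequentially. norm (cl w (\<phi> n) - cl w u) \<le> cl.nrm w * cl.nrm (\<lambda>x. \<phi> n x - u x)"
      using cl.cauchy_schwarz[OF w cl.diff_mem[OF D_sub_dom[OF approx_mem[OF ap]] u]]
        cl.diff_right[OF D_sub_dom[OF approx_mem[OF ap]] u w]
      by (intro always_eventually allI) simp
    show "(\<lambda>n. cl.nrm w * cl.nrm (\<lambda>x. \<phi> n x - u x)) \<longlonglongrightarrow> 0"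
      using tendsto_mult_left[OF approx_cl_nrm[OF ap], of "cl.nrm w"] by simp
  qed
  then show ?thesis by (simp add: LIM_zero_iff)
qed

lemma L2_inner_tendsto_right:
  assumes w: "w \<in> L2 M" and ap: "approx \<phi> u"
  shows "(\<lambda>n. L2_inner M w (\<phi> n)) \<longlonglongrightarrow> L2_inner M w u"
  using ap w by (intro L2_inner_tendsto) (auto simp: form_approx_def L2_norm_def intro: in_L2)

lemma lower_bound_closure:
  assumes c: "\<And>f. f \<in> D \<Longrightarrow> c * (L2_norm M f)\<^sup>2 \<le> Re (q f f)" and u: "u \<in> cdom"
  shows "c * (L2_norm M u)\<^sup>2 \<le> Re (cl u u)"
proof -
  obtain \<phi> where ap: "approx \<phi> u" using u cdom_approx by metis
  have norm_sq: "(L2_norm M f)\<^sup>2 = Re (L2_inner M f f)" if "f \<in> L2 M" for f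
    using L2.nrm_sq[OF that] by (simp add: L2_norm_eq_nrm)
  have "(\<lambda>n. L2_inner M (\<phi> n) (\<phi> n)) \<longlonglongrightarrow> L2_inner M u u"
    using ap by (intro L2_inner_tendsto) (auto simp: form_approx_def intro: in_L2)
  then have "(\<lambda>n. c * Re (L2_inner M (\<phi> n) (\<phi> n))) \<longlonglongrightarrow> c * Re (L2_inner M u u)"
    by (intro tendsto_intros)
  from LIMSEQ_le[OF this tendsto_Re[OF closure_form_tendsto[OF ap ap]]]
  show ?thesis
    using c[OF approx_mem[OF ap]] norm_sq[OF in_L2[OF approx_mem[OF ap]]] norm_sq[OF dom_L2[OF u]] by simp
qed

text \<open>If \<open>T u = v\<close> then \<open>\<parallel>v\<parallel>\<^sup>4 = \<bar>cl u v\<bar>\<^sup>2 \<le> cl u u * q v v\<close>, and \<open>cl u u = \<langle>v, u\<rangle>\<close> is at most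
  \<open>\<parallel>v\<parallel>\<^sup>2\<close> times the norm of the inverse.\<close>

lemma zero_resolvent_imp_lower_bound:
  assumes "0 \<in> resolvent_set M (form_operator M D q)"
  obtains C where "C \<ge> 0" "\<And>v. v \<in> D \<Longrightarrow> (L2_norm M v)\<^sup>2 \<le> C * Re (q v v)"
proof -
  from assms obtain C where C: "\<And>u g. form_operator M D q u g \<Longrightarrow> L2_norm M u \<le> C * L2_norm M g"
    and surj: "\<And>f. f \<in> L2 M \<Longrightarrow> \<exists>u g. form_operator M D q u g \<and> (AE x in M. g x = f x)"
    unfolding resolvent_set_def by auto
  have "(L2_norm M v)\<^sup>2 \<le> max 0 C * Re (q v v)" if v: "v \<in> D" for v
  proof -
    note vL = in_L2[OF v]
    define N where "N = (L2_norm M v)\<^sup>2"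
    obtain u g where T: "form_operator M D q u g" and ae: "AE x in M. g x = v x"
      using surj[OF vL] by blast
    have u: "u \<in> cdom" and g: "g \<in> L2 M"
      and eq: "\<And>w. w \<in> cdom \<Longrightarrow> cl u w = L2_inner M g w"
      using T by (auto simp: form_operator_def)
    have inner: "L2_inner M g w = L2_inner M v w" if "w \<in> L2 M" for w
      using L2_inner_cong_AE[OF ae] L2_measurable[OF g] L2_measurable[OF vL] L2_measurable[OF that] by blast
    have gv: "L2_norm M g = L2_norm M v"
      using L2_norm_cong_AE[OF ae] L2_measurable[OF g] L2_measurable[OF vL] by blast
    have "cl u v = L2_inner M v v" using eq[OF D_sub_dom[OF v]] inner[OF vL] by simp
    then have "cmod (cl u v) = N"
      using L2.cmod_diag[OF vL] L2.nrm_sq[OF vL] by (simp add: N_def L2_norm_eq_nrm)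
    then have "N\<^sup>2 \<le> Re (cl u u) * Re (q v v)"
      using cl.cauchy_schwarz_sq[OF u D_sub_dom[OF v]] by (simp add: cl_eq v)
    also have "\<dots> \<le> (max 0 C * N) * Re (q v v)"
    proof (rule mult_right_mono[OF _ nonneg[OF v]])
      have "Re (cl u u) \<le> cmod (L2_inner M v u)"
        using eq[OF u] inner[OF dom_L2[OF u]] complex_Re_le_cmod by simp
      also have "\<dots> \<le> L2_norm M v * L2_norm M u"
        using L2.cauchy_schwarz[OF vL dom_L2[OF u]] by (simp add: L2_norm_eq_nrm)
      also have "\<dots> \<le> L2_norm M v * (max 0 C * L2_norm M v)"
        using C[OF T] gv L2_norm_nonneg[of M v]
        by (intro mult_left_mono order_trans[OF C[OF T]]) (auto intro: mult_right_mono)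
      finally show "Re (cl u u) \<le> max 0 C * N" by (simp add: N_def power2_eq_square mult_ac)
    qed
    finally have "N * N \<le> N * (max 0 C * Re (q v v))" by (simp add: power2_eq_square mult_ac)
    then show ?thesis
      using nonneg[OF v] mult_le_cancel_left_pos[of N N "max 0 C * Re (q v v)"]
      unfolding N_def[symmetric] by (cases "N = 0") (auto simp: N_def less_le)
  qed
  then show thesis using that[of "max 0 C"] by simp
qed

end

section \<open>Weak solutions and the resolvent in a half plane\<close>

context closable_form
begin

lemma L2_norm_inner: "f \<in> L2 M \<Longrightarrow> (L2_norm M f)\<^sup>2 = Re (L2_inner M f f)"
  using L2.nrm_sq[of f M] by (simp add: L2_norm_eq_nrm)

text \<open>For \<kappa> > 0 the shifted form controls \<open>q\<close> and the L2 norm together, so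
  that one Cauchy estimate yields both parts of \<open>form_approx\<close>.\<close>

definition shift_form :: "real \<Rightarrow> ('a \<Rightarrow> complex) \<Rightarrow> ('a \<Rightarrow> complex) \<Rightarrow> complex" where
  "shift_form \<kappa> f g = q f g + of_real \<kappa> * L2_inner M f g"

lemma nonneg_form_shift:
  assumes "\<kappa> \<ge> 0"
  shows "nonneg_form D (shift_form \<kappa>)"
proof
  fix f g assume fg: "f \<in> D" "g \<in> D"
  note L = in_L2[OF fg(1)] in_L2[OF fg(2)]
  show "shift_form \<kappa> (\<lambda>x. f x + g x) h = shift_form \<kappa> f h + shift_form \<kappa> g h" if "h \<in> D" for h
    using fg that L in_L2[OF that] by (simp add: shift_form_def add_left L2.add_left algebra_simps)
  show "shift_form \<kappa> (\<lambda>x. c * f x) g = c * shift_form \<kappa> f g" for c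
    using fg L by (simp add: shift_form_def scale_left L2.scale_left algebra_simps)
  show "shift_form \<kappa> g f = cnj (shift_form \<kappa> f g)"
    using hermitian[OF fg] L2.hermitian[OF L] by (simp add: shift_form_def)
next
  fix f assume f: "f \<in> D"
  show "0 \<le> Re (shift_form \<kappa> f f)"
    using nonneg[OF f] L2.nonneg[OF in_L2[OF f]] assms by (simp add: shift_form_def)
qed (auto intro: add_mem scale_mem)

text \<open>A minimising sequence of \<open>\<phi> \<mapsto> q \<phi> \<phi> + \<kappa> \<parallel>\<phi>\<parallel>\<^sup>2 - 2 Re \<langle>f, \<phi>\<rangle>\<close> is Cauchy by the parallelogram law,
  and its limit solves the equation.\<close>

lemma exists_weak_solution:
  assumes \<kappa>: "\<kappa> > 0" and f: "f \<in> L2 M"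
  obtains u where "u \<in> cdom" "\<And>v. v \<in> cdom \<Longrightarrow> cl u v + of_real \<kappa> * L2_inner M u v = L2_inner M f v"
proof -
  interpret a: nonneg_form D "shift_form \<kappa>"
    using \<kappa> by (intro nonneg_form_shift) simp
  define J where "J \<phi> = Re (shift_form \<kappa> \<phi> \<phi>) - 2 * Re (L2_inner M f \<phi>)" for \<phi>
  have a_sq: "(a.nrm \<phi>)\<^sup>2 = (nrm \<phi>)\<^sup>2 + \<kappa> * (L2_norm M \<phi>)\<^sup>2" if "\<phi> \<in> D" for \<phi>
    using that in_L2[OF that] by (simp add: a.nrm_sq nrm_sq L2_norm_inner shift_form_def)
  \<comment> \<open>Complete the square in the L2 norm of \<phi>; the minimum is at norm ||f|| /
    \<kappa>.\<close>
  have J_lower: "J \<phi> \<ge> - (L2_norm M f)\<^sup>2 / \<kappa>" if "\<phi> \<in> D" for \<phi>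
  proof -
    define A B where "A = L2_norm M f" and "B = L2_norm M \<phi>"
    have "Re (L2_inner M f \<phi>) \<le> A * B"
      using L2.cauchy_schwarz[OF f in_L2[OF that]] complex_Re_le_cmod order_trans
      unfolding A_def B_def L2_norm_eq_nrm by blast
    moreover have "Re (shift_form \<kappa> \<phi> \<phi>) \<ge> \<kappa> * B\<^sup>2"
      using nonneg[OF that] L2_norm_inner[OF in_L2[OF that]] by (simp add: shift_form_def B_def)
    moreover have "\<kappa> * B\<^sup>2 - 2 * (A * B) + A\<^sup>2 / \<kappa> = (\<kappa> * B - A)\<^sup>2 / \<kappa>"
      using \<kappa> by (simp add: field_simps power2_eq_square)
    moreover have "(\<kappa> * B - A)\<^sup>2 / \<kappa> \<ge> 0" using \<kappa> by simp
    ultimately show ?thesis unfolding J_def A_def[symmetric] by simp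
  qed
  define j where "j = Inf (J ` D)"
  have bdd: "bdd_below (J ` D)" using J_lower by (intro bdd_belowI2)
  have j_le: "j \<le> J \<phi>" if "\<phi> \<in> D" for \<phi>
    unfolding j_def using bdd that by (intro cInf_lower) auto
  have "\<exists>\<phi>\<in>D. J \<phi> < j + inverse (real (Suc n))" for n
  proof -
    have "Inf (J ` D) < j + inverse (real (Suc n))" by (simp add: j_def)
    then show ?thesis using cInf_lessD[of "J ` D"] nonempty by blast
  qed
  then obtain \<phi> where mem: "\<And>n. \<phi> n \<in> D" and J\<phi>: "\<And>n. J (\<phi> n) < j + inverse (real (Suc n))"
    by metis
  have close: "(a.nrm (\<lambda>x. \<phi> m x - \<phi> n x))\<^sup>2 \<le> 2 * inverse (real (Suc m)) + 2 * inverse (real (Suc n))" for m n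
  proof -
    define t :: complex where "t = 1 / 2"
    define h where "h x = t * \<phi> m x + t * \<phi> n x" for x
    have half: "(\<lambda>x. t * \<phi> k x) \<in> D" for k by (intro scale_mem mem)
    have h: "h \<in> D" unfolding h_def by (intro add_mem half)
    have "shift_form \<kappa> h h = t * cnj t * (shift_form \<kappa> (\<phi> m) (\<phi> m) + shift_form \<kappa> (\<phi> m) (\<phi> n)
        + shift_form \<kappa> (\<phi> n) (\<phi> m) + shift_form \<kappa> (\<phi> n) (\<phi> n))"
      unfolding h_def using mem half
      by (simp add: a.add_left a.add_right a.scale_left a.scale_right a.add_mem algebra_simps)
    then have "shift_form \<kappa> (\<lambda>x. \<phi> m x - \<phi> n x) (\<lambda>x. \<phi> m x - \<phi> n x)
      = 2 * shift_form \<kappa> (\<phi> m) (\<phi> m) + 2 * shift_form \<kappa> (\<phi> n) (\<phi> n) - 4 * shift_form \<kappa> h h"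
      using mem by (simp add: a.diff_left a.diff_right a.diff_mem t_def algebra_simps)
    moreover have "L2_inner M f h = cnj t * L2_inner M f (\<phi> m) + cnj t * L2_inner M f (\<phi> n)"
      unfolding h_def using f in_L2[OF mem] in_L2[OF half]
      by (simp add: L2.add_right L2.scale_right)
    ultimately have "(a.nrm (\<lambda>x. \<phi> m x - \<phi> n x))\<^sup>2 = 2 * J (\<phi> m) + 2 * J (\<phi> n) - 4 * J h"
      by (simp add: a.nrm_sq diff_mem mem J_def t_def)
    then show ?thesis using J\<phi>[of m] J\<phi>[of n] j_le[OF h] by simp
  qed
  have small: "\<exists>N. \<forall>m\<ge>N. \<forall>n\<ge>N. (a.nrm (\<lambda>x. \<phi> m x - \<phi> n x))\<^sup>2 < e" if "e > 0" for e
  proof -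
    obtain N where N: "inverse (real (Suc N)) < e / 4" using reals_Archimedean[of "e / 4"] \<open>e > 0\<close> by (metis divide_pos_pos zero_less_numeral)
    have "(a.nrm (\<lambda>x. \<phi> m x - \<phi> n x))\<^sup>2 < e" if "m \<ge> N" "n \<ge> N" for m n
    proof -
      have "inverse (real (Suc k)) < e / 4" if "k \<ge> N" for k
        using le_less_trans[OF _ N] that by (simp add: le_imp_inverse_le)
      from this[OF \<open>m \<ge> N\<close>] this[OF \<open>n \<ge> N\<close>] close[of m n] show ?thesis by simp
    qed
    then show ?thesis by blast
  qed
  have "cauchy_seq \<phi>"
    unfolding cauchy_seq_def
  proof (intro conjI allI impI mem)
    fix e :: real assume e: "e > 0"
    then obtain N where N: "\<And>m n. m \<ge> N \<Longrightarrow> n \<ge> N \<Longrightarrow> (a.nrm (\<lambda>x. \<phi> m x - \<phi> n x))\<^sup>2 < e\<^sup>2"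
      using small[of "e\<^sup>2"] by auto
    have "nrm (\<lambda>x. \<phi> m x - \<phi> n x) < e" if "m \<ge> N" "n \<ge> N" for m n
    proof -
      have "(nrm (\<lambda>x. \<phi> m x - \<phi> n x))\<^sup>2 < e\<^sup>2"
        using N[OF that] a_sq[OF diff_mem[OF mem mem], of m n]
          mult_nonneg_nonneg[OF less_imp_le[OF \<kappa>] zero_le_power2[of "L2_norm M (\<lambda>x. \<phi> m x - \<phi> n x)"]]
        by linarith
      then show ?thesis by (rule power2_less_imp_less) (use e in simp)
    qed
    then show "\<exists>N. \<forall>m\<ge>N. \<forall>n\<ge>N. nrm (\<lambda>x. \<phi> m x - \<phi> n x) < e" by blast
  qed
  have "L2.cauchy_seq M \<phi>"
    unfolding L2.cauchy_seq_def
  proof (intro conjI allI impI in_L2 mem)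
    fix e :: real assume e: "e > 0"
    then obtain N where N: "\<And>m n. m \<ge> N \<Longrightarrow> n \<ge> N \<Longrightarrow> (a.nrm (\<lambda>x. \<phi> m x - \<phi> n x))\<^sup>2 < \<kappa> * e\<^sup>2"
      using small[of "\<kappa> * e\<^sup>2"] \<kappa> by auto
    have "L2.nrm M (\<lambda>x. \<phi> m x - \<phi> n x) < e" if "m \<ge> N" "n \<ge> N" for m n
    proof -
      have "\<kappa> * (L2.nrm M (\<lambda>x. \<phi> m x - \<phi> n x))\<^sup>2 < \<kappa> * e\<^sup>2"
        using N[OF that] a_sq[OF diff_mem[OF mem mem], of m n] zero_le_power2[of "nrm (\<lambda>x. \<phi> m x - \<phi> n x)"]
        unfolding L2_norm_eq_nrm by linarith
      then have "(L2.nrm M (\<lambda>x. \<phi> m x - \<phi> n x))\<^sup>2 < e\<^sup>2" using \<kappa> by simp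
      then show ?thesis by (rule power2_less_imp_less) (use e in simp)
    qed
    then show "\<exists>N. \<forall>m\<ge>N. \<forall>n\<ge>N. L2.nrm M (\<lambda>x. \<phi> m x - \<phi> n x) < e" by blast
  qed
  then obtain u where u: "u \<in> L2 M" "(\<lambda>n. L2_norm M (\<lambda>x. \<phi> n x - u x)) \<longlonglongrightarrow> 0"
    by (rule L2_complete)
  have ap: "approx \<phi> u" using u \<open>cauchy_seq \<phi>\<close> by (simp add: approx_iff)
  then have cdom: "u \<in> cdom" by (auto simp: closure_dom_def)
  define E where "E v = cl u v + of_real \<kappa> * L2_inner M u v - L2_inner M f v" for v
  have Re0: "Re (E v) = 0" if v: "v \<in> D" for v
  proof -
    have lim: "(\<lambda>n. Re (shift_form \<kappa> (\<phi> n) v - L2_inner M f v)) \<longlonglongrightarrow> Re (E v)"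
      unfolding shift_form_def E_def
      by (intro tendsto_intros closure_form_tendsto[OF ap approx_const[OF v]]
          L2_inner_tendsto[OF in_L2[OF mem] u(2,1) in_L2[OF v] _ in_L2[OF v]])
         (simp add: L2_norm_def)
    \<comment> \<open>Compare J at \<phi> n + s v with the infimum j: J (\<phi> n) exceeds j by at
      most 1/(n+1), and this excess disappears in the limit.\<close>
    have pos: "0 \<le> 2 * s * Re (E v) + s\<^sup>2 * Re (shift_form \<kappa> v v)" for s
    proof (rule LIMSEQ_le_const)
      have "(\<lambda>n. inverse (real (Suc n)) + 2 * s * Re (shift_form \<kappa> (\<phi> n) v - L2_inner M f v)
            + s\<^sup>2 * Re (shift_form \<kappa> v v)) \<longlonglongrightarrow> 0 + 2 * s * Re (E v) + s\<^sup>2 * Re (shift_form \<kappa> v v)"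
        by (intro tendsto_add tendsto_mult_left lim tendsto_const LIMSEQ_inverse_real_of_nat)
      then show "(\<lambda>n. inverse (real (Suc n)) + 2 * s * Re (shift_form \<kappa> (\<phi> n) v - L2_inner M f v)
            + s\<^sup>2 * Re (shift_form \<kappa> v v)) \<longlonglongrightarrow> 2 * s * Re (E v) + s\<^sup>2 * Re (shift_form \<kappa> v v)" by simp
      have "0 \<le> inverse (real (Suc n)) + 2 * s * Re (shift_form \<kappa> (\<phi> n) v - L2_inner M f v)
            + s\<^sup>2 * Re (shift_form \<kappa> v v)" for n
      proof -
        define w where "w x = \<phi> n x + of_real s * v x" for x
        have w: "w \<in> D" unfolding w_def by (intro add_mem scale_mem mem v)
        have "Re (shift_form \<kappa> w w) = Re (shift_form \<kappa> (\<phi> n) (\<phi> n)) + 2 * Re (cnj (of_real s) * shift_form \<kappa> (\<phi> n) v)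
            + (cmod (of_real s))\<^sup>2 * Re (shift_form \<kappa> v v)"
          unfolding w_def by (rule a.diag_add_scale[OF mem v])
        moreover have "L2_inner M f w = L2_inner M f (\<phi> n) + of_real s * L2_inner M f v"
          unfolding w_def using f in_L2[OF mem] in_L2[OF v]
          by (simp add: L2.add_right L2.scale_right L2_scale)
        ultimately have "J w = J (\<phi> n) + 2 * s * Re (shift_form \<kappa> (\<phi> n) v - L2_inner M f v) + s\<^sup>2 * Re (shift_form \<kappa> v v)"
          by (simp add: J_def algebra_simps)
        then show ?thesis using j_le[OF w] J\<phi>[of n] by simp
      qed
      then show "\<exists>N. \<forall>n\<ge>N. 0 \<le> inverse (real (Suc n)) + 2 * s * Re (shift_form \<kappa> (\<phi> n) v - L2_inner M f v)
            + s\<^sup>2 * Re (shift_form \<kappa> v v)" by blast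
    qed
    define r A where "r = Re (E v)" and "A = Re (shift_form \<kappa> v v)"
    have A: "A \<ge> 0" using a.nonneg[OF v] by (simp add: A_def)
    \<comment> \<open>With this s the quadratic expression equals -s^2 (A + 2), which is negative
      unless r = 0. The 1 keeps the denominator positive.\<close>
    define s where "s = - r / (A + 1)"
    have r: "r = - s * (A + 1)" using A by (simp add: s_def)
    have "0 \<le> 2 * s * r + s\<^sup>2 * A" using pos[of s] by (simp add: r_def A_def)
    also have "\<dots> = - (s\<^sup>2 * (A + 2))" unfolding r by (simp add: power2_eq_square algebra_simps)
    finally have "s\<^sup>2 * (A + 2) \<le> 0" by simp
    then have "s = 0" using A by (simp add: mult_le_0_iff)
    then have "r = 0" using r by simp
    then show ?thesis by (simp add: r_def)
  qed
  have E0: "E v = 0" if v: "v \<in> D" for v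
  proof -
    \<comment> \<open>E is antilinear, so the real part of E at i v is the imaginary part of E
      v.\<close>
    have "E (\<lambda>x. \<i> * v x) = cnj \<i> * E v"
      using v cdom D_sub_dom[OF v] in_L2[OF v] u(1) f
      by (simp add: E_def cl.scale_right L2.scale_right algebra_simps)
    then have "Im (E v) = 0" using Re0[OF scale_mem[OF v, of \<i>]] by simp
    then show ?thesis using Re0[OF v] by (simp add: complex_eq_iff)
  qed
  have "E v = 0" if v: "v \<in> cdom" for v
  proof -
    obtain \<psi> where ps: "approx \<psi> v" using v cdom_approx by metis
    have "(\<lambda>n. E (\<psi> n)) \<longlonglongrightarrow> E v"
      unfolding E_def by (intro tendsto_intros cl_tendsto_right[OF cdom ps]
          L2_inner_tendsto_right[OF u(1) ps] L2_inner_tendsto_right[OF f ps])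
    then show ?thesis using E0[OF approx_mem[OF ps]] by (simp add: LIMSEQ_const_iff)
  qed
  then show thesis using that[OF cdom] by (simp add: E_def)
qed

text \<open>For \<open>\<kappa>\<close> large, \<open>u \<mapsto> (T + \<kappa>)\<^sup>-\<^sup>1 (f + (z + \<kappa>) u)\<close> is a contraction of \<open>L\<^sup>2\<close>.\<close>

lemma half_plane_resolvent:
  assumes c: "c > 0" "\<And>f. f \<in> D \<Longrightarrow> c * (L2_norm M f)\<^sup>2 \<le> Re (q f f)" and z: "Re z < c"
  shows "z \<in> resolvent_set M (form_operator M D q)"
proof -
  have lower: "c * (L2_norm M u)\<^sup>2 \<le> Re (cl u u)" if "u \<in> cdom" for u
    by (rule lower_bound_closure[OF c(2) that])
  \<comment> \<open>Test g - z u with u: the real part is cl u u - Re z ||u||^2, hence at least (c -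
    Re z) ||u||^2.\<close>
  have inj: "L2_norm M u \<le> inverse (c - Re z) * L2_norm M (\<lambda>x. g x - z * u x)"
    if T: "form_operator M D q u g" for u g
  proof -
    have u: "u \<in> cdom" "u \<in> L2 M" and g: "g \<in> L2 M" and eq: "cl u u = L2_inner M g u"
      using T by (auto simp: form_operator_def dom_L2)
    define N h where "N = L2_norm M u" and "h x = g x - z * u x" for x
    have h: "h \<in> L2 M" unfolding h_def by (intro L2.diff_mem g L2_scale u)
    have "L2_inner M h u = L2_inner M g u - z * L2_inner M u u"
      unfolding h_def using g u by (simp add: L2.diff_left L2.scale_left L2_scale)
    moreover have "L2_inner M u u = of_real (N\<^sup>2)"
      unfolding N_def L2_norm_inner[OF u(2)] by (rule L2.diag_real[OF u(2)])
    ultimately have "Re (L2_inner M h u) = Re (cl u u) - Re z * N\<^sup>2"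
      using eq by (simp del: of_real_power)
    moreover have "Re (L2_inner M h u) \<le> L2_norm M h * N"
      using L2.cauchy_schwarz[OF h u(2)] complex_Re_le_cmod order_trans
      unfolding N_def L2_norm_eq_nrm by blast
    ultimately have "(c - Re z) * N\<^sup>2 \<le> L2_norm M h * N"
      using lower[OF u(1)] by (simp add: N_def algebra_simps)
    then have "N * ((c - Re z) * N) \<le> N * L2_norm M h" by (simp add: power2_eq_square mult_ac)
    moreover have "N \<ge> 0" by (simp add: N_def L2_norm_nonneg)
    ultimately have "(c - Re z) * N \<le> L2_norm M h"
      using L2_norm_nonneg[of M h] by (cases "N = 0") (auto simp: mult_le_cancel_left)
    then show ?thesis using z unfolding h_def[symmetric] N_def[symmetric] by (simp add: field_simps)
  qed
  have surj: "\<exists>u g. form_operator M D q u g \<and> (AE x in M. g x - z * u x = f x)" if f: "f \<in> L2 M" for f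
  proof -
    \<comment> \<open>The inequality |z + \<kappa>|^2 < (c + \<kappa>)^2 amounts to |z|^2 - c^2 < 2
      \<kappa> (c - Re z); this \<kappa> makes the right side |z|^2 + 1.\<close>
    define \<kappa> where "\<kappa> = ((cmod z)\<^sup>2 + 1) / (2 * (c - Re z))"
    have \<kappa>: "\<kappa> > 0" using z by (simp add: \<kappa>_def add_nonneg_pos)
    define w where "w = z + of_real \<kappa>"
    define \<theta> where "\<theta> = cmod w / (c + \<kappa>)"
    have "(cmod w)\<^sup>2 < (c + \<kappa>)\<^sup>2"
    proof -
      have "(cmod w)\<^sup>2 = (cmod z)\<^sup>2 + 2 * \<kappa> * Re z + \<kappa>\<^sup>2"
        unfolding w_def cmod_power2 by (simp add: power2_eq_square algebra_simps)
      moreover have "2 * \<kappa> * (c - Re z) = (cmod z)\<^sup>2 + 1" using z by (simp add: \<kappa>_def field_simps)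
      ultimately show ?thesis using zero_le_power2[of c] by (simp add: power2_sum algebra_simps add_pos_nonneg)
    qed
    then have "cmod w < c + \<kappa>" by (rule power2_less_imp_less) (use c \<kappa> in simp)
    then have \<theta>: "0 \<le> \<theta>" "\<theta> < 1" using c \<kappa> by (simp_all add: \<theta>_def)
    have "\<exists>u. u \<in> cdom \<and> (\<forall>v\<in>cdom. cl u v + of_real \<kappa> * L2_inner M u v = L2_inner M h v)" if "h \<in> L2 M" for h
      using exists_weak_solution[OF \<kappa> that] by metis
    then obtain S where S: "\<And>h. h \<in> L2 M \<Longrightarrow> S h \<in> cdom"
      and S_eq: "\<And>h v. h \<in> L2 M \<Longrightarrow> v \<in> cdom \<Longrightarrow> cl (S h) v + of_real \<kappa> * L2_inner M (S h) v = L2_inner M h v"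
      by metis
    define R where "R u = S (\<lambda>x. f x + w * u x)" for u
    have rhs: "(\<lambda>x. f x + w * u x) \<in> L2 M" if "u \<in> L2 M" for u
      using that f by (intro L2_add L2_scale)
    have R: "R u \<in> cdom" "R u \<in> L2 M" if "u \<in> L2 M" for u
      using S[OF rhs[OF that]] dom_L2 by (simp_all add: R_def)
    have contr: "L2_norm M (\<lambda>x. R u x - R v x) \<le> \<theta> * L2_norm M (\<lambda>x. u x - v x)"
      if u: "u \<in> L2 M" and v: "v \<in> L2 M" for u v
    proof -
      define d where "d x = R u x - R v x" for x
      define N where "N = L2_norm M d"
      have d: "d \<in> cdom" "d \<in> L2 M" unfolding d_def by (intro cl.diff_mem L2.diff_mem R u v)+
      define h where "h x = w * (u x - v x)" for x
      have h: "h \<in> L2 M" unfolding h_def by (intro L2_scale L2.diff_mem u v)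
      have "cl d d + of_real \<kappa> * L2_inner M d d
          = (cl (R u) d + of_real \<kappa> * L2_inner M (R u) d) - (cl (R v) d + of_real \<kappa> * L2_inner M (R v) d)"
      proof -
        have "cl d d = cl (R u) d - cl (R v) d" "L2_inner M d d = L2_inner M (R u) d - L2_inner M (R v) d"
          using cl.diff_left[OF R(1)[OF u] R(1)[OF v] d(1)] L2.diff_left[OF R(2)[OF u] R(2)[OF v] d(2)]
          unfolding d_def[symmetric] by simp_all
        then show ?thesis by (simp only:) (simp add: algebra_simps)
      qed
      also have "\<dots> = L2_inner M (\<lambda>x. f x + w * u x) d - L2_inner M (\<lambda>x. f x + w * v x) d"
        using S_eq[OF rhs[OF u] d(1)] S_eq[OF rhs[OF v] d(1)] by (simp add: R_def)
      also have "\<dots> = L2_inner M h d"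
      proof -
        have "h = (\<lambda>x. (f x + w * u x) - (f x + w * v x))" by (simp add: h_def fun_eq_iff algebra_simps)
        then show ?thesis using L2.diff_left[OF rhs[OF u] rhs[OF v] d(2)] by (simp only:)
      qed
      finally have "Re (cl d d) + \<kappa> * N\<^sup>2 = Re (L2_inner M h d)"
        using L2_norm_inner[OF d(2)] by (simp add: N_def complex_eq_iff)
      also have "\<dots> \<le> L2_norm M h * N"
        using L2.cauchy_schwarz[OF h d(2)] complex_Re_le_cmod order_trans
        unfolding N_def L2_norm_eq_nrm by blast
      also have "L2_norm M h = cmod w * L2_norm M (\<lambda>x. u x - v x)"
        by (simp add: h_def L2_norm_def norm_mult power_mult_distrib real_sqrt_mult)
      finally have "(c + \<kappa>) * N\<^sup>2 \<le> cmod w * L2_norm M (\<lambda>x. u x - v x) * N"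
        using lower[OF d(1)] by (simp add: N_def algebra_simps)
      then have "N * ((c + \<kappa>) * N) \<le> N * (cmod w * L2_norm M (\<lambda>x. u x - v x))"
        by (simp add: power2_eq_square mult_ac)
      moreover have "N \<ge> 0" by (simp add: N_def L2_norm_nonneg)
      ultimately have "(c + \<kappa>) * N \<le> cmod w * L2_norm M (\<lambda>x. u x - v x)"
        using L2_norm_nonneg[of M "\<lambda>x. u x - v x"] by (cases "N = 0") (auto simp: mult_le_cancel_left)
      then show ?thesis using c \<kappa> unfolding d_def[symmetric] N_def[symmetric] \<theta>_def by (simp add: field_simps)
    qed
    define U where "U n = (R ^^ n) (\<lambda>_. 0)" for n
    have U_Suc: "U (Suc n) = R (U n)" for n by (simp add: U_def)
    have U: "U n \<in> L2 M" for n
    proof (induction n)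
      case 0 show ?case by (simp add: U_def L2_zero)
    next
      case (Suc n) then show ?case by (simp add: U_Suc R)
    qed
    \<comment> \<open>The bound that reproduces itself under K \<mapsto> ||U 1|| + \<theta>
      K.\<close>
    define K where "K = L2_norm M (U 1) / (1 - \<theta>)"
    have K_eq: "K = L2_norm M (U 1) + \<theta> * K" using \<theta> by (simp add: K_def field_simps)
    have U_bdd: "L2_norm M (U n) \<le> K" for n
    proof (induction n)
      case 0 show ?case using \<theta> by (simp add: U_def K_def L2_norm_def)
    next
      case (Suc n)
      have "L2_norm M (U (Suc n)) \<le> L2_norm M (\<lambda>x. R (U n) x - R (U 0) x) + L2_norm M (R (U 0))"
        unfolding L2_norm_eq_nrm U_Suc by (intro L2.nrm_triangle_sub R U)
      also have "\<dots> \<le> \<theta> * L2_norm M (\<lambda>x. U n x - U 0 x) + L2_norm M (U 1)"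
        using contr[OF U U, of n 0] by (simp flip: U_Suc)
      also have "(\<lambda>x. U n x - U 0 x) = U n" by (simp add: U_def)
      also have "\<theta> * L2_norm M (U n) + L2_norm M (U 1) \<le> \<theta> * K + L2_norm M (U 1)"
        using \<theta> Suc by (intro add_mono mult_left_mono) auto
      finally show ?case using K_eq by simp
    qed
    have U_diff: "L2_norm M (\<lambda>x. U (n + k) x - U n x) \<le> \<theta>^n * K" for n k
    proof (induction n)
      case 0
      have "(\<lambda>x. U k x - U 0 x) = U k" by (simp add: U_def)
      then show ?case using U_bdd[of k] by simp
    next
      case (Suc n)
      have "L2_norm M (\<lambda>x. U (Suc n + k) x - U (Suc n) x) \<le> \<theta> * L2_norm M (\<lambda>x. U (n + k) x - U n x)"
        using contr[OF U U, of "n + k" n] by (simp add: U_Suc)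
      also have "\<dots> \<le> \<theta> * (\<theta>^n * K)" by (intro mult_left_mono Suc \<theta>)
      finally show ?case by simp
    qed
    have "L2.cauchy_seq M U"
      unfolding L2.cauchy_seq_def
    proof (intro conjI allI impI U)
      fix e :: real assume e: "e > 0"
      have "(\<lambda>n. \<theta>^n * K) \<longlonglongrightarrow> 0 * K" by (intro tendsto_mult tendsto_const LIMSEQ_realpow_zero \<theta>)
      then have "eventually (\<lambda>n. \<theta>^n * K < e) sequentially" using e by (intro order_tendstoD) auto
      then obtain N where N: "\<And>n. n \<ge> N \<Longrightarrow> \<theta>^n * K < e" by (auto simp: eventually_sequentially)
      have half: "L2.nrm M (\<lambda>x. U m x - U n x) < e" if "n \<ge> N" "m \<ge> n" for m n
        using U_diff[of n "m - n"] N[of n] that by (simp add: L2_norm_eq_nrm)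
      have "L2.nrm M (\<lambda>x. U m x - U n x) < e" if "n \<ge> N" "m \<ge> N" for m n
        using half[of n m] half[of m n] that L2.nrm_minus_commute[OF U U, of m n] by (cases "m \<ge> n") auto
      then show "\<exists>N. \<forall>m\<ge>N. \<forall>n\<ge>N. L2.nrm M (\<lambda>x. U m x - U n x) < e" by blast
    qed
    then obtain v where v: "v \<in> L2 M" "(\<lambda>n. L2_norm M (\<lambda>x. U n x - v x)) \<longlonglongrightarrow> 0"
      by (rule L2_complete)
    \<comment> \<open>The limit v is only known to lie in L2. Its image R v agrees with v almost
      everywhere and lies in the form domain, so the solution has to be R v.\<close>
    define u where "u = R v"
    have u: "u \<in> cdom" "u \<in> L2 M" using R[OF v(1)] by (simp_all add: u_def)
    have "L2_norm M (\<lambda>x. u x - v x) \<le> 0"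
    proof (rule LIMSEQ_le_const)
      show "(\<lambda>n. \<theta> * L2_norm M (\<lambda>x. U n x - v x) + L2_norm M (\<lambda>x. U (Suc n) x - v x)) \<longlonglongrightarrow> 0"
        using tendsto_add[OF tendsto_mult_left[OF v(2), of \<theta>] LIMSEQ_Suc[OF v(2)]] by simp
      have "L2_norm M (\<lambda>x. u x - v x) \<le> \<theta> * L2_norm M (\<lambda>x. U n x - v x) + L2_norm M (\<lambda>x. U (Suc n) x - v x)" for n
      proof -
        have "L2_norm M (\<lambda>x. u x - v x) \<le> L2_norm M (\<lambda>x. u x - U (Suc n) x) + L2_norm M (\<lambda>x. U (Suc n) x - v x)"
          unfolding L2_norm_eq_nrm by (intro L2.nrm_triangle_diff u U v)
        moreover have "L2_norm M (\<lambda>x. u x - U (Suc n) x) \<le> \<theta> * L2_norm M (\<lambda>x. U n x - v x)"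
          using contr[OF v(1) U, of n] L2.nrm_minus_commute[OF v(1) U, of n]
          by (simp add: u_def U_Suc L2_norm_eq_nrm)
        ultimately show ?thesis by simp
      qed
      then show "\<exists>N. \<forall>n\<ge>N. L2_norm M (\<lambda>x. u x - v x)
          \<le> \<theta> * L2_norm M (\<lambda>x. U n x - v x) + L2_norm M (\<lambda>x. U (Suc n) x - v x)" by blast
    qed
    then have "L2_norm M (\<lambda>x. u x - v x) = 0" using L2_norm_nonneg[of M "\<lambda>x. u x - v x"] by simp
    then have ae: "AE x in M. u x - v x = 0" by (intro L2_norm_0_AE L2.diff_mem u v)
    define g where "g x = f x + z * u x" for x
    have g: "g \<in> L2 M" unfolding g_def by (intro L2_add L2_scale f u)
    have "cl u t = L2_inner M g t" if t: "t \<in> cdom" for t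
    proof -
      note tL = dom_L2[OF t]
      have ae': "AE x in M. f x + w * v x = f x + w * u x" using ae by eventually_elim simp
      have "cl u t + of_real \<kappa> * L2_inner M u t = L2_inner M (\<lambda>x. f x + w * v x) t"
        unfolding u_def R_def by (rule S_eq[OF rhs[OF v(1)] t])
      also have "\<dots> = L2_inner M (\<lambda>x. f x + w * u x) t"
        by (rule L2_inner_cong_AE[OF ae' L2_measurable[OF rhs[OF v(1)]] L2_measurable[OF rhs[OF u(2)]]
            L2_measurable[OF tL]])
      also have "\<dots> = L2_inner M f t + w * L2_inner M u t"
        using f u tL by (simp add: L2.add_left L2.scale_left L2_scale)
      finally have "cl u t = L2_inner M f t + z * L2_inner M u t"
        by (simp add: w_def algebra_simps)
      also have "\<dots> = L2_inner M g t"
        unfolding g_def using f u tL by (simp add: L2.add_left L2.scale_left L2_scale)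
      finally show ?thesis .
    qed
    then have "form_operator M D q u g" using u g by (simp add: form_operator_def)
    moreover have "AE x in M. g x - z * u x = f x" by (simp add: g_def)
    ultimately show ?thesis by blast
  qed
  show ?thesis unfolding resolvent_set_def using inj surj by blast
qed

end

section \<open>The weight and the test functions\<close>

lemma interval_integral_has_derivative_pos:
  fixes f :: "real \<Rightarrow> real"
  assumes f: "continuous_on {0<..} f" and x: "x > 0"
  shows "((\<lambda>u. LBINT y=ereal 1..ereal u. f y) has_real_derivative f x) (at x)"
proof -
  define p q where "p = min x 1 / 2" and "q = max x 1 + 1"
  have pq: "0 < p" "p < x" "x < q" "p \<le> 1" "1 \<le> q" using x by (auto simp: p_def q_def)
  have "continuous_on {p..q} f" using f by (rule continuous_on_subset) (use pq in auto)
  then have "((\<lambda>u. LBINT y=ereal 1..ereal u. f y) has_vector_derivative f x) (at x within {p..q})"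
    using pq by (intro interval_integral_FTC2) auto
  moreover have "at x within {p..q} = at x" using pq by (intro at_within_interior) auto
  ultimately show ?thesis by (simp add: has_real_derivative_iff_has_vector_derivative)
qed

locale C1_drift =
  fixes b :: "real \<Rightarrow> real"
  assumes C1: "b C1_differentiable_on {0<..}"
begin

lemma b_continuous: "continuous_on {0<..} b"
  using C1 by (rule C1_differentiable_imp_continuous_on)

lemma rho_pos: "0 < rho b x"
  by (simp add: rho_def)

lemma rho_deriv:
  assumes "x > 0"
  shows "(rho b has_real_derivative - 2 * b x * rho b x) (at x)"
proof -
  have "continuous_on {0<..} (\<lambda>s. 2 * b s)" by (intro continuous_intros b_continuous)
  from interval_integral_has_derivative_pos[OF this assms]
  have "((\<lambda>x. exp (- (LBINT s=ereal 1..ereal x. 2 * b s))) has_real_derivative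
      exp (- (LBINT s=ereal 1..ereal x. 2 * b s)) * - (2 * b x)) (at x)"
    by (intro DERIV_fun_exp DERIV_minus)
  then show ?thesis by (simp add: rho_def[abs_def] mult_ac)
qed

lemma rho_continuous: "continuous_on {0<..} (rho b)"
  using rho_deriv by (intro DERIV_atLeastAtMost_imp_continuous_on continuous_at_imp_continuous_on)
    (auto intro: DERIV_isCont)

lemma inverse_rho_continuous: "continuous_on {0<..} (\<lambda>x. 1 / rho b x)"
  using rho_pos by (intro continuous_intros rho_continuous) (simp add: less_imp_neq[THEN not_sym])

lemma rho_measure_sets: "f \<in> borel_measurable borel \<Longrightarrow> f \<in> borel_measurable (rho_measure b)"
  by (simp add: rho_measure_def measurable_restrict_space1)

text \<open>The weight and the drift are under control on (0, \<infinity>) only. A function that is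
  constant below some r > 0 is nevertheless continuous on the whole line, which gives Borel
  measurability.\<close>

lemma continuous_zero_extension:
  fixes f :: "real \<Rightarrow> 'a::topological_space"
  assumes f: "continuous_on {0<..} f" and r: "0 < r" "\<And>x. x < r \<Longrightarrow> f x = z"
  shows "continuous_on UNIV f"
proof -
  have "continuous_on {..<r} f"
    using r(2) continuous_on_cong[of "{..<r}" "{..<r}" f "\<lambda>_. z"] by simp
  then have "continuous_on ({0<..} \<union> {..<r}) f" using f by (intro continuous_on_open_Un) auto
  moreover have "{0<..} \<union> {..<r} = (UNIV :: real set)" using r(1) by auto
  ultimately show ?thesis by simp
qed

text \<open>The bridge from integrals against \<open>rho_measure b\<close> to gauge integrals over a
  compact interval, where the fundamental theorem of calculus is available.\<close>

lemma rho_integral_compact: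
  fixes f :: "real \<Rightarrow> 'a::euclidean_space"
  assumes f: "continuous_on {0<..} f" and r: "0 < r" and supp: "\<And>x. x \<notin> {r..R} \<Longrightarrow> f x = 0"
  shows "integrable (rho_measure b) f"
    and "integral\<^sup>L (rho_measure b) f = integral {r..R} (\<lambda>x. rho b x *\<^sub>R f x)"
    and "f \<in> borel_measurable (rho_measure b)"
proof -
  have "continuous_on UNIV f" by (rule continuous_zero_extension[OF f r]) (use supp in auto)
  then have fm: "f \<in> borel_measurable borel" by (rule borel_measurable_continuous_onI)
  then show "f \<in> borel_measurable (rho_measure b)" by (rule rho_measure_sets)
  have rm: "rho b \<in> borel_measurable (restrict_space lborel {0<..})"
    using borel_measurable_continuous_on_restrict[OF rho_continuous]
    by (simp add: measurable_def space_restrict_space sets_restrict_space)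
  have fm': "f \<in> borel_measurable (restrict_space lborel {0<..})"
    using fm by (simp add: measurable_restrict_space1)
  have si: "set_integrable lborel {r..R} (\<lambda>x. rho b x *\<^sub>R f x)"
    by (intro borel_integrable_atLeastAtMost' continuous_intros continuous_on_subset[OF f]
        continuous_on_subset[OF rho_continuous]) (use r in auto)
  have eq: "(\<lambda>x. indicator {0<..} x *\<^sub>R (rho b x *\<^sub>R f x)) = (\<lambda>x. indicator {r..R} x *\<^sub>R (rho b x *\<^sub>R f x))"
    using supp r by (force simp: fun_eq_iff indicator_def)
  show "integrable (rho_measure b) f"
    unfolding rho_measure_def using si rho_pos
    by (subst integrable_density[OF fm' rm]) (auto simp: integrable_restrict_space eq set_integrable_def less_imp_le simp del: scaleR_scaleR)
  have "integral\<^sup>L (rho_measure b) f = (LINT x:{r..R}|lborel. rho b x *\<^sub>R f x)"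
    unfolding rho_measure_def using rho_pos
    by (subst integral_density[OF fm' rm]) (auto simp: integral_restrict_space eq set_lebesgue_integral_def less_imp_le simp del: scaleR_scaleR)
  then show "integral\<^sup>L (rho_measure b) f = integral {r..R} (\<lambda>x. rho b x *\<^sub>R f x)"
    using set_borel_integral_eq_integral(2)[OF si] by simp
qed

end

section \<open>Derivatives and linear structure of the test functions\<close>

abbreviation dv :: "(real \<Rightarrow> complex) \<Rightarrow> real \<Rightarrow> complex" where
  "dv f \<equiv> (\<lambda>x. vector_derivative f (at x))"

lemma test_has_vector_derivative:
  assumes "\<phi> \<in> test_functions"
  shows "(\<phi> has_vector_derivative dv \<phi> x) (at x)"
proof -
  have "((\<lambda>f y. vector_derivative f (at y)) ^^ 0) \<phi> differentiable (at x)"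
    using assms unfolding test_functions_def by blast
  then show ?thesis by (simp add: vector_derivative_works[symmetric])
qed

lemma test_continuous: "\<phi> \<in> test_functions \<Longrightarrow> continuous_on S \<phi>"
  using test_has_vector_derivative
  by (intro continuous_at_imp_continuous_on ballI) (blast intro: has_vector_derivative_continuous)

lemma test_deriv_support:
  assumes \<phi>: "\<phi> \<in> test_functions" and supp: "\<And>x. x \<notin> {r..R} \<Longrightarrow> \<phi> x = 0" and x: "x \<notin> {r..R}"
  shows "dv \<phi> x = 0"
proof -
  have "((\<lambda>x. 0::complex) has_vector_derivative dv \<phi> x) (at x)"
    by (rule has_vector_derivative_transform_within_open[OF test_has_vector_derivative[OF \<phi>], of "- {r..R}"])
       (use x supp in auto)
  then show ?thesis using vector_derivative_unique_at[OF _ has_vector_derivative_const] by blast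
qed

lemma test_support:
  assumes "\<phi> \<in> test_functions"
  obtains r R where "0 < r" "\<And>x. x \<notin> {r..R} \<Longrightarrow> \<phi> x = 0"
  using assms unfolding test_functions_def by blast

lemma test_deriv:
  assumes "\<phi> \<in> test_functions"
  shows "dv \<phi> \<in> test_functions"
proof -
  obtain r R where r: "0 < r" "\<And>x. x \<notin> {r..R} \<Longrightarrow> \<phi> x = 0" using test_support[OF assms] by blast
  have "((\<lambda>f y. vector_derivative f (at y)) ^^ n) (dv \<phi>) differentiable (at x)" for n x
  proof -
    have "((\<lambda>f y. vector_derivative f (at y)) ^^ Suc n) \<phi> differentiable (at x)"
      using assms unfolding test_functions_def by blast
    then show ?thesis by (simp only: funpow_Suc_right o_apply)
  qed
  then show ?thesis using r test_deriv_support[OF assms r(2)] unfolding test_functions_def by blast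
qed

lemma test_add_scale:
  assumes \<phi>: "\<phi> \<in> test_functions" and \<psi>: "\<psi> \<in> test_functions"
  shows "(\<lambda>x. \<phi> x + c * \<psi> x) \<in> test_functions"
    and "dv (\<lambda>x. \<phi> x + c * \<psi> x) x = dv \<phi> x + c * dv \<psi> x"
proof -
  let ?D = "\<lambda>f y. vector_derivative f (at y) :: complex"
  have step: "(\<lambda>y. vector_derivative (\<lambda>x. f x + c * g x) (at y)) = (\<lambda>y. dv f y + c * dv g y)"
    if "f \<in> test_functions" "g \<in> test_functions" for f g
    using that by (intro ext vector_derivative_at has_vector_derivative_add
        has_vector_derivative_mult_right test_has_vector_derivative)
  show "dv (\<lambda>x. \<phi> x + c * \<psi> x) x = dv \<phi> x + c * dv \<psi> x" using fun_cong[OF step[OF \<phi> \<psi>]] .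
  have iter: "(?D ^^ n) f \<in> test_functions" if "f \<in> test_functions" for f n
    by (induction n) (auto intro: that test_deriv)
  have eq: "(?D ^^ n) (\<lambda>x. \<phi> x + c * \<psi> x) = (\<lambda>x. (?D ^^ n) \<phi> x + c * (?D ^^ n) \<psi> x)" for n
  proof (induction n)
    case (Suc n)
    have "(?D ^^ Suc n) (\<lambda>x. \<phi> x + c * \<psi> x) = ?D (\<lambda>x. (?D ^^ n) \<phi> x + c * (?D ^^ n) \<psi> x)"
      by (simp only: funpow.simps o_apply Suc)
    also have "\<dots> = (\<lambda>x. ?D ((?D ^^ n) \<phi>) x + c * ?D ((?D ^^ n) \<psi>) x)"
      by (rule step[OF iter[OF \<phi>] iter[OF \<psi>]])
    finally show ?case by simp
  qed simp
  have "(?D ^^ n) (\<lambda>x. \<phi> x + c * \<psi> x) differentiable (at x)" for n x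
    unfolding eq
    using test_has_vector_derivative[OF iter[OF \<phi>], of n x] test_has_vector_derivative[OF iter[OF \<psi>], of n x]
    by (intro derivative_intros) (auto intro: differentiableI_vector)
  moreover obtain r R where r: "0 < r" "\<And>x. x \<notin> {r..R} \<Longrightarrow> \<phi> x = 0" using test_support[OF \<phi>] by blast
  obtain r' R' where r': "0 < r'" "\<And>x. x \<notin> {r'..R'} \<Longrightarrow> \<psi> x = 0" using test_support[OF \<psi>] by blast
  have "\<phi> x + c * \<psi> x = 0" if "x \<notin> {min r r'..max R R'}" for x
  proof -
    have "x \<notin> {r..R}" "x \<notin> {r'..R'}" using that by auto
    then show ?thesis using r(2) r'(2) by simp
  qed
  moreover have "0 < min r r'" using r(1) r'(1) by simp
  ultimately show "(\<lambda>x. \<phi> x + c * \<psi> x) \<in> test_functions" unfolding test_functions_def by blast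
qed

lemma test_zero: "(\<lambda>x. 0) \<in> test_functions"
proof -
  have "((\<lambda>f y. vector_derivative f (at y)) ^^ n) (\<lambda>x::real. 0::complex) = (\<lambda>x. 0)" for n
    by (induction n) auto
  then show ?thesis unfolding test_functions_def by (auto intro!: exI[of _ 1])
qed

lemma test_scale:
  assumes "\<psi> \<in> test_functions"
  shows "(\<lambda>x. c * \<psi> x) \<in> test_functions" "dv (\<lambda>x. c * \<psi> x) x = c * dv \<psi> x"
  using test_add_scale[OF test_zero assms, of c] by simp_all

lemma test_add:
  assumes "\<phi> \<in> test_functions" "\<psi> \<in> test_functions"
  shows "(\<lambda>x. \<phi> x + \<psi> x) \<in> test_functions" "dv (\<lambda>x. \<phi> x + \<psi> x) x = dv \<phi> x + dv \<psi> x"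
  using test_add_scale[OF assms, of 1] by simp_all

section \<open>The energy form\<close>

context C1_drift
begin

text \<open>The interval is open so that everything vanishes at r and R too; this removes the
  boundary terms of partial integrations.\<close>

lemma test_common_support:
  assumes \<phi>: "\<phi> \<in> test_functions" and \<psi>: "\<psi> \<in> test_functions"
  obtains r R where "0 < r" "r < R" "\<And>x. x \<notin> {r<..<R} \<Longrightarrow> \<phi> x = 0 \<and> dv \<phi> x = 0 \<and> \<psi> x = 0 \<and> dv \<psi> x = 0"
proof -
  obtain r R where r: "0 < r" "\<And>x. x \<notin> {r..R} \<Longrightarrow> \<phi> x = 0" using test_support[OF \<phi>] by blast
  obtain r' R' where r': "0 < r'" "\<And>x. x \<notin> {r'..R'} \<Longrightarrow> \<psi> x = 0" using test_support[OF \<psi>] by blast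
  define p q where "p = min r r' / 2" and "q = max p (max R R') + 1"
  have "x \<notin> {r..R} \<and> x \<notin> {r'..R'}" if "x \<notin> {p<..<q}" for x
    using that r(1) r'(1) by (auto simp: p_def q_def)
  then have "\<And>x. x \<notin> {p<..<q} \<Longrightarrow> \<phi> x = 0 \<and> dv \<phi> x = 0 \<and> \<psi> x = 0 \<and> dv \<psi> x = 0"
    using r r' test_deriv_support[OF \<phi> r(2)] test_deriv_support[OF \<psi> r'(2)] by blast
  moreover have "0 < p" "p < q" using r(1) r'(1) by (auto simp: p_def q_def)
  ultimately show thesis using that by blast
qed

lemma test_L2:
  assumes \<phi>: "\<phi> \<in> test_functions"
  shows "\<phi> \<in> L2 (rho_measure b)"
proof -
  obtain r R where r: "0 < r" "\<And>x. x \<notin> {r..R} \<Longrightarrow> \<phi> x = 0" using test_support[OF \<phi>] by blast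
  have "integrable (rho_measure b) (\<lambda>x. (cmod (\<phi> x))\<^sup>2)"
    by (rule rho_integral_compact[OF _ r(1)]) (use r in \<open>auto intro!: continuous_intros test_continuous[OF \<phi>]\<close>)
  moreover have "\<phi> \<in> borel_measurable (rho_measure b)"
    by (rule rho_integral_compact[OF test_continuous[OF \<phi>] r])
  ultimately show ?thesis by (simp add: L2_def)
qed

lemma energy_eq_inner: "energy b \<phi> \<psi> = 1 / 2 * L2_inner (rho_measure b) (dv \<phi>) (dv \<psi>)"
  by (simp add: energy_def L2_inner_def)

lemma energy_eq_L2_norm:
  assumes "\<phi> \<in> test_functions"
  shows "Re (energy b \<phi> \<phi>) = 1 / 2 * (L2_norm (rho_measure b) (dv \<phi>))\<^sup>2"
  using L2.nrm_sq[OF test_L2[OF test_deriv[OF assms]]] by (simp add: energy_eq_inner L2_norm_eq_nrm)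

lemma nonneg_form_energy: "nonneg_form test_functions (energy b)"
proof
  fix f g assume fg: "f \<in> test_functions" "g \<in> test_functions"
  note L = test_L2[OF test_deriv[OF fg(1)]] test_L2[OF test_deriv[OF fg(2)]]
  show "energy b (\<lambda>x. f x + g x) h = energy b f h + energy b g h" if "h \<in> test_functions" for h
    using L2.add_left[OF L test_L2[OF test_deriv[OF that]]]
    by (simp add: energy_eq_inner test_add[OF fg])
  show "energy b (\<lambda>x. c * f x) g = c * energy b f g" for c
    using L2.scale_left[OF L] by (simp add: energy_eq_inner test_scale[OF fg(1)])
  show "energy b g f = cnj (energy b f g)"
    using L2.hermitian[OF L] by (simp add: energy_eq_inner)
qed (auto intro: test_add test_scale simp: energy_eq_L2_norm)

text \<open>The function g is -\<psi>''/2 + b \<psi>', the generator applied to \<psi>. Because it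
  lies in L2, the energy against a fixed \<psi> is continuous in the L2 norm, which is the source of
  closability.\<close>

lemma energy_by_parts:
  assumes \<psi>: "\<psi> \<in> test_functions"
  obtains g where "g \<in> L2 (rho_measure b)"
    "\<And>\<phi>. \<phi> \<in> test_functions \<Longrightarrow> energy b \<phi> \<psi> = L2_inner (rho_measure b) \<phi> g"
proof -
  define g where "g x = - (1/2) * (dv (dv \<psi>) x - of_real (2 * b x) * dv \<psi> x)" for x
  obtain r R where r: "0 < r" "\<And>x. x \<notin> {r..R} \<Longrightarrow> \<psi> x = 0" using test_support[OF \<psi>] by blast
  have g_cont: "continuous_on {0<..} g"
    unfolding g_def
    by (intro continuous_intros test_continuous[OF test_deriv] test_deriv \<psi> b_continuous)
  have g_supp: "g x = 0" if "x \<notin> {r..R}" for x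
    using test_deriv_support[OF \<psi> r(2) that]
      test_deriv_support[OF test_deriv[OF \<psi>] test_deriv_support[OF \<psi> r(2)] that] by (simp add: g_def)
  have "integrable (rho_measure b) (\<lambda>x. (cmod (g x))\<^sup>2)"
    by (rule rho_integral_compact[OF _ r(1)]) (use g_supp in \<open>auto intro!: continuous_intros g_cont\<close>)
  then have gL: "g \<in> L2 (rho_measure b)"
    using rho_integral_compact(3)[OF g_cont r(1) g_supp] by (simp add: L2_def)
  have "energy b \<phi> \<psi> = L2_inner (rho_measure b) \<phi> g" if \<phi>: "\<phi> \<in> test_functions" for \<phi>
  proof -
    obtain p q where p: "0 < p" "p < q"
      and z: "\<And>x. x \<notin> {p<..<q} \<Longrightarrow> \<phi> x = 0 \<and> dv \<phi> x = 0 \<and> \<psi> x = 0 \<and> dv \<psi> x = 0"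
      using test_common_support[OF \<phi> \<psi>] by blast
    have z': "\<phi> x = 0" "dv \<phi> x = 0" if "x \<notin> {p..q}" for x using z[of x] that by auto
    let ?f1 = "\<lambda>x. rho b x *\<^sub>R (dv \<phi> x * cnj (dv \<psi> x))"
    let ?f2 = "\<lambda>x. rho b x *\<^sub>R (\<phi> x * cnj (g x))"
    have c1: "continuous_on {0<..} (\<lambda>x. dv \<phi> x * cnj (dv \<psi> x))"
      and c2: "continuous_on {0<..} (\<lambda>x. \<phi> x * cnj (g x))"
      by (intro continuous_intros test_continuous test_deriv \<phi> \<psi> g_cont)+
    have i: "?f1 integrable_on {p..q}" "?f2 integrable_on {p..q}"
      by (intro integrable_continuous_real continuous_intros continuous_on_subset[OF c1]
          continuous_on_subset[OF c2] continuous_on_subset[OF rho_continuous]; use p in auto)+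
    \<comment> \<open>As rho' = -2 b rho, the derivative of F is the energy integrand rho \<phi>'
      cnj \<psi>' minus 2 rho \<phi> cnj g.\<close>
    define F where "F x = rho b x *\<^sub>R (\<phi> x * cnj (dv \<psi> x))" for x
    have "((\<lambda>x. ?f1 x - 2 * ?f2 x) has_integral (F q - F p)) {p..q}"
    proof (rule fundamental_theorem_of_calculus)
      fix x assume x: "x \<in> {p..q}"
      then have "x > 0" using p by auto
      have "(F has_vector_derivative rho b x *\<^sub>R (\<phi> x * cnj (dv (dv \<psi>) x) + dv \<phi> x * cnj (dv \<psi> x))
          + (- 2 * b x * rho b x) *\<^sub>R (\<phi> x * cnj (dv \<psi> x))) (at x)"
        unfolding F_def
        by (intro has_vector_derivative_scaleR rho_deriv has_vector_derivative_mult
            has_vector_derivative_cnj test_has_vector_derivative test_deriv \<phi> \<psi> \<open>x > 0\<close>)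
      moreover have "rho b x *\<^sub>R (\<phi> x * cnj (dv (dv \<psi>) x) + dv \<phi> x * cnj (dv \<psi> x))
          + (- 2 * b x * rho b x) *\<^sub>R (\<phi> x * cnj (dv \<psi> x)) = ?f1 x - 2 * ?f2 x"
        by (simp add: g_def scaleR_conv_of_real algebra_simps)
      ultimately show "(F has_vector_derivative ?f1 x - 2 * ?f2 x) (at x within {p..q})"
        using has_vector_derivative_at_within by fastforce
    qed (use p in simp)
    moreover have "F q = 0" "F p = 0" using z[of p] z[of q] by (simp_all add: F_def)
    ultimately have "integral {p..q} (\<lambda>x. ?f1 x - 2 * ?f2 x) = 0" by (simp add: integral_unique)
    then have "integral {p..q} ?f1 - integral {p..q} (\<lambda>x. 2 * ?f2 x) = 0"
      using Henstock_Kurzweil_Integration.integral_diff[OF i(1) integrable_on_mult_right[OF i(2), of 2]] by simp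
    moreover have "integral {p..q} (\<lambda>x. 2 * ?f2 x) = 2 * integral {p..q} ?f2"
      by (rule Henstock_Kurzweil_Integration.integral_mult_right)
    ultimately have "integral {p..q} ?f1 = 2 * integral {p..q} ?f2" by simp
    moreover have "L2_inner (rho_measure b) (dv \<phi>) (dv \<psi>) = integral {p..q} ?f1"
      unfolding L2_inner_def by (rule rho_integral_compact[OF c1 p(1)]) (use z' in simp)
    moreover have "L2_inner (rho_measure b) \<phi> g = integral {p..q} ?f2"
      unfolding L2_inner_def by (rule rho_integral_compact[OF c2 p(1)]) (use z' in simp)
    ultimately show ?thesis by (simp add: energy_eq_inner)
  qed
  with gL show thesis using that by blast
qed

text \<open>Closability, as for every form of a symmetric operator: \<open>energy (\<phi> n) (\<psi>) \<rightarrow> 0\<close> for fixed \<open>\<psi>\<close>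
  by partial integration, and \<open>\<phi> n\<close> may be replaced by a fixed \<open>\<phi> N\<close> in one argument.\<close>

lemma closable_form_energy: "closable_form (rho_measure b) test_functions (energy b)"
proof -
  interpret e: nonneg_form test_functions "energy b" by (rule nonneg_form_energy)
  show ?thesis
  proof
    show "test_functions \<subseteq> L2 (rho_measure b)" using test_L2 by blast
    show "test_functions \<noteq> {}" using test_zero by blast
    fix \<phi> assume ap: "form_approx (rho_measure b) test_functions (energy b) \<phi> (\<lambda>_. 0)"
    have mem: "\<phi> n \<in> test_functions" for n using ap by (simp add: form_approx_def)
    have L0: "(\<lambda>n. L2_norm (rho_measure b) (\<lambda>x. \<phi> n x - 0)) \<longlonglongrightarrow> 0"
      using ap unfolding form_approx_def by blast
    have cauchy: "\<exists>N. \<forall>m\<ge>N. \<forall>n\<ge>N. e.nrm (\<lambda>x. \<phi> m x - \<phi> n x) < d" if d: "d > 0" for d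
    proof -
      have "\<exists>N. \<forall>m\<ge>N. \<forall>n\<ge>N. cmod (energy b (\<lambda>x. \<phi> m x - \<phi> n x) (\<lambda>x. \<phi> m x - \<phi> n x)) < d\<^sup>2"
        using ap d unfolding form_approx_def by (meson zero_less_power)
      moreover have "e.nrm (\<lambda>x. \<phi> m x - \<phi> n x) < d"
        if "cmod (energy b (\<lambda>x. \<phi> m x - \<phi> n x) (\<lambda>x. \<phi> m x - \<phi> n x)) < d\<^sup>2" for m n
        by (rule power2_less_imp_less)
           (use that d in \<open>simp_all add: e.nrm_sq e.diff_mem mem e.cmod_diag\<close>)
      ultimately show ?thesis by meson
    qed
    then have "e.cauchy_seq \<phi>" unfolding e.cauchy_seq_def using mem by blast
    then obtain K where K: "\<And>n. e.nrm (\<phi> n) \<le> K" "0 \<le> K" using e.cauchy_seq_bounded by blast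
    show "(\<lambda>n. energy b (\<phi> n) (\<phi> n)) \<longlonglongrightarrow> 0"
    proof (rule LIMSEQ_I)
      fix d :: real assume d: "d > 0"
      then have "d / (2 * (K + 1)) > 0" using K by simp
      then obtain N where N: "\<And>m n. m \<ge> N \<Longrightarrow> n \<ge> N \<Longrightarrow> e.nrm (\<lambda>x. \<phi> m x - \<phi> n x) < d / (2 * (K + 1))"
        using cauchy by meson
      obtain g where g: "g \<in> L2 (rho_measure b)"
        "\<And>f. f \<in> test_functions \<Longrightarrow> energy b f (\<phi> N) = L2_inner (rho_measure b) f g"
        using energy_by_parts[OF mem[of N]] by blast
      have "(\<lambda>n. L2_inner (rho_measure b) (\<phi> n) g) \<longlonglongrightarrow> L2_inner (rho_measure b) (\<lambda>_. 0) g"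
        by (rule L2_inner_tendsto[OF test_L2[OF mem] L0 L2_zero g(1) _ g(1)]) (simp add: L2_norm_def)
      then have "(\<lambda>n. energy b (\<phi> n) (\<phi> N)) \<longlonglongrightarrow> 0"
        using g(2)[OF mem] by (simp add: L2_inner_def)
      then obtain N' where N': "\<And>n. n \<ge> N' \<Longrightarrow> cmod (energy b (\<phi> n) (\<phi> N)) < d / 2"
        using LIMSEQ_D[of _ 0 "d/2"] d by force
      have "cmod (energy b (\<phi> n) (\<phi> n) - 0) < d" if n: "n \<ge> max N N'" for n
      proof -
        have "energy b (\<phi> n) (\<phi> n) = energy b (\<phi> n) (\<lambda>x. \<phi> n x - \<phi> N x) + energy b (\<phi> n) (\<phi> N)"
          using mem by (simp add: e.diff_right)
        then have "cmod (energy b (\<phi> n) (\<phi> n))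
            \<le> cmod (energy b (\<phi> n) (\<lambda>x. \<phi> n x - \<phi> N x)) + cmod (energy b (\<phi> n) (\<phi> N))"
          by (metis norm_triangle_ineq)
        also have "cmod (energy b (\<phi> n) (\<lambda>x. \<phi> n x - \<phi> N x)) \<le> e.nrm (\<phi> n) * e.nrm (\<lambda>x. \<phi> n x - \<phi> N x)"
          by (intro e.cauchy_schwarz e.diff_mem mem)
        also have "\<dots> \<le> (K + 1) * (d / (2 * (K + 1)))"
          using K(2) add_increasing2[OF zero_le_one K(1), of n] less_imp_le[OF N[of n N]] n
          by (intro mult_mono) (auto simp: e.nrm_nonneg e.diff_mem mem)
        also have "\<dots> = d / 2" using K(2) by (simp add: field_simps)
        finally show ?thesis using N'[of n] n by simp
      qed
      then show "\<exists>no. \<forall>n\<ge>no. cmod (energy b (\<phi> n) (\<phi> n) - 0) < d" by blast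
    qed
  qed
qed

end

section \<open>Hardy's inequality\<close>

lemma nn_integral_Ioo_antiderivative:
  assumes F: "\<And>x. x > 0 \<Longrightarrow> (F has_real_derivative f x) (at x)" and nonneg: "\<And>x. 0 \<le> f x"
    and a: "0 < a" "a \<le> x"
  shows "(\<integral>\<^sup>+y\<in>{a<..<x}. ennreal (f y) \<partial>lborel) = ennreal (F x - F a)"
proof (rule nn_integral_has_integral_lebesgue')
  have "(f has_integral (F x - F a)) {a..x}"
    using a F by (intro fundamental_theorem_of_calculus)
      (auto simp: has_real_derivative_iff_has_vector_derivative[symmetric] intro: has_field_derivative_at_within)
  then show "(f has_integral (F x - F a)) {a<..<x}" by (simp add: has_integral_Icc_iff_Ioo)
qed (use nonneg in simp)

lemma le_enn2real:
  assumes "ennreal x \<le> I" "I < \<infinity>"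
  shows "x \<le> enn2real I"
proof -
  have "I = ennreal (enn2real I)" using assms(2) by (simp add: ennreal_enn2real_if)
  then show ?thesis using assms(1) ennreal_le_iff[OF enn2real_nonneg, of x I] by simp
qed

section \<open>Scale and speed: sufficiency of the condition\<close>

context C1_drift
begin

text \<open>The scale function, an antiderivative of 1/rho normalised at 1 rather than at 0, so that
  no convergence at 0 is presupposed; \<open>speed\<close> is the corresponding antiderivative of
  rho.\<close>

definition scale :: "real \<Rightarrow> real" where "scale x = (LBINT y=ereal 1..ereal x. 1 / rho b y)"

definition speed :: "real \<Rightarrow> real" where "speed x = (LBINT y=ereal 1..ereal x. rho b y)"

lemma scale_deriv: "x > 0 \<Longrightarrow> (scale has_real_derivative 1 / rho b x) (at x)"
  unfolding scale_def[abs_def] by (rule interval_integral_has_derivative_pos[OF inverse_rho_continuous])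

lemma speed_deriv: "x > 0 \<Longrightarrow> (speed has_real_derivative rho b x) (at x)"
  unfolding speed_def[abs_def] by (rule interval_integral_has_derivative_pos[OF rho_continuous])

lemma scale_less: "0 < x \<Longrightarrow> x < y \<Longrightarrow> scale x < scale y"
  by (rule DERIV_pos_imp_increasing[of x y scale], assumption)
    (metis scale_deriv rho_pos zero_less_divide_1_iff less_le_trans)

lemma speed_less: "0 < x \<Longrightarrow> x < y \<Longrightarrow> speed x < speed y"
  by (rule DERIV_pos_imp_increasing[of x y speed], assumption)
    (metis speed_deriv rho_pos less_le_trans)

lemma scale_mono: "0 < x \<Longrightarrow> x \<le> y \<Longrightarrow> scale x \<le> scale y"
  using scale_less by (cases "x = y") (auto simp: less_le)

lemma speed_mono: "0 < x \<Longrightarrow> x \<le> y \<Longrightarrow> speed x \<le> speed y"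
  using speed_less by (cases "x = y") (auto simp: less_le)

lemma nn_integral_scale:
  "0 < a \<Longrightarrow> a \<le> x \<Longrightarrow> (\<integral>\<^sup>+y\<in>{a<..<x}. ennreal (1 / rho b y) \<partial>lborel) = ennreal (scale x - scale a)"
  using rho_pos by (intro nn_integral_Ioo_antiderivative scale_deriv) (auto simp: less_imp_le)

lemma nn_integral_speed:
  "0 < a \<Longrightarrow> a \<le> x \<Longrightarrow> (\<integral>\<^sup>+y\<in>{a<..<x}. ennreal (rho b y) \<partial>lborel) = ennreal (speed x - speed a)"
  using rho_pos by (intro nn_integral_Ioo_antiderivative speed_deriv) (auto simp: less_imp_le)

lemma nn_integral_speed_Ioi:
  assumes x: "x > 0"
  shows "(\<integral>\<^sup>+y\<in>{x<..}. ennreal (rho b y) \<partial>lborel) = (SUP n. ennreal (speed (x + real n) - speed x))"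
proof -
  define g where "g n y = ennreal (rho b y) * indicator {x<..<x + real n} y" for n y
  have "rho b \<in> borel_measurable (restrict_space borel {0<..})"
    by (rule borel_measurable_continuous_on_restrict[OF rho_continuous])
  then have "(\<lambda>y. ennreal (rho b y)) \<in> borel_measurable (restrict_space borel {0<..})"
    by measurable
  then have m: "(\<lambda>y. ennreal (rho b y) * indicator {0<..} y) \<in> borel_measurable borel"
    by (simp add: borel_measurable_restrict_space_iff_ennreal)
  have g_eq: "g n = (\<lambda>y. ennreal (rho b y) * indicator {0<..} y * indicator {x<..<x + real n} y)" for n
    using x by (auto simp: g_def fun_eq_iff indicator_def)
  have gm: "g n \<in> borel_measurable lborel" for n
    unfolding g_eq using m by simp
  have inc: "incseq g"
    by (auto simp: incseq_def le_fun_def g_def indicator_def)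
  have "(\<integral>\<^sup>+y\<in>{x<..}. ennreal (rho b y) \<partial>lborel) = (\<integral>\<^sup>+y. (SUP n. g n y) \<partial>lborel)"
  proof (rule nn_integral_cong)
    fix y
    obtain n where n: "y < x + real n" using reals_Archimedean2[of "y - x"] by (auto simp: algebra_simps)
    have "(SUP n. g n y) = ennreal (rho b y) * indicator {x<..} y"
    proof (rule antisym)
      show "(SUP n. g n y) \<le> ennreal (rho b y) * indicator {x<..} y"
        by (rule SUP_least) (auto simp: g_def indicator_def)
      have "ennreal (rho b y) * indicator {x<..} y = g n y"
        using n by (auto simp: g_def indicator_def)
      also have "\<dots> \<le> (SUP n. g n y)" by (rule SUP_upper) simp
      finally show "ennreal (rho b y) * indicator {x<..} y \<le> (SUP n. g n y)" .
    qed
    then show "ennreal (rho b y) * indicator {x<..} y = (SUP n. g n y)" by simp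
  qed
  also have "\<dots> = (SUP n. \<integral>\<^sup>+y. g n y \<partial>lborel)"
    by (rule nn_integral_monotone_convergence_SUP[OF inc gm])
  also have "\<dots> = (SUP n. ennreal (speed (x + real n) - speed x))"
    unfolding g_def using x by (simp add: nn_integral_speed)
  finally show ?thesis .
qed

text \<open>Restrict the outer integral of the exit condition to (e, x); there the inner integral is
  at least speed c - speed x. The value of the double integral serves as K for all e and x.\<close>

lemma exit_boundary_bound:
  assumes "exit_boundary b"
  obtains c K where "c > 0" "\<And>e x. 0 < e \<Longrightarrow> e \<le> x \<Longrightarrow> x < c \<Longrightarrow> (scale x - scale e) * (speed c - speed x) \<le> K"
proof -
  obtain c where c: "c > 0" and fin: "(\<integral>\<^sup>+x\<in>{0<..<c}. ennreal (1 / rho b x) *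
        (\<integral>\<^sup>+y\<in>{x<..<c}. ennreal (rho b y) \<partial>lborel) \<partial>lborel) < \<infinity>" (is "?I < \<infinity>")
    using assms unfolding exit_boundary_def by blast
  have "(scale x - scale e) * (speed c - speed x) \<le> enn2real ?I" if e: "0 < e" "e \<le> x" "x < c" for e x
  proof -
    have "ennreal ((scale x - scale e) * (speed c - speed x))
        = (\<integral>\<^sup>+z\<in>{e<..<x}. ennreal (1 / rho b z * (speed c - speed x)) \<partial>lborel)"
    proof -
      have "(\<integral>\<^sup>+z\<in>{e<..<x}. ennreal (1 / rho b z * (speed c - speed x)) \<partial>lborel)
        = ennreal (scale x * (speed c - speed x) - scale e * (speed c - speed x))"
        using e rho_pos speed_less[of x c]
        by (intro nn_integral_Ioo_antiderivative DERIV_cmult_right scale_deriv) (auto simp: less_imp_le)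
      then show ?thesis by (simp add: left_diff_distrib)
    qed
    also have "\<dots> \<le> ?I"
    proof (rule nn_integral_mono)
      fix z
      show "ennreal (1 / rho b z * (speed c - speed x)) * indicator {e<..<x} z
        \<le> ennreal (1 / rho b z) * (\<integral>\<^sup>+y\<in>{z<..<c}. ennreal (rho b y) \<partial>lborel) * indicator {0<..<c} z"
      proof (cases "z \<in> {e<..<x}")
        case True
        then have z: "0 < z" "z < x" "z < c" using e by auto
        have "ennreal (1 / rho b z * (speed c - speed x)) \<le> ennreal (1 / rho b z * (speed c - speed z))"
          using speed_less[OF z(1,2)] rho_pos[of z] by (intro ennreal_leI mult_left_mono) auto
        also have "\<dots> = ennreal (1 / rho b z) * (\<integral>\<^sup>+y\<in>{z<..<c}. ennreal (rho b y) \<partial>lborel)"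
          unfolding nn_integral_speed[OF z(1) less_imp_le[OF z(3)]]
          by (rule ennreal_mult) (use rho_pos[of z] speed_less[OF z(1,3)] in \<open>simp_all add: less_imp_le\<close>)
        finally show ?thesis using True z by simp
      qed simp
    qed
    finally show ?thesis using fin by (rule le_enn2real)
  qed
  then show thesis by (rule that[OF c])
qed

lemma A_const_bound:
  assumes a: "a > 0" and "A_const b a < \<infinity>"
  obtains A where "\<And>x y. a < x \<Longrightarrow> x \<le> y \<Longrightarrow> (scale x - scale a) * (speed y - speed x) \<le> A"
proof -
  have "(scale x - scale a) * (speed y - speed x) \<le> enn2real (A_const b a)" if xy: "a < x" "x \<le> y" for x y
  proof -
    have "ennreal ((scale x - scale a) * (speed y - speed x))
      = (\<integral>\<^sup>+y\<in>{a<..<x}. ennreal (1 / rho b y) \<partial>lborel) * (\<integral>\<^sup>+z\<in>{x<..<y}. ennreal (rho b z) \<partial>lborel)"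
      using a xy scale_less[of a x] speed_mono[of x y]
      by (simp add: nn_integral_scale nn_integral_speed ennreal_mult)
    also have "\<dots> \<le> (\<integral>\<^sup>+y\<in>{a<..<x}. ennreal (1 / rho b y) \<partial>lborel) * (\<integral>\<^sup>+z\<in>{x<..}. ennreal (rho b z) \<partial>lborel)"
      by (intro mult_left_mono nn_integral_mono) (auto simp: indicator_def)
    also have "\<dots> \<le> A_const b a"
      unfolding A_const_def using xy by (intro SUP_upper) simp
    finally show ?thesis using assms(2) by (rule le_enn2real)
  qed
  then show thesis by (rule that)
qed

text \<open>Fix x = a + 1 in the bound: the scale factor is then a positive constant and only the
  tail of rho remains.\<close>

lemma speed_bounded:
  assumes a: "a > 0" "A_const b a < \<infinity>"
  obtains T where "\<And>y. y > 0 \<Longrightarrow> speed y < T"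
proof -
  obtain A where A: "\<And>x y. a < x \<Longrightarrow> x \<le> y \<Longrightarrow> (scale x - scale a) * (speed y - speed x) \<le> A"
    using A_const_bound[OF a] by blast
  define d where "d = scale (a + 1) - scale a"
  have d: "d > 0" using scale_less[of a "a + 1"] a by (simp add: d_def)
  have "speed y < speed (a + 1) + \<bar>A\<bar> / d + 1" if "y > 0" for y
  proof (cases "y \<ge> a + 1")
    case True
    then have "d * (speed y - speed (a + 1)) \<le> A" using A[of "a + 1" y] by (simp add: d_def)
    then have "speed y - speed (a + 1) \<le> A / d" using d by (simp add: field_simps)
    also have "\<dots> \<le> \<bar>A\<bar> / d" using d by (simp add: divide_right_mono)
    finally show ?thesis by simp
  next
    case False
    then have "speed y \<le> speed (a + 1)" using that by (intro speed_mono) auto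
    moreover have "0 \<le> \<bar>A\<bar> / d" using d by simp
    ultimately show ?thesis by linarith
  qed
  then show thesis using that by blast
qed

text \<open>The pair \<open>s = \<integral>\<^sub>0\<^sup>x \<rho>\<^sup>-\<^sup>1\<close>, \<open>R = \<integral>\<^sub>x\<^sup>\<infinity> \<rho>\<close> of Muckenhoupt's condition on the whole half line: near \<open>0\<close>
  the product \<open>s R\<close> is controlled by the exit condition, near \<open>\<infinity>\<close> by \<open>A_const\<close>.\<close>

lemma Muckenhoupt_pair:
  assumes exit: "exit_boundary b" and a: "a > 0" "A_const b a < \<infinity>"
  obtains s R C where
    "\<And>x. x > 0 \<Longrightarrow> s x > 0" "\<And>x. x > 0 \<Longrightarrow> (s has_real_derivative 1 / rho b x) (at x)"
    "\<And>x. x > 0 \<Longrightarrow> (R has_real_derivative - rho b x) (at x)"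
    "\<And>x. x > 0 \<Longrightarrow> 0 \<le> R x" "\<And>x. x > 0 \<Longrightarrow> s x * R x \<le> C" "C > 0"
proof -
  obtain c K where c: "c > 0"
    and K: "\<And>e x. 0 < e \<Longrightarrow> e \<le> x \<Longrightarrow> x < c \<Longrightarrow> (scale x - scale e) * (speed c - speed x) \<le> K"
    using exit_boundary_bound[OF exit] by blast
  obtain A where A: "\<And>x y. a < x \<Longrightarrow> x \<le> y \<Longrightarrow> (scale x - scale a) * (speed y - speed x) \<le> A"
    using A_const_bound[OF a] by blast
  obtain T where T: "\<And>y. y > 0 \<Longrightarrow> speed y < T" using speed_bounded[OF a] by blast
  \<comment> \<open>By monotonicity these are the limits of \<open>scale\<close> at 0 and of
    \<open>speed\<close> at \<infinity>; subtracting them makes s vanish at 0 and R at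
    \<infinity>.\<close>
  define l where "l = Inf (scale ` {0<..})"
  define u where "u = Sup (speed ` {0<..})"
  \<comment> \<open>The exit bound solved for \<open>scale e\<close>: it shows that
    \<open>scale\<close> has a finite limit at 0 and estimates how far below \<open>scale x\<close>
    that limit lies.\<close>
  have scale_ge: "scale x - K / (speed c - speed x) \<le> scale e" if x: "0 < x" "x < c" and e: "e > 0" for x e
  proof -
    have p: "speed c - speed x > 0" using speed_less[OF x] by simp
    have K0: "K \<ge> 0" using K[OF x(1) order_refl x(2)] by simp
    show ?thesis
    proof (cases "e \<le> x")
      case True
      then show ?thesis using K[OF e True x(2)] p by (simp add: field_simps)
    next
      case False
      then have "scale x \<le> scale e" using x by (intro scale_mono) auto
      moreover have "0 \<le> K / (speed c - speed x)" using p K0 by simp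
      ultimately show ?thesis by linarith
    qed
  qed
  have bdd: "bdd_below (scale ` {0<..})"
    using scale_ge[of "c/2"] c by (intro bdd_belowI2[where m = "scale (c/2) - K / (speed c - speed (c/2))"]) auto
  have bdd': "bdd_above (speed ` {0<..})" using T by (intro bdd_aboveI2[where M = T]) (auto simp: less_imp_le)
  define s R where "s x = scale x - l" and "R x = u - speed x" for x
  have s_pos: "s x > 0" if "x > 0" for x
  proof -
    have "l \<le> scale (x / 2)" unfolding l_def using that bdd by (intro cInf_lower) auto
    also have "\<dots> < scale x" using that by (intro scale_less) auto
    finally show ?thesis by (simp add: s_def)
  qed
  have R_nonneg: "R x \<ge> 0" if "x > 0" for x
    unfolding R_def u_def using that bdd' by (auto intro: cSup_upper)
  have s_mono: "s x \<le> s y" if "0 < x" "x \<le> y" for x y using scale_mono[OF that] by (simp add: s_def)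
  have R_mono: "R y \<le> R x" if "0 < x" "x \<le> y" for x y using speed_mono[OF that] by (simp add: R_def)
  \<comment> \<open>The sum covers the regions x < c (K and s c R c), c \<le> x \<le> a (s a R c)
    and x > a (A and s a R a). If c > a the middle region is empty. The 1 makes C positive.\<close>
  define C where "C = 1 + K + s c * R c + s a * R c + A + s a * R a"
  have K0: "K \<ge> 0" using K[of "c/2" "c/2"] c by simp
  have A0: "A \<ge> 0" using A[of "a+1" "a+1"] by simp
  note nn = s_pos[OF a(1), THEN less_imp_le] s_pos[OF c, THEN less_imp_le] R_nonneg[OF a(1)] R_nonneg[OF c]
  note nn' = mult_nonneg_nonneg[OF nn(2) nn(4)] mult_nonneg_nonneg[OF nn(1) nn(4)] mult_nonneg_nonneg[OF nn(1) nn(3)]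
  have "s x * R x \<le> C" if x: "x > 0" for x
  proof -
    consider "x < c" | "c \<le> x" "x \<le> a" | "a < x" by linarith
    then show ?thesis
    proof cases
      case 1
      have p: "speed c - speed x > 0" using speed_less[OF x 1] by simp
      have "scale x - K / (speed c - speed x) \<le> l"
        unfolding l_def using scale_ge[OF x 1] by (intro cInf_greatest) auto
      then have "s x * (speed c - speed x) \<le> K" using p by (simp add: s_def field_simps)
      moreover have "s x * R c \<le> s c * R c" using s_mono[OF x] 1 nn by (intro mult_right_mono) auto
      moreover have "s x * R x = s x * (speed c - speed x) + s x * R c" by (simp add: R_def algebra_simps)
      ultimately show ?thesis using nn' A0 unfolding C_def by linarith
    next
      case 2
      have "s x * R x \<le> s a * R c" using 2 s_mono[OF x] R_mono[OF c] nn R_nonneg[OF x] by (intro mult_mono) auto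
      then show ?thesis using nn' A0 K0 unfolding C_def by linarith
    next
      case 3
      have p: "scale x - scale a > 0" using scale_less[OF a(1) 3] by simp
      have "u \<le> speed x + A / (scale x - scale a)"
        unfolding u_def
      proof (rule cSup_least, simp, elim imageE)
        fix w y assume w: "w = speed y" "y \<in> {0<..}"
        show "w \<le> speed x + A / (scale x - scale a)"
        proof (cases "x \<le> y")
          case True
          then show ?thesis using A[OF 3 True] p w by (simp add: field_simps)
        next
          case False
          then have "speed y \<le> speed x" using w by (intro speed_mono) auto
          moreover have "0 \<le> A / (scale x - scale a)" using p A0 by simp
          ultimately show ?thesis using w by linarith
        qed
      qed
      then have "(scale x - scale a) * R x \<le> A" using p by (simp add: R_def field_simps)
      moreover have "s a * R x \<le> s a * R a" using R_mono[OF a(1)] 3 nn by (intro mult_left_mono) auto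
      moreover have "s x * R x = (scale x - scale a) * R x + s a * R x" by (simp add: s_def algebra_simps)
      ultimately show ?thesis using nn' K0 unfolding C_def by linarith
    qed
  qed
  moreover have "C > 0" using nn' A0 K0 unfolding C_def by linarith
  moreover have "(s has_real_derivative 1 / rho b x) (at x)" "(R has_real_derivative - rho b x) (at x)" if "x > 0" for x
    unfolding s_def[abs_def] R_def[abs_def]
    using scale_deriv[OF that] speed_deriv[OF that] by (auto intro!: derivative_eq_intros)
  ultimately show thesis using that s_pos R_nonneg by blast
qed

text \<open>The integrand satisfies \<open>|\<phi>|\<^sup>2 \<rho> + (|\<phi>|\<^sup>2 (R + C / s))' \<le> 4 C |\<phi>'|\<^sup>2 \<rho>\<close> pointwise.\<close>

lemma Hardy_inequality:
  assumes exit: "exit_boundary b" and a: "a > 0" "A_const b a < \<infinity>"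
  obtains C where "C > 0" "\<And>\<phi>. \<phi> \<in> test_functions \<Longrightarrow>
    (L2_norm (rho_measure b) \<phi>)\<^sup>2 \<le> C * (L2_norm (rho_measure b) (dv \<phi>))\<^sup>2"
proof -
  obtain s R C where s: "\<And>x. x > 0 \<Longrightarrow> s x > 0" "\<And>x. x > 0 \<Longrightarrow> (s has_real_derivative 1 / rho b x) (at x)"
    and R: "\<And>x. x > 0 \<Longrightarrow> (R has_real_derivative - rho b x) (at x)" "\<And>x. x > 0 \<Longrightarrow> 0 \<le> R x"
    and sR: "\<And>x. x > 0 \<Longrightarrow> s x * R x \<le> C" and C: "C > 0"
    using Muckenhoupt_pair[OF assms] by blast
  have "(L2_norm (rho_measure b) \<phi>)\<^sup>2 \<le> 4 * C * (L2_norm (rho_measure b) (dv \<phi>))\<^sup>2"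
    if \<phi>: "\<phi> \<in> test_functions" for \<phi>
  proof -
    obtain p q where p: "0 < p" "p < q"
      and z: "\<And>x. x \<notin> {p<..<q} \<Longrightarrow> \<phi> x = 0 \<and> dv \<phi> x = 0 \<and> \<phi> x = 0 \<and> dv \<phi> x = 0"
      using test_common_support[OF \<phi> \<phi>] by blast
    have z': "\<phi> x = 0" "dv \<phi> x = 0" if "x \<notin> {p..q}" for x using z[of x] that by auto
    define n where "n x = (cmod (\<phi> x))\<^sup>2" for x
    define n' where "n' x = 2 * (Re (\<phi> x) * Re (dv \<phi> x) + Im (\<phi> x) * Im (dv \<phi> x))" for x
    define m where "m x = (cmod (dv \<phi> x))\<^sup>2" for x
    have n_deriv: "(n has_real_derivative n' x) (at x)" for x
    proof -
      note d = test_has_vector_derivative[OF \<phi>, of x]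
      have "((\<lambda>x. Re (\<phi> x)) has_real_derivative Re (dv \<phi> x)) (at x)"
        "((\<lambda>x. Im (\<phi> x)) has_real_derivative Im (dv \<phi> x)) (at x)"
        using bounded_linear.has_vector_derivative[OF bounded_linear_Re d]
          bounded_linear.has_vector_derivative[OF bounded_linear_Im d]
        by (simp_all add: has_real_derivative_iff_has_vector_derivative)
      from DERIV_add[OF DERIV_power[OF this(1), of 2] DERIV_power[OF this(2), of 2]]
      show ?thesis unfolding n_def cmod_power2 n'_def by (simp add: algebra_simps)
    qed
    have n'_le: "n' x \<le> 2 * cmod (\<phi> x) * cmod (dv \<phi> x)" for x
    proof -
      have "Re (\<phi> x * cnj (dv \<phi> x)) \<le> cmod (\<phi> x * cnj (dv \<phi> x))" by (rule complex_Re_le_cmod)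
      then show ?thesis by (simp add: n'_def norm_mult)
    qed
    \<comment> \<open>The term C/s is added to R because its derivative -C / (rho s^2) absorbs the
      cross term coming from n'; by the bound on s R, adding it at most doubles the factor C/s that
      dominates R.\<close>
    define G where "G x = n x * (R x + C / s x)" for x
    define G' where "G' x = n' x * (R x + C / s x) + n x * (- rho b x - C / (rho b x * (s x)\<^sup>2))" for x
    have G_deriv: "(G has_real_derivative G' x) (at x)" if x: "x > 0" for x
    proof -
      have ne: "s x \<noteq> 0" "rho b x \<noteq> 0" using s(1)[OF x] rho_pos[of x] by simp_all
      have "((\<lambda>x. C / s x) has_real_derivative (0 * s x - C * (1 / rho b x)) / (s x * s x)) (at x)"
        by (rule DERIV_divide[OF DERIV_const s(2)[OF x] ne(1)])
      moreover have "(0 * s x - C * (1 / rho b x)) / (s x * s x) = - (C / (rho b x * (s x)\<^sup>2))"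
        by (simp add: power2_eq_square)
      ultimately have "((\<lambda>x. C / s x) has_real_derivative - (C / (rho b x * (s x)\<^sup>2))) (at x)" by metis
      from DERIV_mult[OF n_deriv DERIV_add[OF R(1)[OF x] this]]
      show ?thesis unfolding G_def[abs_def] G'_def by (simp add: algebra_simps)
    qed
    have "(G' has_integral (G q - G p)) {p..q}"
      using p G_deriv by (intro fundamental_theorem_of_calculus)
        (auto simp: has_real_derivative_iff_has_vector_derivative[symmetric] intro: has_field_derivative_at_within)
    moreover have "G q = 0" "G p = 0" using z[of p] z[of q] by (simp_all add: G_def n_def)
    ultimately have G0: "(G' has_integral 0) {p..q}" by simp
    have cont: "continuous_on {0<..} n" "continuous_on {0<..} m"
      unfolding n_def m_def by (intro continuous_intros test_continuous test_deriv \<phi>)+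
    have int: "(\<lambda>x. rho b x * n x) integrable_on {p..q}" "(\<lambda>x. rho b x * m x) integrable_on {p..q}"
      by (intro integrable_continuous_real continuous_intros continuous_on_subset[OF rho_continuous]
          continuous_on_subset[OF cont(1)] continuous_on_subset[OF cont(2)]; use p in auto)+
    have "integral {p..q} (\<lambda>x. rho b x * n x) + 0 \<le> 4 * C * integral {p..q} (\<lambda>x. rho b x * m x)"
    proof (rule has_integral_le[OF has_integral_add[OF integrable_integral[OF int(1)] G0]
          has_integral_mult_right[OF integrable_integral[OF int(2)]]])
      fix x assume "x \<in> {p..q}"
      then have x: "x > 0" using p by auto
      define f g where "f = cmod (\<phi> x)" and "g = cmod (dv \<phi> x)"
      have fg: "f \<ge> 0" "g \<ge> 0" by (simp_all add: f_def g_def)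
      have R_le: "R x \<le> C / s x" using sR[OF x] s(1)[OF x] by (simp add: field_simps)
      have "n' x * (R x + C / s x) \<le> (2 * f * g) * (R x + C / s x)"
        using n'_le[of x] R(2)[OF x] C s(1)[OF x] by (intro mult_right_mono) (auto simp: f_def g_def)
      also have "\<dots> \<le> (2 * f * g) * (C / s x + C / s x)"
        using R_le fg by (intro mult_left_mono) auto
      also have "\<dots> = 4 * C * f * g / s x" by simp
      also have "\<dots> \<le> 4 * C * (rho b x * g\<^sup>2) + f\<^sup>2 * (C / (rho b x * (s x)\<^sup>2))"
      proof -
        \<comment> \<open>Young's inequality as a square. The weight is chosen so that the f^2 term
          is exactly the one that G' supplies with negative sign; the g^2 term is the origin of the
          constant 4 C.\<close>
        have "0 \<le> C * rho b x * (f / (s x * rho b x) - 2 * g)\<^sup>2"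
          using C rho_pos[of x] by simp
        also have "\<dots> = 4 * C * (rho b x * g\<^sup>2) + f\<^sup>2 * (C / (rho b x * (s x)\<^sup>2)) - 4 * C * f * g / s x"
        proof -
          define S P where "S = s x" and "P = rho b x"
          have "S \<noteq> 0" "P \<noteq> 0" using rho_pos[of x] s(1)[OF x] by (simp_all add: S_def P_def)
          then have "C * P * (f / (S * P) - 2 * g)\<^sup>2
            = 4 * C * (P * g\<^sup>2) + f\<^sup>2 * (C / (P * S\<^sup>2)) - 4 * C * f * g / S"
            by (simp add: power2_eq_square divide_simps) (simp add: algebra_simps)
          then show ?thesis by (simp only: S_def P_def)
        qed
        finally show ?thesis by simp
      qed
      finally show "rho b x * n x + G' x \<le> 4 * C * (rho b x * m x)"
        by (simp add: G'_def n_def m_def f_def g_def algebra_simps)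
    qed
    moreover have "(L2_norm (rho_measure b) \<phi>)\<^sup>2 = integral {p..q} (\<lambda>x. rho b x *\<^sub>R n x)"
      unfolding L2_norm_sq n_def[symmetric]
      by (rule rho_integral_compact[OF cont(1) p(1)]) (use z' in \<open>simp add: n_def\<close>)
    moreover have "(L2_norm (rho_measure b) (dv \<phi>))\<^sup>2 = integral {p..q} (\<lambda>x. rho b x *\<^sub>R m x)"
      unfolding L2_norm_sq m_def[symmetric]
      by (rule rho_integral_compact[OF cont(2) p(1)]) (use z' in \<open>simp add: m_def\<close>)
    ultimately show ?thesis by simp
  qed
  then show thesis using that[of "4 * C"] C by simp
qed

end

section \<open>Smooth approximation of compactly supported functions\<close>

text \<open>\<open>bump r R k p\<close> with \<open>p\<close> a polynomial is \<open>p u\<^sup>-\<^sup>k exp (-1/u)\<close>, \<open>u = (x - r) (R - x)\<close>; this family is closed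
  under differentiation.\<close>

definition bump :: "real \<Rightarrow> real \<Rightarrow> nat \<Rightarrow> (real \<Rightarrow> real) \<Rightarrow> real \<Rightarrow> real" where
  "bump r R k p x = (if r < x \<and> x < R
     then p x / ((x - r) * (R - x)) ^ k * exp (- 1 / ((x - r) * (R - x))) else 0)"

text \<open>Take the (n+1)-st power of t \<le> exp t at t = 1 / ((n+1) u). The exponential thus
  beats every negative power of u.\<close>

lemma exp_neg_inverse_le:
  fixes u :: real
  assumes u: "u > 0"
  shows "exp (- 1 / u) \<le> (real (Suc n) * u) ^ Suc n"
proof -
  define m where "m = Suc n"
  have "1 / (real m * u) \<le> exp (1 / (real m * u))"
    by (rule order_trans[OF _ exp_ge_add_one_self]) simp
  then have "(1 / (real m * u)) ^ m \<le> exp (1 / (real m * u)) ^ m"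
    using u by (intro power_mono) (auto simp: m_def)
  also have "\<dots> = exp (real m * (1 / (real m * u)))" by (rule exp_of_nat_mult[symmetric])
  also have "real m * (1 / (real m * u)) = 1 / u" by (simp add: m_def)
  finally have "1 / (real m * u) ^ m \<le> exp (1 / u)" by (simp add: power_divide)
  then have "inverse (exp (1 / u)) \<le> inverse (1 / (real m * u) ^ m)"
    using u by (intro le_imp_inverse_le) (auto simp: m_def)
  then show ?thesis by (simp add: m_def exp_minus[symmetric])
qed

text \<open>Using k + 2 powers from \<open>exp_neg_inverse_le\<close>, k of them cancel the
  denominator and u^2 remains. Quadratic vanishing at r and R gives derivative 0 there without any
  one-sided limits.\<close>

lemma bump_quadratic_bound:
  assumes p: "continuous_on {r..R} p"
  obtains C where "\<And>x. \<bar>bump r R k p x\<bar> \<le> C * (x - r)\<^sup>2" "\<And>x. \<bar>bump r R k p x\<bar> \<le> C * (x - R)\<^sup>2"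
proof -
  have "bounded (p ` {r..R})" by (intro compact_imp_bounded compact_continuous_image p compact_Icc)
  then obtain B where "\<forall>y\<in>p ` {r..R}. norm y \<le> B" and B0: "B > 0"
    unfolding bounded_pos by blast
  then have B: "\<bar>p x\<bar> \<le> B" "B > 0" if "x \<in> {r..R}" for x using that by auto
  define K where "K = real (Suc (Suc k)) ^ Suc (Suc k)"
  define C where "C = B * K * (R - r)\<^sup>2"
  have K: "K \<ge> 0" by (simp add: K_def)
  have main: "\<bar>bump r R k p x\<bar> \<le> B * K * ((x - r) * (R - x))\<^sup>2" if x: "r < x" "x < R" for x
  proof -
    define u where "u = (x - r) * (R - x)"
    have u: "u > 0" using x by (simp add: u_def)
    have "\<bar>bump r R k p x\<bar> = \<bar>p x\<bar> / u ^ k * exp (- 1 / u)"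
      using x u by (simp add: bump_def u_def[symmetric] abs_mult)
    also have "\<dots> \<le> B / u ^ k * (real (Suc (Suc k)) * u) ^ Suc (Suc k)"
      using u B(1)[of x] B0 x exp_neg_inverse_le[OF u, of "Suc k"]
      by (intro mult_mono divide_right_mono) auto
    also have "\<dots> = B * K * u\<^sup>2"
      unfolding K_def power_mult_distrib using u by (simp add: power2_eq_square)
    finally show ?thesis by (simp add: u_def)
  qed
  have "\<bar>bump r R k p x\<bar> \<le> C * (x - r)\<^sup>2 \<and> \<bar>bump r R k p x\<bar> \<le> C * (x - R)\<^sup>2" for x
  proof (cases "r < x \<and> x < R")
    case True
    then have "(x - r)\<^sup>2 \<le> (R - r)\<^sup>2" "(R - x)\<^sup>2 \<le> (R - r)\<^sup>2" by (auto intro!: power_mono)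
    then have "B * K * (x - r)\<^sup>2 * (R - x)\<^sup>2 \<le> B * K * (x - r)\<^sup>2 * (R - r)\<^sup>2"
      "B * K * (R - x)\<^sup>2 * (x - r)\<^sup>2 \<le> B * K * (R - x)\<^sup>2 * (R - r)\<^sup>2"
      using B0 K by (intro mult_left_mono; simp)+
    then show ?thesis using main[of x] True
      by (simp add: C_def power_mult_distrib power2_commute[of x R] mult_ac)
  next
    case False
    then show ?thesis using B0 K by (auto simp: bump_def C_def)
  qed
  then show thesis using that by blast
qed

lemma quadratic_bound_imp_deriv_0:
  fixes f :: "real \<Rightarrow> real"
  assumes "\<And>x. \<bar>f x\<bar> \<le> C * (x - a)\<^sup>2"
  shows "(f has_real_derivative 0) (at a)"
proof -
  have fa: "f a = 0" using assms[of a] by simp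
  have "((\<lambda>h. (f (a + h) - f a) / h) \<longlongrightarrow> 0) (at 0)"
  proof (rule Lim_null_comparison)
    show "\<forall>\<^sub>F h in at 0. norm ((f (a + h) - f a) / h) \<le> C * \<bar>h\<bar>"
      unfolding eventually_at_filter
    proof (intro always_eventually allI impI)
      fix h :: real assume "h \<noteq> 0"
      then show "norm ((f (a + h) - f a) / h) \<le> C * \<bar>h\<bar>"
        using assms[of "a + h"] by (simp add: fa abs_divide divide_le_eq power2_eq_square abs_mult_self_eq mult.assoc)
    qed
    have "((\<lambda>h. C * \<bar>h\<bar>) \<longlongrightarrow> C * \<bar>0\<bar>) (at 0)" by (intro tendsto_intros)
    then show "((\<lambda>h. C * \<bar>h\<bar>) \<longlongrightarrow> 0) (at 0)" by simp
  qed
  then show ?thesis by (simp add: DERIV_def)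
qed

text \<open>Inside (r, R) this is the quotient rule over the common denominator
  \<open>u^(k+2)\<close>: the exponential contributes u'/u^2, and the other two terms are expanded
  by u^2 and u. At r and R the quadratic bound gives derivative 0, which is also the value of the
  new bump.\<close>

lemma bump_deriv:
  assumes p: "\<And>x. (p has_real_derivative p' x) (at x)"
  shows "(bump r R k p has_real_derivative
    bump r R (Suc (Suc k)) (\<lambda>x. p' x * ((x - r) * (R - x))\<^sup>2
      - real k * p x * (R + r - 2 * x) * ((x - r) * (R - x)) + p x * (R + r - 2 * x)) x) (at x)"
    (is "(_ has_real_derivative bump r R _ ?q x) _")
proof -
  have pc: "continuous_on {r..R} p" using p by (intro DERIV_continuous_on) (auto intro: has_field_derivative_at_within)
  consider "r < x" "x < R" | "x < r \<or> R < x" | "x = r \<or> x = R" by linarith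
  then show ?thesis
  proof cases
    case 1
    define u where "u y = (y - r) * (R - y)" for y
    have u: "u x \<noteq> 0" using 1 by (simp add: u_def)
    have du: "(u has_real_derivative (R + r - 2 * x)) (at x)"
      unfolding u_def by (auto intro!: derivative_eq_intros)
    let ?u' = "R + r - 2 * x"
    have e: "((\<lambda>y. exp (- 1 / u y)) has_real_derivative exp (- 1 / u x) * (?u' / (u x)\<^sup>2)) (at x)"
      using u by (auto intro!: derivative_eq_intros du simp: power2_eq_square field_simps)
    have d: "((\<lambda>y. p y / u y ^ k) has_real_derivative
        (p' x * u x ^ k - p x * (real k * (?u' * u x ^ (k - Suc 0)))) / (u x ^ k * u x ^ k)) (at x)"
      using u by (intro DERIV_divide p DERIV_power[OF du, of k, simplified]) simp
    have "((\<lambda>y. p y / u y ^ k * exp (- 1 / u y)) has_real_derivative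
       (p' x * u x ^ k - p x * (real k * (?u' * u x ^ (k - Suc 0)))) / (u x ^ k * u x ^ k) * exp (- 1 / u x)
       + exp (- 1 / u x) * (?u' / (u x)\<^sup>2) * (p x / u x ^ k)) (at x)"
      by (rule DERIV_mult[OF d e])
    moreover have "(p' x * u x ^ k - p x * (real k * (?u' * u x ^ (k - Suc 0)))) / (u x ^ k * u x ^ k) * exp (- 1 / u x)
       + exp (- 1 / u x) * (?u' / (u x)\<^sup>2) * (p x / u x ^ k)
      = (p' x * (u x)\<^sup>2 - real k * p x * ?u' * u x + p x * ?u') / u x ^ Suc (Suc k) * exp (- 1 / u x)"
    \<comment> \<open>For k = 0 the exponent k - Suc 0 is truncated to 0, but the factor k removes
      that term.\<close>
    proof (cases k)
      case 0
      then show ?thesis using u by (simp add: field_simps power2_eq_square)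
    next
      case (Suc j)
      define v where "v = u x ^ j"
      have v: "v \<noteq> 0" using u by (simp add: v_def)
      show ?thesis unfolding Suc using u v
        by (simp add: v_def[symmetric] power2_eq_square divide_simps) (simp add: algebra_simps)
    qed
    moreover have "bump r R (Suc (Suc k)) ?q x
      = (p' x * (u x)\<^sup>2 - real k * p x * ?u' * u x + p x * ?u') / u x ^ Suc (Suc k) * exp (- 1 / u x)"
      using 1 by (simp add: bump_def u_def)
    ultimately have "((\<lambda>y. p y / u y ^ k * exp (- 1 / u y)) has_real_derivative bump r R (Suc (Suc k)) ?q x) (at x)"
      by simp
    then show ?thesis
      by (rule has_field_derivative_transform_within_open[of _ _ _ "{r<..<R}"])
         (use 1 in \<open>auto simp: bump_def u_def\<close>)
  next
    case 2
    have "((\<lambda>y. 0) has_real_derivative bump r R (Suc (Suc k)) ?q x) (at x)"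
      using 2 by (auto simp: bump_def)
    then show ?thesis
      by (rule has_field_derivative_transform_within_open[of _ _ _ "{..<r} \<union> {R<..}"])
         (use 2 in \<open>auto simp: bump_def\<close>)
  next
    case 3
    obtain C where "\<And>x. \<bar>bump r R k p x\<bar> \<le> C * (x - r)\<^sup>2" "\<And>x. \<bar>bump r R k p x\<bar> \<le> C * (x - R)\<^sup>2"
      using bump_quadratic_bound[OF pc] by blast
    then have "(bump r R k p has_real_derivative 0) (at x)"
      using 3 quadratic_bound_imp_deriv_0[of "bump r R k p" C] by blast
    then show ?thesis using 3 by (auto simp: bump_def)
  qed
qed

text \<open>The induction keeps the power and the polynomial existential: only membership of the
  n-th derivative in the family matters.\<close>

lemma bump_test_function:
  assumes p: "real_polynomial_function p" and r: "0 < r"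
  shows "(\<lambda>x. of_real (bump r R k p x)) \<in> test_functions"
proof -
  let ?D = "\<lambda>f y. vector_derivative f (at y) :: complex"
  have "\<exists>k' p'. real_polynomial_function p' \<and> (?D ^^ n) (\<lambda>x. of_real (bump r R k p x)) = (\<lambda>x. of_real (bump r R k' p' x))" for n
  proof (induction n)
    case 0
    then show ?case using p by auto
  next
    case (Suc n)
    then obtain k' p' where p': "real_polynomial_function p'"
      and eq: "(?D ^^ n) (\<lambda>x. of_real (bump r R k p x)) = (\<lambda>x. of_real (bump r R k' p' x))" by blast
    obtain p'' where p'': "real_polynomial_function p''" "\<And>x. (p' has_real_derivative p'' x) (at x)"
      using has_real_derivative_polynomial_function[OF p'] by blast
    have id: "real_polynomial_function (\<lambda>x::real. x)" by (intro real_polynomial_function.intros(1) bounded_linear_ident)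
    define s where "s x = p'' x * ((x - r) * (R - x))\<^sup>2
      - real k' * p' x * (R + r - 2 * x) * ((x - r) * (R - x)) + p' x * (R + r - 2 * x)" for x
    have "real_polynomial_function s"
      unfolding s_def
      by (intro real_polynomial_function.intros(3) real_polynomial_function.intros(4) real_polynomial_function_diff
          real_polynomial_function_power real_polynomial_function.intros(2) p' p'' id)
    moreover have "((\<lambda>x. complex_of_real (bump r R k' p' x)) has_vector_derivative of_real (bump r R (Suc (Suc k')) s x)) (at x)" for x
      using bump_deriv[of p' p'' r R k' x] p''(2)
      unfolding s_def[abs_def, symmetric]
      by (intro has_vector_derivative_of_real) (simp add: has_real_derivative_iff_has_vector_derivative)
    then have "?D (\<lambda>x. complex_of_real (bump r R k' p' x)) = (\<lambda>x. of_real (bump r R (Suc (Suc k')) s x))"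
      by (intro ext vector_derivative_at)
    then have "(?D ^^ Suc n) (\<lambda>x. of_real (bump r R k p x)) = (\<lambda>x. of_real (bump r R (Suc (Suc k')) s x))"
      by (simp add: eq)
    ultimately show ?case by blast
  qed
  moreover have "(\<lambda>x. complex_of_real (bump r R k' p' x)) differentiable (at x)" if p': "real_polynomial_function p'" for k' p' x
  proof -
    obtain p'' where p'': "\<And>x. (p' has_real_derivative p'' x) (at x)"
      using has_real_derivative_polynomial_function[OF p'] by blast
    have "((\<lambda>x. complex_of_real (bump r R k' p' x)) has_vector_derivative of_real (bump r R (Suc (Suc k'))
       (\<lambda>x. p'' x * ((x - r) * (R - x))\<^sup>2
      - real k' * p' x * (R + r - 2 * x) * ((x - r) * (R - x)) + p' x * (R + r - 2 * x)) x)) (at x)"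
      using bump_deriv[of p' p'' r R k' x] p''
      by (intro has_vector_derivative_of_real) (simp add: has_real_derivative_iff_has_vector_derivative)
    then show ?thesis by (rule differentiableI_vector)
  qed
  ultimately have "(?D ^^ n) (\<lambda>x. of_real (bump r R k p x)) differentiable (at x)" for n x by metis
  moreover have "bump r R k p x = 0" if "x \<notin> {r..R}" for x using that by (auto simp: bump_def)
  ultimately show ?thesis unfolding test_functions_def using r by auto
qed

section \<open>Approximation in C1 by test functions\<close>

lemma polynomial_antiderivative:
  assumes "real_polynomial_function (q :: real \<Rightarrow> real)"
  obtains p where "real_polynomial_function p" "\<And>x. (p has_real_derivative q x) (at x)" "p a = 0"
proof -
  obtain c n where q: "q = (\<lambda>x. \<Sum>i\<le>n. c i * x ^ i)"
    using real_polynomial_function_imp_sum[OF assms] by blast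
  define P where "P x = (\<Sum>i\<le>n. c i / real (Suc i) * x ^ Suc i)" for x
  have id: "real_polynomial_function (\<lambda>x::real. x)" by (intro real_polynomial_function.intros(1) bounded_linear_ident)
  have "real_polynomial_function (\<lambda>x. P x - P a)"
    unfolding P_def
    by (intro real_polynomial_function_diff real_polynomial_function_sum real_polynomial_function.intros(4)
        real_polynomial_function_power real_polynomial_function.intros(2) id finite_atMost)
  moreover have "((\<lambda>x. P x - P a) has_real_derivative q x - 0) (at x)" for x
    unfolding q P_def
  proof (intro DERIV_diff DERIV_const DERIV_sum)
    fix i
    have "((\<lambda>x. c i / real (Suc i) * x ^ Suc i) has_real_derivative c i / real (Suc i) * (real (Suc i) * x ^ i)) (at x)"
      using DERIV_cmult[OF DERIV_pow[of "Suc i" x], of "c i / real (Suc i)"] by simp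
    then show "((\<lambda>x. c i / real (Suc i) * x ^ Suc i) has_real_derivative c i * x ^ i) (at x)" by simp
  qed
  ultimately show thesis using that[of "\<lambda>x. P x - P a"] by simp
qed

lemma derivative_zero_outside_support:
  fixes f f' :: "real \<Rightarrow> real"
  assumes f: "\<And>x. (f has_real_derivative f' x) (at x)"
    and supp: "\<And>x. x \<notin> {r..R} \<Longrightarrow> f x = 0" and x: "x \<notin> {r..R}"
  shows "f' x = 0"
proof -
  have "((\<lambda>x. 0) has_real_derivative f' x) (at x)"
    by (rule has_field_derivative_transform_within_open[OF f, of "- {r..R}"]) (use x supp in auto)
  then show ?thesis using DERIV_unique[OF _ DERIV_const] by blast
qed

text \<open>Approximate \<open>f / w\<close> with \<open>w = exp (-1/u)\<close> by a polynomial in \<open>C\<^sup>1\<close> and multiply by \<open>w\<close>.\<close>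

lemma C1_approximation:
  assumes r: "0 < r" "r < r'" "r' < R'" "R' < R"
    and f: "\<And>x. (f has_real_derivative f' x) (at x)" and f': "continuous_on UNIV f'"
    and supp: "\<And>x. x \<notin> {r'..R'} \<Longrightarrow> f x = 0" and e: "e > 0"
  obtains g where "(\<lambda>x. complex_of_real (g x)) \<in> test_functions"
    "\<And>x. x \<notin> {r..R} \<Longrightarrow> g x = 0" "\<And>x. \<bar>g x - f x\<bar> \<le> e"
    "\<And>x D. (g has_real_derivative D) (at x) \<Longrightarrow> \<bar>D - f' x\<bar> \<le> e"
proof -
  define w where "w = bump r R 0 (\<lambda>_. 1)"
  define w' where "w' = bump r R (Suc (Suc 0)) (\<lambda>x. R + r - 2 * x)"
  have dw: "(w has_real_derivative w' x) (at x)" for x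
    using bump_deriv[of "\<lambda>_. 1" "\<lambda>_. 0" r R 0 x] by (simp add: w_def w'_def)
  have w_pos: "w x > 0" if "r < x" "x < R" for x using that by (simp add: w_def bump_def)
  have w_le: "\<bar>w x\<bar> \<le> 1" for x
    by (auto simp: w_def bump_def)
  have w0: "w x = 0" if "\<not> (r < x \<and> x < R)" for x using that by (simp add: w_def bump_def)
  have w'0: "w' x = 0" if "\<not> (r < x \<and> x < R)" for x using that by (auto simp: w'_def bump_def)
  have w'_cont: "continuous_on UNIV w'"
  proof -
    have "\<exists>D. (w' has_real_derivative D) (at x)" for x
      unfolding w'_def using bump_deriv[of "\<lambda>x. R + r - 2 * x" "\<lambda>_. - 2" r R "Suc (Suc 0)" x]
      by (force intro!: derivative_eq_intros)
    then show ?thesis by (meson DERIV_isCont continuous_at_imp_continuous_on)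
  qed
  have w_cont: "continuous_on UNIV w" using dw by (meson DERIV_isCont continuous_at_imp_continuous_on)
  have f_cont: "continuous_on UNIV f" using f by (meson DERIV_isCont continuous_at_imp_continuous_on)
  have supp': "f' x = 0" if "x \<notin> {r'..R'}" for x
    using f supp that by (rule derivative_zero_outside_support)
  \<comment> \<open>Off (r, R) the denominators are 0 and the quotients are 0 by convention, which
    is the right value: f already vanishes outside the smaller interval [r', R'], where w is still
    positive.\<close>
  define h h' where "h x = f x / w x" and "h' x = (f' x * w x - f x * w' x) / (w x * w x)" for x
  have dh: "(h has_real_derivative h' x) (at x)" for x
  proof (cases "r < x \<and> x < R")
    case True
    then show ?thesis unfolding h_def h'_def
      using w_pos[of x] by (intro DERIV_divide f dw) auto
  next
    case False
    then have x: "x \<notin> {r'..R'}" using r by auto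
    have "((\<lambda>x. 0) has_real_derivative h' x) (at x)"
      using supp[OF x] supp'[OF x] by (simp add: h'_def)
    then show ?thesis
      by (rule has_field_derivative_transform_within_open[of _ _ _ "- {r'..R'}"])
         (use x supp in \<open>auto simp: h_def\<close>)
  qed
  have h'_cont: "continuous_on UNIV h'"
  proof -
    have "continuous_on {r<..<R} h'"
      unfolding h'_def using w_pos
      by (intro continuous_intros continuous_on_subset[OF f'] continuous_on_subset[OF w_cont]
          continuous_on_subset[OF w'_cont] continuous_on_subset[OF f_cont]) (force intro!: less_imp_neq[THEN not_sym])+
    moreover have "continuous_on (- {r'..R'}) h'"
      using continuous_on_cong[of "- {r'..R'}" "- {r'..R'}" h' "\<lambda>_. 0"] supp supp' by (auto simp: h'_def)
    ultimately have "continuous_on ({r<..<R} \<union> - {r'..R'}) h'" by (intro continuous_on_open_Un) auto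
    moreover have "{r<..<R} \<union> - {r'..R'} = UNIV" using r by auto
    ultimately show ?thesis by simp
  qed
  have "bounded (w' ` {r..R})"
    by (intro compact_imp_bounded compact_continuous_image compact_Icc continuous_on_subset[OF w'_cont]) auto
  then obtain W where W: "\<forall>y\<in>w' ` {r..R}. norm y \<le> W" "W > 0" unfolding bounded_pos by blast
  then have W': "\<bar>w' x\<bar> \<le> W" if "x \<in> {r..R}" for x using that by auto
  \<comment> \<open>The error in the derivative is at most W times the error of p, plus the error of
    q, that is W d (R - r) + d; the extra d (R - r) covers the error of the function itself.\<close>
  define d where "d = e / ((W + 1) * (R - r) + 1)"
  have pos: "(W + 1) * (R - r) + 1 > 0" using W(2) r by (intro add_pos_pos mult_pos_pos) auto
  have d: "d > 0" using e pos by (simp add: d_def)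
  \<comment> \<open>Approximating the derivative and integrating from r, where h = 0, controls both
    errors at once.\<close>
  obtain q where q: "real_polynomial_function q" "\<And>x. x \<in> {r..R} \<Longrightarrow> \<bar>h' x - q x\<bar> < d"
    using Stone_Weierstrass_real_polynomial_function[OF compact_Icc continuous_on_subset[OF h'_cont] d, of r R] by blast
  obtain p where p: "real_polynomial_function p" "\<And>x. (p has_real_derivative q x) (at x)" "p r = 0"
    using polynomial_antiderivative[OF q(1), of r] by blast
  have ph: "\<bar>p x - h x\<bar> \<le> d * (R - r)" if x: "x \<in> {r..R}" for x
  proof -
    have "norm ((p x - h x) - (p r - h r)) \<le> d * norm (x - r)"
    proof (rule field_differentiable_bound[of "{r..R}" "\<lambda>x. p x - h x" "\<lambda>x. q x - h' x"])
      show "norm (q y - h' y) \<le> d" if "y \<in> {r..R}" for y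
        using q(2)[OF that] by (simp add: abs_minus_commute less_imp_le)
    qed (use x in \<open>auto intro!: DERIV_diff has_field_derivative_at_within[OF p(2)] has_field_derivative_at_within[OF dh]\<close>)
    moreover have "h r = 0" using supp[of r] r by (simp add: h_def)
    moreover have "d * norm (x - r) \<le> d * (R - r)" using d x by (intro mult_left_mono) auto
    ultimately show ?thesis using p(3) by simp
  qed
  define g where "g x = w x * p x" for x
  have g_bump: "g = bump r R 0 p" by (auto simp: g_def w_def bump_def fun_eq_iff)
  have fw: "f x = w x * h x" for x
    using w_pos[of x] supp[of x] r by (cases "r < x \<and> x < R") (auto simp: h_def)
  have f'w: "f' x = w' x * h x + w x * h' x" for x
  proof (rule DERIV_unique[OF f])
    have "((\<lambda>x. w x * h x) has_real_derivative w' x * h x + h' x * w x) (at x)" by (intro DERIV_mult dw dh)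
    then show "(f has_real_derivative w' x * h x + w x * h' x) (at x)"
      by (simp add: fw[abs_def] mult.commute)
  qed
  have de: "d * ((W + 1) * (R - r) + 1) = e" using pos by (simp add: d_def)
  have split: "d * ((W + 1) * (R - r) + 1) = W * (d * (R - r)) + d * (R - r) + d" by (simp add: algebra_simps)
  have nn: "0 \<le> d * (R - r)" "0 \<le> W * (d * (R - r))" using d r W(2) by auto
  show thesis
  proof (rule that[of g])
    show "(\<lambda>x. complex_of_real (g x)) \<in> test_functions" unfolding g_bump by (rule bump_test_function[OF p(1) r(1)])
    show "g x = 0" if "x \<notin> {r..R}" for x using that by (auto simp: g_bump bump_def)
    show "\<bar>g x - f x\<bar> \<le> e" for x
    proof (cases "r < x \<and> x < R")
      case True
      have "\<bar>g x - f x\<bar> = \<bar>w x\<bar> * \<bar>p x - h x\<bar>" by (simp add: g_def fw abs_mult[symmetric] algebra_simps)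
      also have "\<dots> \<le> 1 * (d * (R - r))" using w_le ph[of x] True by (intro mult_mono) auto
      finally show ?thesis using de split nn d by linarith
    qed (use e w0 in \<open>simp add: g_def fw\<close>)
    fix x D assume "(g has_real_derivative D) (at x)"
    moreover have "(g has_real_derivative w' x * p x + q x * w x) (at x)"
      unfolding g_def by (intro DERIV_mult dw p)
    ultimately have g': "D = w' x * p x + q x * w x" by (rule DERIV_unique)
    show "\<bar>D - f' x\<bar> \<le> e"
    proof (cases "r < x \<and> x < R")
      case True
      have "\<bar>D - f' x\<bar> = \<bar>w' x * (p x - h x) + w x * (q x - h' x)\<bar>"
        unfolding g' f'w by (simp add: algebra_simps)
      also have "\<dots> \<le> \<bar>w' x\<bar> * \<bar>p x - h x\<bar> + \<bar>w x\<bar> * \<bar>q x - h' x\<bar>"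
        using abs_triangle_ineq by (simp add: abs_mult[symmetric])
      also have "\<dots> \<le> W * (d * (R - r)) + 1 * d"
        using W(2) W'[of x] w_le ph[of x] q(2)[of x] True
        by (intro add_mono mult_mono) (auto simp: abs_minus_commute less_imp_le)
      finally show ?thesis using de split nn by linarith
    next
      case False
      then show ?thesis using e w0[OF False] w'0[OF False] by (simp add: g' f'w)
    qed
  qed
qed

section \<open>Necessity of Muckenhoupt's condition\<close>

lemma continuous_antiderivative:
  fixes h :: "real \<Rightarrow> real"
  assumes h: "continuous_on UNIV h"
  shows "((\<lambda>u. LBINT y=ereal a..ereal u. h y) has_real_derivative h x) (at x)"
proof -
  define p q where "p = min x a - 1" and "q = max x a + 1"
  have pq: "p < x" "x < q" "p \<le> a" "a \<le> q" by (auto simp: p_def q_def)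
  have "((\<lambda>u. LBINT y=ereal a..ereal u. h y) has_vector_derivative h x) (at x within {p..q})"
    using pq by (intro interval_integral_FTC2 continuous_on_subset[OF h]) auto
  moreover have "at x within {p..q} = at x" using pq by (intro at_within_interior) auto
  ultimately show ?thesis by (simp add: has_real_derivative_iff_has_vector_derivative)
qed

context C1_drift
begin

text \<open>Integrating the indicator of (\<alpha>, \<beta>) against 1/rho would give only a
  Lipschitz function. Ramps of width \<eta> make F continuously differentiable, and its total rise S
  still dominates the scale length of the plateau.\<close>

lemma trapezoid:
  assumes \<alpha>: "0 < \<alpha>" and \<eta>: "0 < \<eta>" "\<alpha> + \<eta> < \<beta> - \<eta>"
  obtains F t S where "\<And>x. (F has_real_derivative t x / rho b x) (at x)"
    "continuous_on UNIV (\<lambda>x. t x / rho b x)" "\<And>x. 0 \<le> t x" "\<And>x. t x \<le> 1" "\<And>x. x \<notin> {\<alpha><..<\<beta>} \<Longrightarrow> t x = 0"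
    "\<And>x. x \<le> \<alpha> \<Longrightarrow> F x = 0" "\<And>x. x \<ge> \<beta> \<Longrightarrow> F x = S" "scale (\<beta> - \<eta>) - scale (\<alpha> + \<eta>) \<le> S"
proof -
  define t where "t x = max 0 (min 1 (min ((x - \<alpha>) / \<eta>) ((\<beta> - x) / \<eta>)))" for x :: real
  have t: "0 \<le> t x" "t x \<le> 1" for x by (auto simp: t_def)
  have t0: "t x = 0" if "x \<notin> {\<alpha><..<\<beta>}" for x
  proof -
    have "(x - \<alpha>) / \<eta> \<le> 0 \<or> (\<beta> - x) / \<eta> \<le> 0" using that \<eta> by (auto simp: divide_le_0_iff)
    then show ?thesis by (auto simp: t_def)
  qed
  have t1: "t x = 1" if "x \<in> {\<alpha> + \<eta>..\<beta> - \<eta>}" for x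
  proof -
    have "(x - \<alpha>) / \<eta> \<ge> 1" "(\<beta> - x) / \<eta> \<ge> 1" using that \<eta> by (auto simp: le_divide_eq)
    then show ?thesis by (auto simp: t_def)
  qed
  have tc: "continuous_on UNIV t"
    unfolding t_def using \<eta> by (intro continuous_intros) auto
  have hc: "continuous_on UNIV (\<lambda>x. t x / rho b x)"
  proof (rule continuous_zero_extension[OF _ \<alpha>])
    show "continuous_on {0<..} (\<lambda>x. t x / rho b x)"
      using rho_pos by (intro continuous_intros continuous_on_subset[OF tc] rho_continuous)
        (auto simp: less_imp_neq[THEN not_sym])
  qed (use t0 in auto)
  define F where "F u = (LBINT y=ereal \<alpha>..ereal u. t y / rho b y)" for u
  have dF: "(F has_real_derivative t x / rho b x) (at x)" for x
    unfolding F_def[abs_def] by (rule continuous_antiderivative[OF hc])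
  have F\<alpha>: "F \<alpha> = 0" by (simp add: F_def)
  have low: "F x = 0" if "x \<le> \<alpha>" for x
  proof -
    have "\<exists>c. \<forall>x\<in>{..\<alpha>}. F x = c"
    proof (rule has_field_derivative_zero_constant)
      fix x assume "x \<in> {..\<alpha>}"
      then show "(F has_field_derivative 0) (at x within {..\<alpha>})"
        using has_field_derivative_at_within[OF dF[of x]] t0[of x] by simp
    qed simp
    then obtain c where "\<And>x. x \<le> \<alpha> \<Longrightarrow> F x = c" by auto
    then show ?thesis using F\<alpha> that by (metis order_refl)
  qed
  have "\<exists>c. \<forall>x\<in>{\<beta>..}. F x = c"
  proof (rule has_field_derivative_zero_constant)
    fix x assume "x \<in> {\<beta>..}"
    then show "(F has_field_derivative 0) (at x within {\<beta>..})"
      using has_field_derivative_at_within[OF dF[of x]] t0[of x] by simp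
  qed simp
  then obtain S where S: "\<And>x. x \<ge> \<beta> \<Longrightarrow> F x = S" by auto
  have mono: "F x \<le> F y" if "x \<le> y" for x y
    by (rule DERIV_nonneg_imp_nondecreasing[OF that]) (metis dF t(1) rho_pos divide_nonneg_pos)
  have "F (\<alpha> + \<eta>) - scale (\<alpha> + \<eta>) \<le> F (\<beta> - \<eta>) - scale (\<beta> - \<eta>)"
  proof (rule DERIV_nonneg_imp_nondecreasing[where f = "\<lambda>x. F x - scale x"])
    fix x assume x: "\<alpha> + \<eta> \<le> x" "x \<le> \<beta> - \<eta>"
    then have "((\<lambda>x. F x - scale x) has_real_derivative t x / rho b x - 1 / rho b x) (at x)"
      using \<alpha> \<eta> by (intro DERIV_diff dF scale_deriv) auto
    then show "\<exists>y. ((\<lambda>x. F x - scale x) has_real_derivative y) (at x) \<and> 0 \<le> y"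
      using t1[of x] x by auto
  qed (use \<eta> in simp)
  moreover have "F (\<beta> - \<eta>) \<le> S" using mono[of "\<beta> - \<eta>" \<beta>] S[of \<beta>] \<eta> by simp
  moreover have "0 \<le> F (\<alpha> + \<eta>)" using mono[of \<alpha> "\<alpha> + \<eta>"] F\<alpha> \<eta> by simp
  ultimately have "scale (\<beta> - \<eta>) - scale (\<alpha> + \<eta>) \<le> S" by linarith
  then show thesis using that[OF dF hc t t0 low S] by blast
qed

text \<open>As speed R - speed r is the mass of [r, R] under \<open>rho_measure b\<close>, uniform
  smallness on a fixed compact interval becomes smallness in L2.\<close>

lemma L2_norm_small:
  fixes h :: "real \<Rightarrow> complex"
  assumes r: "0 < r" "r \<le> R" and h: "continuous_on {0<..} h" "\<And>x. x \<notin> {r..R} \<Longrightarrow> h x = 0"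
    and le: "\<And>x. cmod (h x) \<le> e" and e: "e \<ge> 0"
  shows "h \<in> L2 (rho_measure b)" "L2_norm (rho_measure b) h \<le> e * sqrt (speed R - speed r)"
proof -
  have c: "continuous_on {0<..} (\<lambda>x. (cmod (h x))\<^sup>2)" by (intro continuous_intros h)
  note I = rho_integral_compact[OF c r(1), of R]
  have "integrable (rho_measure b) (\<lambda>x. (cmod (h x))\<^sup>2)" by (rule I) (use h(2) in simp)
  moreover have "h \<in> borel_measurable (rho_measure b)" by (rule rho_integral_compact[OF h(1) r(1) h(2)])
  ultimately show "h \<in> L2 (rho_measure b)" by (simp add: L2_def)
  have speed: "(rho b has_integral (speed R - speed r)) {r..R}"
    using r speed_deriv by (intro fundamental_theorem_of_calculus)
      (auto simp: has_real_derivative_iff_has_vector_derivative[symmetric] intro: has_field_derivative_at_within)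
  have "(L2_norm (rho_measure b) h)\<^sup>2 = integral {r..R} (\<lambda>x. rho b x *\<^sub>R (cmod (h x))\<^sup>2)"
    unfolding L2_norm_sq by (rule I) (use h(2) in simp)
  also have "\<dots> \<le> e\<^sup>2 * (speed R - speed r)"
  proof (rule has_integral_le[OF integrable_integral has_integral_mult_right[OF speed]])
    show "(\<lambda>x. rho b x *\<^sub>R (cmod (h x))\<^sup>2) integrable_on {r..R}"
      by (intro integrable_continuous_real continuous_intros continuous_on_subset[OF rho_continuous]
          continuous_on_subset[OF h(1)]) (use r in auto)
    fix x show "rho b x *\<^sub>R (cmod (h x))\<^sup>2 \<le> e\<^sup>2 * rho b x"
      using power_mono[OF le[of x], of 2] rho_pos[of x] by (simp add: mult.commute)
  qed
  also have "\<dots> = (e * sqrt (speed R - speed r))\<^sup>2"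
    using speed_mono[OF r] by (simp add: power_mult_distrib)
  finally show "L2_norm (rho_measure b) h \<le> e * sqrt (speed R - speed r)"
    by (rule power2_le_imp_le) (use e speed_mono[OF r] in simp)
qed

text \<open>All approximants live on the same interval [r, R], so their errors and those of their
  derivatives are at most e times the constant K in L2, and e may tend to 0.\<close>

lemma Hardy_C1:
  assumes C: "C \<ge> 0" "\<And>\<phi>. \<phi> \<in> test_functions \<Longrightarrow>
      (L2_norm (rho_measure b) \<phi>)\<^sup>2 \<le> C * (L2_norm (rho_measure b) (dv \<phi>))\<^sup>2"
    and r: "0 < r'" "r' < R'"
    and f: "\<And>x. (f has_real_derivative f' x) (at x)" and f': "continuous_on UNIV f'"
    and supp: "\<And>x. x \<notin> {r'..R'} \<Longrightarrow> f x = 0"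
  shows "(L2_norm (rho_measure b) (\<lambda>x. of_real (f x)))\<^sup>2 \<le> C * (L2_norm (rho_measure b) (\<lambda>x. of_real (f' x)))\<^sup>2"
proof -
  let ?N = "L2_norm (rho_measure b)"
  define r R where "r = r' / 2" and "R = R' + 1"
  have rR: "0 < r" "r < r'" "R' < R" "r \<le> R" using r by (auto simp: r_def R_def)
  have f_cont: "continuous_on UNIV f" using f by (meson DERIV_isCont continuous_at_imp_continuous_on)
  have supp': "f' x = 0" if "x \<notin> {r'..R'}" for x
    using f supp that by (rule derivative_zero_outside_support)
  have bdd: "\<exists>B\<ge>0. \<forall>x. \<bar>g x\<bar> \<le> B" if "continuous_on UNIV g" "\<And>x. x \<notin> {r'..R'} \<Longrightarrow> g x = 0" for g :: "real \<Rightarrow> real"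
  proof -
    have "bounded (g ` {r'..R'})"
      by (intro compact_imp_bounded compact_continuous_image compact_Icc continuous_on_subset[OF that(1)]) auto
    then obtain B where B: "\<forall>y\<in>g ` {r'..R'}. norm y \<le> B" "B > 0" unfolding bounded_pos by blast
    have "\<bar>g x\<bar> \<le> B" for x using B that(2)[of x] by (cases "x \<in> {r'..R'}") auto
    then show ?thesis using B(2) less_imp_le by blast
  qed
  have inL2: "(\<lambda>x. complex_of_real (g x)) \<in> L2 (rho_measure b)"
    if g: "continuous_on UNIV g" "\<And>x. x \<notin> {r'..R'} \<Longrightarrow> g x = 0" for g :: "real \<Rightarrow> real"
  proof -
    obtain B where "B \<ge> 0" "\<forall>x. \<bar>g x\<bar> \<le> B" using bdd[OF g] by blast
    then show ?thesis
      by (intro L2_norm_small(1)[of r' R' _ B] continuous_intros continuous_on_subset[OF g(1)]) (use r g in auto)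
  qed
  note L = inL2[OF f_cont supp] inL2[OF f' supp']
  define K where "K = sqrt (speed R - speed r)"
  have K: "K \<ge> 0" using speed_mono[OF rR(1,4)] by (simp add: K_def)
  have step: "?N (\<lambda>x. of_real (f x)) \<le> sqrt C * ?N (\<lambda>x. of_real (f' x)) + e * (K + sqrt C * K)" if e: "e > 0" for e
  proof -
    obtain g where g: "(\<lambda>x. complex_of_real (g x)) \<in> test_functions" and g0: "\<And>x. x \<notin> {r..R} \<Longrightarrow> g x = 0"
      and gf: "\<And>x. \<bar>g x - f x\<bar> \<le> e" and gf': "\<And>x D. (g has_real_derivative D) (at x) \<Longrightarrow> \<bar>D - f' x\<bar> \<le> e"
      using C1_approximation[OF rR(1,2) r(2) rR(3) f f' supp e] by blast
    let ?g = "\<lambda>x. complex_of_real (g x)"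
    note gL = test_L2[OF g] test_L2[OF test_deriv[OF g]]
    have dg: "\<exists>D. (g has_real_derivative D) (at x) \<and> dv ?g x = of_real D" for x
    proof -
      have 1: "(g has_real_derivative Re (dv ?g x)) (at x)"
        using bounded_linear.has_vector_derivative[OF bounded_linear_Re test_has_vector_derivative[OF g, of x]]
        by (simp add: has_real_derivative_iff_has_vector_derivative)
      have "Im (dv ?g x) = 0"
        using bounded_linear.has_vector_derivative[OF bounded_linear_Im test_has_vector_derivative[OF g, of x]]
        vector_derivative_unique_at[OF _ has_vector_derivative_const[of 0]] by simp
      then show ?thesis using 1 by (auto simp: complex_eq_iff)
    qed
    have g'0: "dv ?g x = 0" if "x \<notin> {r..R}" for x
      using test_deriv_support[OF g _ that] g0 by simp
    have a1: "?N (\<lambda>x. of_real (f x) - ?g x) \<le> e * K"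
      unfolding K_def
    proof (rule L2_norm_small(2)[OF rR(1,4)])
      show "continuous_on {0<..} (\<lambda>x. of_real (f x) - ?g x)"
        by (intro continuous_intros continuous_on_subset[OF f_cont] test_continuous[OF g]) auto
      show "of_real (f x) - ?g x = 0" if "x \<notin> {r..R}" for x
        using that g0[OF that] supp[of x] rR by auto
      show "cmod (of_real (f x) - ?g x) \<le> e" for x
        using gf[of x] by (simp add: abs_minus_commute flip: of_real_diff)
    qed (use e in simp)
    have a2: "?N (\<lambda>x. dv ?g x - of_real (f' x)) \<le> e * K"
      unfolding K_def
    proof (rule L2_norm_small(2)[OF rR(1,4)])
      show "continuous_on {0<..} (\<lambda>x. dv ?g x - of_real (f' x))"
        by (intro continuous_intros continuous_on_subset[OF f'] test_continuous[OF test_deriv[OF g]]) auto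
      show "dv ?g x - of_real (f' x) = 0" if "x \<notin> {r..R}" for x
        using that g'0[OF that] supp'[of x] rR by auto
      show "cmod (dv ?g x - of_real (f' x)) \<le> e" for x
        using dg[of x] gf'[of _ x] by (metis norm_of_real of_real_diff)
    qed (use e in simp)
    have "?N ?g \<le> sqrt C * ?N (dv ?g)"
      using real_sqrt_le_mono[OF C(2)[OF g]] by (simp add: real_sqrt_mult L2_norm_nonneg)
    also have "\<dots> \<le> sqrt C * (e * K + ?N (\<lambda>x. of_real (f' x)))"
      using L2.nrm_triangle_sub[OF gL(2) L(2)] a2 C(1)
      unfolding L2_norm_eq_nrm by (intro mult_left_mono) auto
    finally have "?N ?g \<le> sqrt C * (e * K + ?N (\<lambda>x. of_real (f' x)))" .
    moreover have "?N (\<lambda>x. of_real (f x)) \<le> e * K + ?N ?g"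
      using L2.nrm_triangle_sub[OF L(1) gL(1)] a1 unfolding L2_norm_eq_nrm by linarith
    ultimately show ?thesis by (simp add: algebra_simps)
  qed
  have "?N (\<lambda>x. of_real (f x)) \<le> sqrt C * ?N (\<lambda>x. of_real (f' x))"
  proof (rule field_le_epsilon)
    fix d :: real assume d: "d > 0"
    define L where "L = K + sqrt C * K + 1"
    have L: "L > 0" using K C(1) by (simp add: L_def add_nonneg_pos)
    have "d / L * (K + sqrt C * K) \<le> d / L * L" using d L by (intro mult_left_mono) (auto simp: L_def)
    then show "?N (\<lambda>x. of_real (f x)) \<le> sqrt C * ?N (\<lambda>x. of_real (f' x)) + d"
      using step[of "d / L"] d L by simp
  qed
  then have "(?N (\<lambda>x. of_real (f x)))\<^sup>2 \<le> (sqrt C * ?N (\<lambda>x. of_real (f' x)))\<^sup>2"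
    by (intro power_mono) (auto simp: L2_norm_nonneg)
  then show ?thesis using C(1) by (simp add: power_mult_distrib)
qed

text \<open>The trial function climbs to S on (a, x), keeps this value on (x, N) and returns to 0
  beyond N with slope factor k = S / S2. Hardy's inequality then reads S^2 V \<le> C (S + k^2 S2) =
  C S (1 + k), and k is small once S2 is large.\<close>

lemma Muckenhoupt_necessary:
  assumes C: "C \<ge> 0" "\<And>\<phi>. \<phi> \<in> test_functions \<Longrightarrow>
      (L2_norm (rho_measure b) \<phi>)\<^sup>2 \<le> C * (L2_norm (rho_measure b) (dv \<phi>))\<^sup>2"
    and unb: "\<And>K. \<exists>y>0. scale y > K"
    and ax: "0 < a" "a < x" "x < N"
  shows "(scale x - scale a) * (speed N - speed x) \<le> C"
proof -
  define V where "V = speed N - speed x"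
  have V: "V > 0" using speed_less[of x N] ax by (simp add: V_def)
  have main: "(scale (x - \<eta>) - scale (a + \<eta>)) * V \<le> C" if \<eta>: "0 < \<eta>" "a + \<eta> < x - \<eta>" for \<eta>
  proof -
    obtain F t S where F: "\<And>x. (F has_real_derivative t x / rho b x) (at x)"
      "continuous_on UNIV (\<lambda>x. t x / rho b x)" and t: "\<And>x. 0 \<le> t x" "\<And>x. t x \<le> 1" "\<And>y. y \<notin> {a<..<x} \<Longrightarrow> t y = 0"
      and F0: "\<And>y. y \<le> a \<Longrightarrow> F y = 0" and FS: "\<And>y. y \<ge> x \<Longrightarrow> F y = S" and S: "scale (x - \<eta>) - scale (a + \<eta>) \<le> S"
      using trapezoid[OF ax(1) \<eta>] by blast
    have S_pos: "S > 0" using S scale_less[of "a + \<eta>" "x - \<eta>"] \<eta> ax by simp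
    have "S * V \<le> C + e" if e: "e > 0" for e
    proof -
      \<comment> \<open>If S2 exceeds C S / e, the cost C k = C S / S2 of the descent is at most e;
        the 1 makes K positive.\<close>
      define K where "K = C * S / e + 1"
      have K: "K > 0" using C(1) S_pos e by (simp add: K_def add_nonneg_pos)
      obtain y where y: "y > 0" "scale y > scale (N + 1) + K" using unb by blast
      have yN: "y > N + 1"
      proof (rule ccontr)
        assume "\<not> y > N + 1"
        then have "scale y \<le> scale (N + 1)" using y by (intro scale_mono) auto
        then show False using y K by simp
      qed
      \<comment> \<open>The trapezoid on (N, y + 1) with ramps of width 1 has plateau (N + 1, y), so
        its rise is at least scale y - scale (N + 1) > K.\<close>
      obtain F2 t2 S2 where F2: "\<And>x. (F2 has_real_derivative t2 x / rho b x) (at x)"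
        "continuous_on UNIV (\<lambda>x. t2 x / rho b x)" and t2: "\<And>x. 0 \<le> t2 x" "\<And>x. t2 x \<le> 1" "\<And>z. z \<notin> {N<..<y+1} \<Longrightarrow> t2 z = 0"
        and F20: "\<And>z. z \<le> N \<Longrightarrow> F2 z = 0" and F2S: "\<And>z. z \<ge> y + 1 \<Longrightarrow> F2 z = S2"
        and S2: "scale (y + 1 - 1) - scale (N + 1) \<le> S2"
      proof -
        have "0 < N" "(0::real) < 1" "N + 1 < y + 1 - 1" using ax yN by simp_all
        from trapezoid[OF this] that show thesis by blast
      qed
      have S2K: "S2 > K" using S2 y by simp
      have S2_pos: "S2 > 0" using S2K K by simp
      define k where "k = S / S2"
      define f f' where "f z = F z - k * F2 z" and "f' z = t z / rho b z - k * (t2 z / rho b z)" for z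
      have df: "(f has_real_derivative f' z) (at z)" for z
        unfolding f_def f'_def by (intro DERIV_diff DERIV_cmult F F2)
      have f'c: "continuous_on UNIV f'" unfolding f'_def by (intro continuous_intros F F2)
      have f0: "f z = 0" if "z \<notin> {a..y + 1}" for z
      proof (cases "z < a")
        case True
        then show ?thesis using F0[of z] F20[of z] ax by (simp add: f_def)
      next
        case False
        then have "z \<ge> y + 1" using that by auto
        then show ?thesis using FS[of z] F2S[of z] ax yN S2_pos by (simp add: f_def k_def)
      qed
      have f'0: "f' z = 0" if "z \<notin> {a..y + 1}" for z
        using t(3)[of z] t2(3)[of z] that ax yN by (auto simp: f'_def)
      have fc: "continuous_on UNIV f" using df by (meson DERIV_isCont continuous_at_imp_continuous_on)
      have ay: "a \<le> y + 1" "a < y + 1" using ax yN by auto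
      have norm_eq: "(L2_norm (rho_measure b) (\<lambda>x. complex_of_real (g x)))\<^sup>2 = integral {a..y+1} (\<lambda>x. rho b x *\<^sub>R (g x)\<^sup>2)"
        if "continuous_on UNIV g" "\<And>z. z \<notin> {a..y+1} \<Longrightarrow> g z = 0" for g :: "real \<Rightarrow> real"
      proof -
        have "(L2_norm (rho_measure b) (\<lambda>x. complex_of_real (g x)))\<^sup>2 = (LINT x|rho_measure b. (g x)\<^sup>2)"
          by (simp add: L2_norm_sq)
        also have "\<dots> = integral {a..y+1} (\<lambda>x. rho b x *\<^sub>R (g x)\<^sup>2)"
          by (rule rho_integral_compact(2)[OF _ ax(1)])
            (use that in \<open>auto intro!: continuous_intros continuous_on_subset[OF that(1)]\<close>)
        finally show ?thesis .
      qed
      have intble: "(\<lambda>x. rho b x *\<^sub>R (g x)\<^sup>2) integrable_on {p..q}"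
        if "continuous_on UNIV g" "p > 0" for g :: "real \<Rightarrow> real" and p q
        by (intro integrable_continuous_real continuous_intros continuous_on_subset[OF rho_continuous]
          continuous_on_subset[OF that(1)]) (use that in auto)
      have "integral {a..y+1} (\<lambda>x. rho b x *\<^sub>R (f x)\<^sup>2) \<le> C * integral {a..y+1} (\<lambda>x. rho b x *\<^sub>R (f' x)\<^sup>2)"
      proof -
        have "(L2_norm (rho_measure b) (\<lambda>x. of_real (f x)))\<^sup>2 \<le> C * (L2_norm (rho_measure b) (\<lambda>x. of_real (f' x)))\<^sup>2"
          by (rule Hardy_C1[OF C ax(1) ay(2) df f'c f0])
        moreover have "(L2_norm (rho_measure b) (\<lambda>x. complex_of_real (f x)))\<^sup>2 = integral {a..y+1} (\<lambda>x. rho b x *\<^sub>R (f x)\<^sup>2)"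
          using fc f0 by (rule norm_eq)
        moreover have "(L2_norm (rho_measure b) (\<lambda>x. complex_of_real (f' x)))\<^sup>2 = integral {a..y+1} (\<lambda>x. rho b x *\<^sub>R (f' x)\<^sup>2)"
          using f'c f'0 by (rule norm_eq)
        ultimately show ?thesis by (simp only:)
      qed
      also have "\<dots> \<le> C * (S + k\<^sup>2 * S2)"
      proof (rule mult_left_mono[OF _ C(1)])
        define H where "H z = F z + k\<^sup>2 * F2 z" for z
        have "((\<lambda>z. t z / rho b z + k\<^sup>2 * (t2 z / rho b z)) has_integral (H (y + 1) - H a)) {a..y+1}"
        proof (rule fundamental_theorem_of_calculus[OF ay(1)])
          fix z
          have "(H has_real_derivative t z / rho b z + k\<^sup>2 * (t2 z / rho b z)) (at z)"
            unfolding H_def by (intro DERIV_add DERIV_cmult F F2)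
          then show "(H has_vector_derivative t z / rho b z + k\<^sup>2 * (t2 z / rho b z)) (at z within {a..y+1})"
            unfolding has_real_derivative_iff_has_vector_derivative by (rule has_vector_derivative_at_within)
        qed
        moreover have "H (y + 1) = S + k\<^sup>2 * S2" "H a = 0"
          using FS[of "y + 1"] F2S[of "y + 1"] F0[of a] F20[of a] ax yN by (auto simp: H_def)
        ultimately have hi: "((\<lambda>z. t z / rho b z + k\<^sup>2 * (t2 z / rho b z)) has_integral (S + k\<^sup>2 * S2)) {a..y+1}" by simp
        show "integral {a..y+1} (\<lambda>x. rho b x *\<^sub>R (f' x)\<^sup>2) \<le> S + k\<^sup>2 * S2"
        proof (rule has_integral_le[OF integrable_integral[OF intble[OF f'c ax(1)]] hi])
          fix z
          have p: "rho b z > 0" by (rule rho_pos)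
          \<comment> \<open>Ascent and descent have disjoint supports, hence no cross term in
            f'^2.\<close>
          have tt: "t z * t2 z = 0" using t(3)[of z] t2(3)[of z] ax by (cases "z < x") auto
          have sq: "(t z)\<^sup>2 \<le> t z" "(t2 z)\<^sup>2 \<le> t2 z"
            using t(1,2)[of z] t2(1,2)[of z] by (simp_all add: power2_eq_square mult_left_le)
          have "f' z = (t z - k * t2 z) / rho b z" by (simp add: f'_def diff_divide_distrib)
          then have "rho b z *\<^sub>R (f' z)\<^sup>2 = (t z - k * t2 z)\<^sup>2 / rho b z"
            using p by (simp add: power_divide power2_eq_square)
          also have "\<dots> = ((t z)\<^sup>2 - 2 * k * (t z * t2 z) + k\<^sup>2 * (t2 z)\<^sup>2) / rho b z"
            by (simp add: power2_diff power_mult_distrib)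
          also have "\<dots> = ((t z)\<^sup>2 + k\<^sup>2 * (t2 z)\<^sup>2) / rho b z" by (simp add: tt)
          also have "\<dots> \<le> (t z + k\<^sup>2 * t2 z) / rho b z"
            using sq p by (intro divide_right_mono add_mono mult_left_mono) auto
          finally show "rho b z *\<^sub>R (f' z)\<^sup>2 \<le> t z / rho b z + k\<^sup>2 * (t2 z / rho b z)" by (simp add: add_divide_distrib)
        qed
      qed
      finally have upper: "integral {a..y+1} (\<lambda>x. rho b x *\<^sub>R (f x)\<^sup>2) \<le> C * (S + k\<^sup>2 * S2)" .
      have x0: "x > 0" using ax by simp
      have "S\<^sup>2 * V = integral {x..N} (\<lambda>z. rho b z *\<^sub>R (f z)\<^sup>2)"
      proof -
        have "((\<lambda>z. S\<^sup>2 * rho b z) has_integral S\<^sup>2 * (speed N - speed x)) {x..N}"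
          using ax speed_deriv by (intro has_integral_mult_right fundamental_theorem_of_calculus)
            (auto simp: has_real_derivative_iff_has_vector_derivative[symmetric] intro: has_field_derivative_at_within)
        moreover have "S\<^sup>2 * rho b z = rho b z *\<^sub>R (f z)\<^sup>2" if "z \<in> {x..N}" for z
          using FS[of z] F20[of z] that by (simp add: f_def)
        ultimately have "((\<lambda>z. rho b z *\<^sub>R (f z)\<^sup>2) has_integral S\<^sup>2 * V) {x..N}"
          unfolding V_def by (rule has_integral_eq[rotated])
        then show ?thesis by (simp add: integral_unique)
      qed
      also have "\<dots> \<le> integral {a..y+1} (\<lambda>z. rho b z *\<^sub>R (f z)\<^sup>2)"
        using ax yN rho_pos by (intro integral_subset_le intble fc) (auto simp: less_imp_le)
      finally have "S\<^sup>2 * V \<le> C * (S + k\<^sup>2 * S2)" using upper by simp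
      also have "k\<^sup>2 * S2 = S * k" using S2_pos by (simp add: k_def power2_eq_square)
      finally have "S * (S * V) \<le> S * (C * (1 + k))" by (simp add: power2_eq_square algebra_simps)
      then have "S * V \<le> C * (1 + k)" by (rule mult_left_le_imp_le[OF _ S_pos])
      then have "S * V \<le> C + C * k" by (simp add: algebra_simps)
      also have "C * k \<le> e"
      proof -
        have "C * S \<le> K * e" using e by (simp add: K_def field_simps)
        also have "\<dots> \<le> S2 * e" using S2K e by simp
        finally show ?thesis using S2_pos by (simp add: k_def field_simps)
      qed
      finally show ?thesis by simp
    qed
    then have "S * V \<le> C" by (rule field_le_epsilon)
    moreover have "(scale (x - \<eta>) - scale (a + \<eta>)) * V \<le> S * V" using S V by (intro mult_right_mono) auto
    ultimately show ?thesis by linarith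
  qed
  have cont: "isCont scale x" "isCont scale a" by (intro DERIV_isCont[OF scale_deriv]; use ax in simp)+
  \<comment> \<open>The constant in \<open>main\<close> does not depend on \<eta>, so the ramps can
    be shrunk to nothing.\<close>
  have "((\<lambda>\<eta>. (scale (x - \<eta>) - scale (a + \<eta>)) * V) \<longlongrightarrow> (scale x - scale a) * V) (at_right 0)"
  proof (intro tendsto_mult tendsto_diff tendsto_const)
    show "((\<lambda>\<eta>. scale (x - \<eta>)) \<longlongrightarrow> scale x) (at_right 0)"
      by (rule isCont_tendsto_compose[OF cont(1)]) (auto intro!: tendsto_eq_intros)
    show "((\<lambda>\<eta>. scale (a + \<eta>)) \<longlongrightarrow> scale a) (at_right 0)"
      by (rule isCont_tendsto_compose[OF cont(2)]) (auto intro!: tendsto_eq_intros)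
  qed
  then have "(scale x - scale a) * V \<le> C"
  proof (rule tendsto_upperbound)
    have "eventually (\<lambda>\<eta>::real. 0 < \<eta> \<and> \<eta> < (x - a) / 2) (at_right 0)"
      using ax by (auto simp: eventually_at_right_field intro!: exI[of _ "(x - a) / 2"])
    then show "\<forall>\<^sub>F \<eta> in at_right 0. (scale (x - \<eta>) - scale (a + \<eta>)) * V \<le> C"
    proof eventually_elim
      case (elim \<eta>)
      then have "0 < \<eta>" "a + \<eta> < x - \<eta>" by (auto simp: field_simps)
      then show ?case by (rule main)
    qed
  qed simp
  then show ?thesis by (simp add: V_def)
qed

text \<open>A bound uniform in N passes to the tail integral by monotone convergence along N = x +
  n; at n = 0 the product is simply 0.\<close>

lemma A_const_finite:
  assumes "\<And>x N. a < x \<Longrightarrow> x < N \<Longrightarrow> (scale x - scale a) * (speed N - speed x) \<le> C" and a: "a > 0" and C: "C \<ge> 0"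
  shows "A_const b a < \<infinity>"
proof -
  have "A_const b a \<le> ennreal C"
    unfolding A_const_def
  proof (rule SUP_least)
    fix x assume "x \<in> {a<..}"
    then have x: "a < x" by simp
    then have x0: "x > 0" using a by simp
    have le: "ennreal (scale x - scale a) * ennreal (speed (x + real n) - speed x) \<le> ennreal C" for n
    proof (cases n)
      case 0 then show ?thesis by simp
    next
      case (Suc m)
      then show ?thesis using assms(1)[OF x, of "x + real n"] x0 speed_mono[of x "x + real n"] scale_mono[OF a, of x] x C
        by (simp add: ennreal_leI flip: ennreal_mult)
    qed
    have "(\<integral>\<^sup>+y\<in>{a<..<x}. ennreal (1 / rho b y) \<partial>lborel) * (\<integral>\<^sup>+y\<in>{x<..}. ennreal (rho b y) \<partial>lborel)
      = ennreal (scale x - scale a) * (SUP n. ennreal (speed (x + real n) - speed x))"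
      using nn_integral_scale[OF a, of x] x nn_integral_speed_Ioi[OF x0] by simp
    also have "\<dots> = (SUP n. ennreal (scale x - scale a) * ennreal (speed (x + real n) - speed x))"
      by (rule SUP_mult_left_ennreal)
    also have "\<dots> \<le> ennreal C" by (intro SUP_least le)
    finally show "(\<integral>\<^sup>+y\<in>{a<..<x}. ennreal (1 / rho b y) \<partial>lborel) * (\<integral>\<^sup>+y\<in>{x<..}. ennreal (rho b y) \<partial>lborel) \<le> ennreal C" .
  qed
  then show ?thesis by (rule le_less_trans) simp
qed

lemma speed_finite:
  assumes "a > 0" "A_const b a < \<infinity>"
  shows "(\<integral>\<^sup>+y\<in>{1<..}. ennreal (rho b y) \<partial>lborel) < \<infinity>"
proof -
  obtain T where T: "\<And>y. y > 0 \<Longrightarrow> speed y < T" using speed_bounded[OF assms] by blast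
  have "(SUP n. ennreal (speed (1 + real n) - speed 1)) \<le> ennreal (T - speed 1)"
    using T by (intro SUP_least ennreal_leI) (simp add: less_imp_le)
  then show ?thesis unfolding nn_integral_speed_Ioi[OF zero_less_one] by (rule le_less_trans) simp
qed

end

section \<open>Absorption and the scale function\<close>

text \<open>The Euler scheme for \<open>dX = dB - a(X) dt\<close> with step \<open>d\<close> and increments \<open>\<xi>\<close>, stopped outside \<open>(l, R)\<close>.\<close>

primrec euler :: "(real \<Rightarrow> real) \<Rightarrow> real \<Rightarrow> real \<Rightarrow> real \<Rightarrow> real \<Rightarrow> (nat \<Rightarrow> real) \<Rightarrow> nat \<Rightarrow> real" where
  "euler a d l R x \<xi> 0 = x"
| "euler a d l R x \<xi> (Suc k) = (if l < euler a d l R x \<xi> k \<and> euler a d l R x \<xi> k < R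
     then euler a d l R x \<xi> k + \<xi> k - a (euler a d l R x \<xi> k) * d else euler a d l R x \<xi> k)"

lemma euler_stopped:
  assumes "euler a d l R x \<xi> k \<le> l" "k \<le> m"
  shows "euler a d l R x \<xi> m \<le> l"
  using assms(2)
proof (induction m rule: dec_induct)
  case base then show ?case by (rule assms(1))
next
  case (step m) then show ?case by simp
qed

text \<open>While the scheme has not reached \<open>l\<close>, its distance from the solution after \<open>k\<close> steps is at most
  \<open>\<eta> ((1 + L d)\<^sup>k - 1)\<close>, \<open>\<eta>\<close> being the oscillation of the solution over one step.\<close>

lemma euler_reaches:
  assumes lip: "\<And>u v. \<bar>a u - a v\<bar> \<le> L * \<bar>u - v\<bar>" and L: "L \<ge> 0"
    and V: "\<And>t. t \<in> {0..\<theta>} \<Longrightarrow> ((\<lambda>s. X s - \<beta> s) has_real_derivative - a (X t)) (at t within {0..\<theta>})"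
    and X0: "X 0 = x" and d: "d > 0" and \<theta>: "\<theta> \<ge> 0" "\<theta> \<le> real n * d"
    and osc: "\<And>s t. s \<in> {0..\<theta>} \<Longrightarrow> t \<in> {0..\<theta>} \<Longrightarrow> \<bar>s - t\<bar> \<le> d \<Longrightarrow> \<bar>X s - X t\<bar> \<le> \<eta>"
    and upper: "\<And>t. t \<in> {0..\<theta>} \<Longrightarrow> X t + \<eta> * exp (L * \<theta>) < R"
    and lower: "X \<theta> + \<eta> + \<eta> * exp (L * \<theta>) \<le> l"
  shows "euler a d l R x (\<lambda>i. \<beta> (real (Suc i) * d) - \<beta> (real i * d)) n \<le> l"
proof -
  define Y where "Y k = euler a d l R x (\<lambda>i. \<beta> (real (Suc i) * d) - \<beta> (real i * d)) k" for k
  have \<eta>: "\<eta> \<ge> 0" using osc[of 0 0] \<theta> d by simp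
  \<comment> \<open>The solution of E (k+1) = E k + L (\<eta> + E k) d with E 0 = 0.\<close>
  define E where "E k = \<eta> * ((1 + L * d) ^ k - 1)" for k
  have E_nonneg: "0 \<le> E k" for k using \<eta> L d by (simp add: E_def one_le_power)
  have E_le: "E k \<le> \<eta> * exp (L * \<theta>)" if "real k * d \<le> \<theta>" for k
  proof -
    have "(1 + L * d) ^ k \<le> exp (L * d) ^ k" using L d by (intro power_mono) auto
    also have "\<dots> = exp (real k * (L * d))" by (rule exp_of_nat_mult[symmetric])
    also have "\<dots> = exp (L * (real k * d))" by (simp add: algebra_simps)
    also have "\<dots> \<le> exp (L * \<theta>)" using that L by (simp add: mult_left_mono)
    finally show ?thesis using \<eta> unfolding E_def by (intro mult_left_mono) auto
  qed
  \<comment> \<open>The first alternative is absorbing, so the error has to be followed only while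
    the scheme is above l. The assumption \<open>upper\<close> keeps it from being stopped at R
    before that.\<close>
  have inv: "Y k \<le> l \<or> \<bar>X (real k * d) - Y k\<bar> \<le> E k" if "real k * d \<le> \<theta>" for k
    using that
  proof (induction k)
    case 0
    show ?case by (simp add: Y_def X0 E_def)
  next
    case (Suc k)
    define s t where "s = real k * d" and "t = real (Suc k) * d"
    have st: "s \<in> {0..\<theta>}" "t \<in> {0..\<theta>}" "s < t" "t - s = d"
      using Suc.prems d by (auto simp: s_def t_def algebra_simps)
    show ?case
    proof (cases "Y k \<le> l")
      case True
      then have "Y (Suc k) \<le> l" by (simp add: Y_def)
      then show ?thesis ..
    next
      case False
      then have err: "\<bar>X s - Y k\<bar> \<le> E k" using Suc st by (auto simp: s_def)
      have "Y k < R" using err E_le[of k] upper[OF st(1)] st by (auto simp: s_def)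
      then have Y_Suc: "Y (Suc k) = Y k + (\<beta> t - \<beta> s) - a (Y k) * d"
        using False by (simp add: Y_def s_def t_def)
      \<comment> \<open>Path and scheme receive the same noise, which cancels in their difference.
        What remains over one step is differentiable, with derivative a (Y k) - a (X r), and the
        Lipschitz bound applies.\<close>
      define W where "W r = X r - \<beta> r + a (Y k) * r" for r
      have "norm (W t - W s) \<le> L * (\<eta> + E k) * norm (t - s)"
      proof (rule field_differentiable_bound[of "{s..t}"])
        fix r assume r: "r \<in> {s..t}"
        then have r\<theta>: "r \<in> {0..\<theta>}" using st by auto
        have "(W has_real_derivative - a (X r) + a (Y k)) (at r within {0..\<theta>})"
          unfolding W_def by (intro DERIV_add V[OF r\<theta>]) (auto intro!: derivative_eq_intros)
        then show "(W has_real_derivative - a (X r) + a (Y k)) (at r within {s..t})"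
          by (rule DERIV_subset) (use st in auto)
        have "\<bar>X r - X s\<bar> \<le> \<eta>" using osc[OF r\<theta> st(1)] r st by auto
        then have "\<bar>Y k - X r\<bar> \<le> \<eta> + E k" using err by linarith
        then show "norm (- a (X r) + a (Y k)) \<le> L * (\<eta> + E k)"
          using lip[of "Y k" "X r"] L by (simp add: order_trans[OF _ mult_left_mono] add.commute)
      qed (use st in auto)
      then have "\<bar>W t - W s\<bar> \<le> L * (\<eta> + E k) * d" using st by simp
      moreover have "X t - Y (Suc k) = (X s - Y k) + (W t - W s)"
        using st(4) by (simp add: W_def Y_Suc algebra_simps flip: st(4))
      ultimately have "\<bar>X t - Y (Suc k)\<bar> \<le> E k + L * (\<eta> + E k) * d" using err by linarith
      also have "\<dots> = E (Suc k)" by (simp add: E_def algebra_simps)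
      finally show ?thesis by (simp add: t_def)
    qed
  qed
  \<comment> \<open>The last grid point not after \<theta>. It lies within d of \<theta>, so one
    more oscillation \<eta> is lost; having stopped below l, the scheme stays there until step
    n.\<close>
  define K where "K = nat \<lfloor>\<theta> / d\<rfloor>"
  have "real K \<le> \<theta> / d" "\<theta> / d < real K + 1"
    using \<theta>(1) d by (simp_all add: K_def)
  then have K: "real K * d \<le> \<theta>" "\<theta> < real K * d + d"
    using d by (simp_all add: field_simps)
  have "real K * d \<le> real n * d" using K \<theta> by linarith
  then have "real K \<le> real n" using d by (rule mult_right_le_imp_le)
  then have "K \<le> n" by simp
  have "Y K \<le> l"
  proof (rule ccontr)
    assume "\<not> Y K \<le> l"
    then have "\<bar>X (real K * d) - Y K\<bar> \<le> \<eta> * exp (L * \<theta>)"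
      using inv[OF K(1)] E_le[OF K(1)] by simp
    moreover have "\<bar>X (real K * d) - X \<theta>\<bar> \<le> \<eta>"
      using K d \<theta> by (intro osc) auto
    ultimately show False using lower \<open>\<not> Y K \<le> l\<close> by linarith
  qed
  then show ?thesis using euler_stopped[OF _ \<open>K \<le> n\<close>] by (simp add: Y_def)
qed

lemma euler_cong: "(\<And>i. i < k \<Longrightarrow> \<xi> i = \<zeta> i) \<Longrightarrow> euler a d l R x \<xi> k = euler a d l R x \<zeta> k"
  by (induction k) auto

lemma euler_measurable:
  assumes [measurable]: "a \<in> borel_measurable borel" and "k \<le> m"
  shows "(\<lambda>\<xi>. euler a d l R x \<xi> k) \<in> borel_measurable (PiM {..<m} (\<lambda>_. borel))"
  using assms(2)
proof (induction k)
  case (Suc k)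
  then have [measurable]: "(\<lambda>\<xi>. euler a d l R x \<xi> k) \<in> borel_measurable (PiM {..<m} (\<lambda>_. borel))"
    "(\<lambda>\<xi>. \<xi> k) \<in> borel_measurable (PiM {..<m} (\<lambda>_. borel))"
    by auto
  show ?case by simp
qed simp

section \<open>Normal increments\<close>

lemma normal_second_moment:
  "\<sigma> > 0 \<Longrightarrow> has_bochner_integral lborel (\<lambda>z. normal_density 0 \<sigma> z * z\<^sup>2) (\<sigma>\<^sup>2)"
  using normal_moment_even[of \<sigma> 0 1] by (simp add: fact_numeral)

lemma normal_third_abs_moment:
  assumes "\<sigma> > 0"
  shows "integrable lborel (\<lambda>z. normal_density 0 \<sigma> z * \<bar>z\<bar> ^ 3)"
    and "(\<integral>z. normal_density 0 \<sigma> z * \<bar>z\<bar> ^ 3 \<partial>lborel) \<le> 2 * \<sigma> ^ 3"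
proof -
  have 3: "2 * 1 + 1 = (3::nat)" by simp
  show "integrable lborel (\<lambda>z. normal_density 0 \<sigma> z * \<bar>z\<bar> ^ 3)"
    using integrable_normal_moment_abs[OF assms, of 0 3] by simp
  have "(\<integral>z. normal_density 0 \<sigma> z * \<bar>z\<bar> ^ 3 \<partial>lborel) = 2 * \<sigma> ^ 3 * sqrt (2 / pi)"
    using integral_normal_moment_abs_odd[OF assms, of 0 1] unfolding 3 by simp
  also have "\<dots> \<le> 2 * \<sigma> ^ 3 * 1"
    using assms pi_ge_two by (intro mult_left_mono) auto
  finally show "(\<integral>z. normal_density 0 \<sigma> z * \<bar>z\<bar> ^ 3 \<partial>lborel) \<le> 2 * \<sigma> ^ 3" by simp
qed

text \<open>The first and second moments \<open>-q \<delta>\<close> and \<open>\<delta> + q\<^sup>2 \<delta>\<^sup>2\<close> of the increment \<open>z - q \<delta>\<close> make the main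
  terms cancel up to \<open>p q\<^sup>3 \<delta>\<^sup>2\<close>.\<close>

lemma normal_step_lower_bound:
  assumes \<sigma>: "0 < \<sigma>" "\<sigma> \<le> 1" and gm: "g \<in> borel_measurable borel" and gb: "\<And>z. \<bar>g z\<bar> \<le> G"
    and C: "C \<ge> 0" and g: "\<And>h. c + p * h + p * q * h\<^sup>2 - C * \<bar>h\<bar> ^ 3 \<le> g (y + h)"
    and B: "\<bar>p\<bar> \<le> P" "\<bar>q\<bar> \<le> P"
  shows "c - (P ^ 4 + 8 * C + 4 * C * P ^ 3) * \<sigma> ^ 3 \<le> (\<integral>z. normal_density 0 \<sigma> z * g (y + (z - q * \<sigma>\<^sup>2)) \<partial>lborel)"
proof -
  let ?n = "normal_density 0 \<sigma>"
  \<comment> \<open>The lower bound for g expanded in powers of z, with the cube of |z - q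
    \<sigma>^2| split into cubes of the two parts, so that only moments of z occur.\<close>
  let ?low = "\<lambda>z. (c - p * q * \<sigma>\<^sup>2 + p * q * (q * \<sigma>\<^sup>2)\<^sup>2 - 4 * C * \<bar>q * \<sigma>\<^sup>2\<bar> ^ 3) * ?n z + (p - 2 * p * q * (q * \<sigma>\<^sup>2)) * (?n z * z)
      + p * q * (?n z * z\<^sup>2) - 4 * C * (?n z * \<bar>z\<bar> ^ 3)"
  note m1 = normal_moment_nz_1[OF \<sigma>(1), of 0]
  note m2 = normal_second_moment[OF \<sigma>(1)]
  note m3 = normal_third_abs_moment[OF \<sigma>(1)]
  have P: "P \<ge> 0" using B(1) by simp
  have int_low: "integrable lborel ?low"
    by (intro Bochner_Integration.integrable_add Bochner_Integration.integrable_diff integrable_mult_right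
        integrable_normal_density \<sigma> integrable.intros[OF m1] integrable.intros[OF m2] m3(1))
  have int_g: "integrable lborel (\<lambda>z. ?n z * g (y + (z - q * \<sigma>\<^sup>2)))"
  proof (rule Bochner_Integration.integrable_bound)
    show "integrable lborel (\<lambda>z. ?n z * G)" using \<sigma> by simp
    show "(\<lambda>z. ?n z * g (y + (z - q * \<sigma>\<^sup>2))) \<in> borel_measurable lborel" using gm by measurable
    show "AE z in lborel. norm (?n z * g (y + (z - q * \<sigma>\<^sup>2))) \<le> norm (?n z * G)"
      using gb by (intro always_eventually allI) (auto simp: abs_mult intro!: mult_left_mono order_trans[OF gb])
  qed
  have cube: "\<bar>u - v\<bar> ^ 3 \<le> 4 * \<bar>u\<bar> ^ 3 + 4 * \<bar>v\<bar> ^ 3" for u v :: real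
  proof -
    have "\<bar>u - v\<bar> ^ 3 \<le> (\<bar>u\<bar> + \<bar>v\<bar>) ^ 3" by (intro power_mono) auto
    also have "\<dots> = 4 * \<bar>u\<bar> ^ 3 + 4 * \<bar>v\<bar> ^ 3 - 3 * (\<bar>u\<bar> + \<bar>v\<bar>) * (\<bar>u\<bar> - \<bar>v\<bar>)\<^sup>2"
      by (simp add: power3_eq_cube power2_eq_square algebra_simps)
    also have "\<dots> \<le> 4 * \<bar>u\<bar> ^ 3 + 4 * \<bar>v\<bar> ^ 3" by simp
    finally show ?thesis .
  qed
  have le: "?low z \<le> ?n z * g (y + (z - q * \<sigma>\<^sup>2))" for z
  proof -
    define v where "v = q * \<sigma>\<^sup>2"
    have "C * \<bar>z - v\<bar> ^ 3 \<le> C * (4 * \<bar>z\<bar> ^ 3 + 4 * \<bar>v\<bar> ^ 3)" using cube C by (rule mult_left_mono)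
    then have "c + p * (z - v) + p * q * (z - v)\<^sup>2 - C * (4 * \<bar>z\<bar> ^ 3 + 4 * \<bar>v\<bar> ^ 3) \<le> g (y + (z - v))"
      using g[of "z - v"] by linarith
    then have "?n z * (c + p * (z - v) + p * q * (z - v)\<^sup>2 - C * (4 * \<bar>z\<bar> ^ 3 + 4 * \<bar>v\<bar> ^ 3)) \<le> ?n z * g (y + (z - v))"
      by (intro mult_left_mono) auto
    moreover have "?low z = ?n z * (c + p * (z - v) + p * q * (z - v)\<^sup>2 - C * (4 * \<bar>z\<bar> ^ 3 + 4 * \<bar>v\<bar> ^ 3))"
      unfolding v_def[symmetric] by (simp add: v_def[symmetric] power2_eq_square algebra_simps) (simp add: v_def power2_eq_square algebra_simps)
    ultimately show ?thesis by (simp add: v_def)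
  qed
  have "(\<integral>z. ?low z \<partial>lborel) = (c - p * q * \<sigma>\<^sup>2 + p * q * (q * \<sigma>\<^sup>2)\<^sup>2 - 4 * C * \<bar>q * \<sigma>\<^sup>2\<bar> ^ 3) * 1
      + (p - 2 * p * q * (q * \<sigma>\<^sup>2)) * 0 + p * q * \<sigma>\<^sup>2 - 4 * C * (\<integral>z. ?n z * \<bar>z\<bar> ^ 3 \<partial>lborel)"
    using \<sigma> integrable.intros[OF m1] integrable.intros[OF m2] m3(1)
      has_bochner_integral_integral_eq[OF m1] has_bochner_integral_integral_eq[OF m2] by simp
  also have "\<dots> \<ge> c - (P ^ 4 + 8 * C + 4 * C * P ^ 3) * \<sigma> ^ 3"
  proof -
    \<comment> \<open>As \<sigma> \<le> 1, all errors become of order \<sigma>^3, the 3/2 power of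
      the step length; summed over a fixed time horizon they still tend to 0.\<close>
    have "\<sigma> ^ 4 \<le> \<sigma> ^ 3" "\<sigma> ^ 6 \<le> \<sigma> ^ 3" using \<sigma> by (intro power_decreasing; simp)+
    have 1: "- (P ^ 4 * \<sigma> ^ 3) \<le> p * q * (q * \<sigma>\<^sup>2)\<^sup>2"
    proof -
      have "\<bar>p * q * (q * \<sigma>\<^sup>2)\<^sup>2\<bar> = \<bar>p\<bar> * \<bar>q\<bar> ^ 3 * \<sigma> ^ 4"
        by (simp add: abs_mult power2_eq_square power3_eq_cube power4_eq_xxxx)
      also have "\<dots> \<le> P * P ^ 3 * \<sigma> ^ 3"
        using B P \<sigma> \<open>\<sigma> ^ 4 \<le> \<sigma> ^ 3\<close> by (intro mult_mono power_mono) auto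
      also have "P * P ^ 3 = P ^ 4" by (simp add: power3_eq_cube power4_eq_xxxx)
      finally show ?thesis by linarith
    qed
    have 2: "\<bar>q * \<sigma>\<^sup>2\<bar> ^ 3 \<le> P ^ 3 * \<sigma> ^ 3"
    proof -
      have "\<bar>q * \<sigma>\<^sup>2\<bar> ^ 3 = \<bar>q\<bar> ^ 3 * \<sigma> ^ 6" by (simp add: abs_mult power_mult_distrib flip: power_mult)
      also have "\<dots> \<le> P ^ 3 * \<sigma> ^ 3"
        using B P \<sigma> \<open>\<sigma> ^ 6 \<le> \<sigma> ^ 3\<close> by (intro mult_mono power_mono) auto
      finally show ?thesis .
    qed
    have "4 * C * \<bar>q * \<sigma>\<^sup>2\<bar> ^ 3 \<le> 4 * C * (P ^ 3 * \<sigma> ^ 3)" using 2 C by (intro mult_left_mono) auto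
    moreover have "4 * C * (\<integral>z. ?n z * \<bar>z\<bar> ^ 3 \<partial>lborel) \<le> 4 * C * (2 * \<sigma> ^ 3)"
      using m3(2) C by (intro mult_left_mono) auto
    ultimately show ?thesis using 1 by (simp add: algebra_simps)
  qed
  finally show ?thesis using integral_mono[OF int_low int_g le] by linarith
qed

text \<open>After k steps the scheme is a function of the first k increments, hence independent of
  the next one; integrating that increment out with the position frozen loses at most \<kappa>.
  Measurability is carried along because the induction step needs it.\<close>

lemma (in prob_space) euler_expectation:
  assumes ind: "indep_vars (\<lambda>_. borel) \<xi> {..<n}"
    and dist: "\<And>i. i < n \<Longrightarrow> distributed M lborel (\<xi> i) (\<lambda>z. ennreal (normal_density 0 \<sigma> z))"
    and a: "a \<in> borel_measurable borel" and g: "g \<in> borel_measurable borel" and gb: "\<And>z. \<bar>g z\<bar> \<le> G"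
    and \<sigma>: "\<sigma> > 0" and \<kappa>: "\<kappa> \<ge> 0"
    and step: "\<And>y. l < y \<Longrightarrow> y < R \<Longrightarrow> g y - \<kappa> \<le> (\<integral>z. normal_density 0 \<sigma> z * g (y + (z - a y * d)) \<partial>lborel)"
    and k: "k \<le> n"
  shows "(\<lambda>\<omega>. euler a d l R x (\<lambda>i. \<xi> i \<omega>) k) \<in> borel_measurable M \<and>
    g x - real k * \<kappa> \<le> expectation (\<lambda>\<omega>. g (euler a d l R x (\<lambda>i. \<xi> i \<omega>) k))"
  using k
proof (induction k)
  case 0
  then show ?case by (simp add: prob_space)
next
  case (Suc k)
  define Y where "Y \<omega> = euler a d l R x (\<lambda>i. \<xi> i \<omega>) k" for \<omega>
  have Ym [measurable]: "Y \<in> borel_measurable M" and IH: "g x - real k * \<kappa> \<le> expectation (\<lambda>\<omega>. g (Y \<omega>))"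
    using Suc unfolding Y_def by auto
  have \<xi>m: "\<xi> k \<in> borel_measurable M"
    using distributed_measurable[OF dist[of k]] Suc by simp
  note [measurable] = a g
  \<comment> \<open>One step including the stopping rule, as a bounded function of position and
    increment, ready for Fubini.\<close>
  define H where "H = (\<lambda>(y, z). g (if l < y \<and> y < R then y + (z - a y * d) else y))"
  have Hm [measurable]: "H \<in> borel_measurable (borel \<Otimes>\<^sub>M borel)"
    unfolding H_def by measurable
  have Hb: "\<bar>H u\<bar> \<le> G" for u unfolding H_def using gb by (cases u) auto
  have step_eq: "g (euler a d l R x (\<lambda>i. \<xi> i \<omega>) (Suc k)) = H (Y \<omega>, \<xi> k \<omega>)" for \<omega>
    by (simp add: H_def Y_def add_diff_eq)
  \<comment> \<open>Group the increments into the blocks {..<k} and {k}; Y depends on the first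
    block only, by \<open>euler_cong\<close>.\<close>
  have "indep_var borel Y borel (\<xi> k)"
  proof -
    have "indep_var (PiM {..<k} (\<lambda>_. borel)) (\<lambda>\<omega>. restrict (\<lambda>i. \<xi> i \<omega>) {..<k})
        (PiM {k} (\<lambda>_. borel)) (\<lambda>\<omega>. restrict (\<lambda>i. \<xi> i \<omega>) {k})"
      using Suc by (intro indep_var_restrict[OF ind]) auto
    from indep_var_compose[OF this euler_measurable[OF a order_refl, of d l R x] measurable_component_singleton[of k "{k}"]]
    have "indep_var borel ((\<lambda>\<xi>. euler a d l R x \<xi> k) \<circ> (\<lambda>\<omega>. restrict (\<lambda>i. \<xi> i \<omega>) {..<k}))
        borel ((\<lambda>x. x k) \<circ> (\<lambda>\<omega>. restrict (\<lambda>i. \<xi> i \<omega>) {k}))" by simp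
    moreover have "(\<lambda>\<xi>. euler a d l R x \<xi> k) \<circ> (\<lambda>\<omega>. restrict (\<lambda>i. \<xi> i \<omega>) {..<k}) = Y"
      unfolding Y_def by (intro ext) (auto intro!: euler_cong)
    moreover have "(\<lambda>x. x k) \<circ> (\<lambda>\<omega>. restrict (\<lambda>i. \<xi> i \<omega>) {k}) = \<xi> k" by auto
    ultimately show ?thesis by simp
  qed
  then have joint: "distr M (borel \<Otimes>\<^sub>M borel) (\<lambda>\<omega>. (Y \<omega>, \<xi> k \<omega>)) = distr M borel Y \<Otimes>\<^sub>M distr M borel (\<xi> k)"
    by (simp add: indep_var_distribution_eq)
  have \<nu>: "distr M borel (\<xi> k) = density lborel (\<lambda>z. ennreal (normal_density 0 \<sigma> z))"
  proof -
    have "distr M borel (\<xi> k) = distr M lborel (\<xi> k)" by (intro distr_cong) auto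
    then show ?thesis using distributed_distr_eq_density[OF dist[of k]] Suc by simp
  qed
  interpret Yp: prob_space "distr M borel Y" by (rule prob_space_distr) simp
  interpret Xp: prob_space "distr M borel (\<xi> k)" by (rule prob_space_distr) (rule \<xi>m)
  interpret YX: pair_prob_space "distr M borel Y" "distr M borel (\<xi> k)" ..
  have HI: "integrable (distr M borel Y \<Otimes>\<^sub>M distr M borel (\<xi> k)) H"
    by (rule YX.integrable_const_bound[where B = G]) (use Hb in auto)
  have gI: "integrable (distr M borel Y) g"
    by (rule Yp.integrable_const_bound[where B = G]) (use gb in auto)
  have inner: "g y - \<kappa> \<le> (\<integral>z. H (y, z) \<partial>distr M borel (\<xi> k))" for y
  proof (cases "l < y \<and> y < R")
    case True
    have "(\<integral>z. H (y, z) \<partial>distr M borel (\<xi> k)) = (\<integral>z. normal_density 0 \<sigma> z * H (y, z) \<partial>lborel)"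
      unfolding \<nu> by (subst integral_density) auto
    then show ?thesis using step[of y] True by (simp add: H_def)
  next
    case False
    then have "H (y, z) = g y" for z by (auto simp: H_def)
    then show ?thesis using Xp.prob_space \<kappa> by simp
  qed
  have "expectation (\<lambda>\<omega>. g (euler a d l R x (\<lambda>i. \<xi> i \<omega>) (Suc k)))
      = (\<integral>u. H u \<partial>distr M (borel \<Otimes>\<^sub>M borel) (\<lambda>\<omega>. (Y \<omega>, \<xi> k \<omega>)))"
    unfolding step_eq by (subst integral_distr) (use \<xi>m in \<open>auto intro!: measurable_Pair\<close>)
  also have "\<dots> = (\<integral>y. (\<integral>z. H (y, z) \<partial>distr M borel (\<xi> k)) \<partial>distr M borel Y)"
    unfolding joint by (rule YX.integral_fst'[OF HI, symmetric])
  also have "\<dots> \<ge> (\<integral>y. g y - \<kappa> \<partial>distr M borel Y)"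
    by (rule integral_mono) (use gI YX.integrable_fst'[OF HI] inner in auto)
  also have "(\<integral>y. g y - \<kappa> \<partial>distr M borel Y) = (\<integral>y. g y \<partial>distr M borel Y) - \<kappa>"
    using gI Yp.prob_space by simp
  also have "(\<integral>y. g y \<partial>distr M borel Y) = expectation (\<lambda>\<omega>. g (Y \<omega>))"
    by (rule integral_distr) simp_all
  finally have "g x - real (Suc k) * \<kappa> \<le> expectation (\<lambda>\<omega>. g (euler a d l R x (\<lambda>i. \<xi> i \<omega>) (Suc k)))"
    using IH by (simp add: algebra_simps)
  moreover have "(\<lambda>\<omega>. euler a d l R x (\<lambda>i. \<xi> i \<omega>) (Suc k)) \<in> borel_measurable M"
    using Ym \<xi>m unfolding euler.simps Y_def[symmetric] by measurable
  ultimately show ?case by blast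
qed

text \<open>The unions over the tails decrease to the upper limit, and each contains a single event
  of probability at least p.\<close>

lemma (in prob_space) prob_limsup_ge:
  fixes E :: "nat \<Rightarrow> 'a set"
  assumes E: "\<And>n. E n \<in> events" and p: "\<And>n. n \<ge> n0 \<Longrightarrow> p \<le> prob (E n)"
  shows "(\<Inter>N. \<Union>n\<in>{N..}. E n) \<in> events" "p \<le> prob (\<Inter>N. \<Union>n\<in>{N..}. E n)"
proof -
  have U: "(\<Union>n\<in>{N..}. E n) \<in> events" for N by (intro sets.countable_UN'' E) simp
  then show "(\<Inter>N. \<Union>n\<in>{N..}. E n) \<in> events" by (intro sets.countable_INT) auto
  have "(\<lambda>N. prob (\<Union>n\<in>{N..}. E n)) \<longlonglongrightarrow> prob (\<Inter>N. \<Union>n\<in>{N..}. E n)"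
  proof (rule finite_Lim_measure_decseq)
    show "decseq (\<lambda>N. \<Union>n\<in>{N..}. E n)" unfolding decseq_def by (intro allI impI UN_mono) auto
  qed (use U in auto)
  moreover have "p \<le> prob (\<Union>n\<in>{N..}. E n)" for N
  proof -
    have "p \<le> prob (E (max N n0))" by (intro p) simp
    also have "\<dots> \<le> prob (\<Union>n\<in>{N..}. E n)" by (intro finite_measure_mono U UN_upper) simp
    finally show ?thesis .
  qed
  ultimately show "p \<le> prob (\<Inter>N. \<Union>n\<in>{N..}. E n)" by (intro LIMSEQ_le_const) blast+
qed

text \<open>A normal increment can throw the Euler scheme out of (0, \<infinity>). Truncating the
  argument makes the drift globally Lipschitz and the scale function bounded.\<close>

definition clamp_to :: "real \<Rightarrow> real \<Rightarrow> real \<Rightarrow> real" where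
  "clamp_to l u x = max l (min u x)"

lemma clamp_to_continuous: "continuous_on S (clamp_to l u)"
  unfolding clamp_to_def[abs_def] by (intro continuous_intros)

lemma clamp_to_mem: "l \<le> u \<Longrightarrow> clamp_to l u x \<in> {l..u}"
  by (simp add: clamp_to_def)

lemma clamp_to_id: "x \<in> {l..u} \<Longrightarrow> clamp_to l u x = x"
  by (simp add: clamp_to_def)

lemma clamp_to_lipschitz: "\<bar>clamp_to l u x - clamp_to l u y\<bar> \<le> \<bar>x - y\<bar>"
  by (auto simp: clamp_to_def max_def min_def)

lemma continuous_bound:
  fixes f :: "real \<Rightarrow> real"
  assumes "continuous_on {l..u} f"
  obtains B where "B \<ge> 0" "\<And>x. x \<in> {l..u} \<Longrightarrow> \<bar>f x\<bar> \<le> B"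
proof -
  have "bounded (f ` {l..u})" by (intro compact_imp_bounded compact_continuous_image assms compact_Icc)
  then obtain B where "B > 0" "\<forall>y\<in>f ` {l..u}. norm y \<le> B" unfolding bounded_pos by blast
  then show thesis using that[of B] by auto
qed

section \<open>The scale function along the Euler scheme\<close>

context C1_drift
begin

lemma scale_continuous: "continuous_on {0<..} scale"
  by (intro continuous_at_imp_continuous_on ballI DERIV_isCont[OF scale_deriv]) simp

text \<open>The first two derivatives of the scale function are 1/rho and 2 b / rho, whence the
  coefficients; the third involves b', which is continuous. If y + h leaves [l, 2 R], then |h| \<ge>
  l, and every term of lower order is dominated by a multiple of |h|^3.\<close>

lemma scale_Taylor:
  assumes l: "0 < l" "2 * l \<le> R"
  obtains C P where "C \<ge> 0" "\<And>y. y \<in> {2 * l..R} \<Longrightarrow> \<bar>1 / rho b y\<bar> \<le> P" "\<And>y. y \<in> {2 * l..R} \<Longrightarrow> \<bar>b y\<bar> \<le> P"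
    "\<And>y h. y \<in> {2 * l..R} \<Longrightarrow> scale y + 1 / rho b y * h + 1 / rho b y * b y * h\<^sup>2 - C * \<bar>h\<bar> ^ 3
        \<le> scale (clamp_to l (2 * R) (y + h))"
proof -
  obtain b' where b': "\<And>x. x > 0 \<Longrightarrow> (b has_real_derivative b' x) (at x)" and b'c: "continuous_on {0<..} b'"
    using C1 unfolding C1_differentiable_on_def has_real_derivative_iff_has_vector_derivative by auto
  define s1 s2 s3 where "s1 x = 1 / rho b x" and "s2 x = 2 * b x / rho b x"
    and "s3 x = (2 * b' x + 4 * (b x)\<^sup>2) / rho b x" for x
  have d1: "(s1 has_real_derivative s2 x) (at x)" if x: "x > 0" for x
  proof -
    have "((\<lambda>x. 1 / rho b x) has_real_derivative (0 * rho b x - 1 * (- 2 * b x * rho b x)) / (rho b x * rho b x)) (at x)"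
      by (rule DERIV_divide[OF DERIV_const rho_deriv[OF x]]) (use rho_pos[of x] in simp)
    moreover have "(0 * rho b x - 1 * (- 2 * b x * rho b x)) / (rho b x * rho b x) = s2 x"
      using rho_pos[of x] by (simp add: s2_def)
    ultimately show ?thesis by (simp add: s1_def[abs_def])
  qed
  have d2: "(s2 has_real_derivative s3 x) (at x)" if x: "x > 0" for x
  proof -
    have "((\<lambda>x. 2 * b x / rho b x) has_real_derivative (2 * b' x * rho b x - 2 * b x * (- 2 * b x * rho b x)) / (rho b x * rho b x)) (at x)"
      by (rule DERIV_divide[OF DERIV_cmult[OF b'[OF x]] rho_deriv[OF x]]) (use rho_pos[of x] in simp)
    moreover have "(2 * b' x * rho b x - 2 * b x * (- 2 * b x * rho b x)) / (rho b x * rho b x) = s3 x"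
    proof -
      have "2 * b' x * rho b x - 2 * b x * (- 2 * b x * rho b x) = (2 * b' x + 4 * (b x)\<^sup>2) * rho b x"
        by (simp add: power2_eq_square algebra_simps)
      then show ?thesis using rho_pos[of x] by (simp add: s3_def)
    qed
    ultimately show ?thesis by (simp add: s2_def[abs_def])
  qed
  have sub: "{l..2 * R} \<subseteq> {0<..}" "{2 * l..R} \<subseteq> {l..2 * R}" using l by auto
  have ne: "\<forall>x\<in>S. rho b x \<noteq> 0" for S using rho_pos by (metis less_irrefl)
  have c1: "continuous_on {l..2 * R} s1" unfolding s1_def
    by (rule continuous_on_subset[OF inverse_rho_continuous sub(1)])
  have c0: "continuous_on {l..2 * R} scale"
    by (rule continuous_on_subset[OF scale_continuous sub(1)])
  have cb: "continuous_on {l..2 * R} b" by (rule continuous_on_subset[OF b_continuous sub(1)])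
  have c3: "continuous_on {l..2 * R} s3" unfolding s3_def
    by (intro continuous_intros continuous_on_subset[OF b'c sub(1)] cb continuous_on_subset[OF rho_continuous sub(1)] ne)
  obtain M0 where M0: "M0 \<ge> 0" "\<And>x. x \<in> {l..2 * R} \<Longrightarrow> \<bar>scale x\<bar> \<le> M0" using continuous_bound[OF c0] by blast
  obtain M1 where M1: "M1 \<ge> 0" "\<And>x. x \<in> {l..2 * R} \<Longrightarrow> \<bar>s1 x\<bar> \<le> M1" using continuous_bound[OF c1] by blast
  obtain Mb where Mb: "Mb \<ge> 0" "\<And>x. x \<in> {l..2 * R} \<Longrightarrow> \<bar>b x\<bar> \<le> Mb" using continuous_bound[OF cb] by blast
  obtain M3 where M3: "M3 \<ge> 0" "\<And>x. x \<in> {l..2 * R} \<Longrightarrow> \<bar>s3 x\<bar> \<le> M3" using continuous_bound[OF c3] by blast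
  define P where "P = M1 + Mb"
  \<comment> \<open>M3 covers the Taylor remainder; the other three summands cover the constant,
    linear and quadratic terms for |h| \<ge> l, in this order.\<close>
  define C where "C = M3 + (2 * M0 / l ^ 3 + P / l\<^sup>2 + P\<^sup>2 / l)"
  have P0: "P \<ge> 0" using M1 Mb by (simp add: P_def)
  have tail0: "0 \<le> 2 * M0 / l ^ 3 + P / l\<^sup>2 + P\<^sup>2 / l" using l P0 M0 by simp
  have P: "\<bar>s1 y\<bar> \<le> P" "\<bar>b y\<bar> \<le> P" if "y \<in> {2 * l..R}" for y
    using that sub(2) M1(2)[of y] Mb(2)[of y] M1(1) Mb(1) by (auto simp: P_def)
  have main: "scale y + s1 y * h + s1 y * b y * h\<^sup>2 - C * \<bar>h\<bar> ^ 3 \<le> scale (clamp_to l (2 * R) (y + h))"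
    if y: "y \<in> {2 * l..R}" for y h
  proof (cases "y + h \<in> {l..2 * R}")
    case True
    show ?thesis
    proof (cases "h = 0")
      case True
      then show ?thesis using y sub(2) by (auto simp: clamp_to_id)
    next
      case False
      define diff where "diff m = (if m = 0 then scale else if m = 1 then s1 else if m = (2::nat) then s2 else s3)" for m
      have D: "\<forall>m t. m < (3::nat) \<and> l \<le> t \<and> t \<le> 2 * R \<longrightarrow> DERIV (diff m) t :> diff (Suc m) t"
      proof (intro allI impI)
        fix m :: nat and t assume m: "m < 3 \<and> l \<le> t \<and> t \<le> 2 * R"
        then have t: "t > 0" using l by auto
        from m consider "m = 0" | "m = 1" | "m = 2" by linarith
        then show "DERIV (diff m) t :> diff (Suc m) t"
          by cases (use scale_deriv[OF t] d1[OF t] d2[OF t] in \<open>simp_all add: diff_def s1_def\<close>)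
      qed
      have yy: "l \<le> y" "y \<le> 2 * R" using y sub(2) by auto
      have "\<exists>t. (if y + h < y then y + h < t \<and> t < y else y < t \<and> t < y + h) \<and>
        scale (y + h) = (\<Sum>m<3. (diff m y / fact m) * (y + h - y)^m) + (diff 3 t / fact 3) * (y + h - y)^3"
        by (rule Taylor[OF _ _ D yy]) (use True False in \<open>simp_all add: diff_def\<close>)
      then obtain t where t: "if y + h < y then y + h < t \<and> t < y else y < t \<and> t < y + h"
        and eq: "scale (y + h) = (\<Sum>m<3. (diff m y / fact m) * (y + h - y)^m) + (diff 3 t / fact 3) * (y + h - y)^3"
        by blast
      have "t \<in> {l..2 * R}" using t True yy by (auto split: if_splits)
      then have "\<bar>s3 t\<bar> / 6 * \<bar>h\<bar> ^ 3 \<le> M3 * \<bar>h\<bar> ^ 3"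
        using M3(2)[of t] M3(1) by (intro mult_right_mono) auto
      then have "\<bar>s3 t / 6 * h ^ 3\<bar> \<le> M3 * \<bar>h\<bar> ^ 3" by (simp add: abs_mult power_abs)
      then have "- (M3 * \<bar>h\<bar> ^ 3) \<le> s3 t / 6 * h ^ 3" by linarith
      moreover have "scale (y + h) = scale y + s1 y * h + s1 y * b y * h\<^sup>2 + s3 t / 6 * h ^ 3"
        unfolding eq by (simp add: diff_def s1_def s2_def numeral_3_eq_3 fact_numeral lessThan_Suc power2_eq_square)
      moreover have "M3 * \<bar>h\<bar> ^ 3 \<le> C * \<bar>h\<bar> ^ 3" using tail0 by (intro mult_right_mono) (auto simp: C_def)
      ultimately show ?thesis using True by (simp add: clamp_to_id)
    qed
  next
    case False
    \<comment> \<open>Points of [2 l, R] have distance at least l from both ends of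
      [l, 2 R].\<close>
    have h: "\<bar>h\<bar> \<ge> l" using False y l by (auto simp: abs_if)
    have h0: "\<bar>h\<bar> > 0" using h l by simp
    have cl: "clamp_to l (2 * R) (y + h) \<in> {l..2 * R}" using l by (intro clamp_to_mem) auto
    have "scale y - scale (clamp_to l (2 * R) (y + h)) \<le> 2 * M0"
      using M0(2)[OF cl] M0(2)[of y] y sub(2) by auto
    also have "2 * M0 \<le> 2 * M0 / l ^ 3 * \<bar>h\<bar> ^ 3"
      using power_mono[OF h, of 3] l M0 by (simp add: field_simps mult_left_mono)
    finally have t0: "scale y - scale (clamp_to l (2 * R) (y + h)) \<le> 2 * M0 / l ^ 3 * \<bar>h\<bar> ^ 3" .
    have "\<bar>s1 y * h\<bar> \<le> P * \<bar>h\<bar>"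
      unfolding abs_mult using P(1)[OF y] by (rule mult_right_mono) simp
    then have "s1 y * h \<le> P * \<bar>h\<bar>" by linarith
    also have "\<dots> \<le> P / l\<^sup>2 * \<bar>h\<bar> ^ 3"
    proof -
      have "P * \<bar>h\<bar> * l\<^sup>2 \<le> P * \<bar>h\<bar> * \<bar>h\<bar>\<^sup>2" using power_mono[OF h, of 2] l P0 by (intro mult_left_mono) auto
      then show ?thesis using l by (simp add: field_simps power2_eq_square power3_eq_cube)
    qed
    finally have t1: "s1 y * h \<le> P / l\<^sup>2 * \<bar>h\<bar> ^ 3" .
    have "\<bar>s1 y * b y * h\<^sup>2\<bar> \<le> P * P * h\<^sup>2"
      unfolding abs_mult using P[OF y] P0 by (intro mult_mono) auto
    then have "s1 y * b y * h\<^sup>2 \<le> P * P * h\<^sup>2" by linarith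
    also have "\<dots> \<le> P\<^sup>2 / l * \<bar>h\<bar> ^ 3"
    proof -
      have "P * P * \<bar>h\<bar>\<^sup>2 * l \<le> P * P * \<bar>h\<bar>\<^sup>2 * \<bar>h\<bar>" using h P0 by (intro mult_left_mono) auto
      then have "P * P * h\<^sup>2 \<le> P * P * \<bar>h\<bar>\<^sup>2 * \<bar>h\<bar> / l" using l by (simp add: pos_le_divide_eq)
      also have "\<dots> = P\<^sup>2 / l * \<bar>h\<bar> ^ 3" by (simp add: power2_eq_square power3_eq_cube)
      finally show ?thesis .
    qed
    finally have t2: "s1 y * b y * h\<^sup>2 \<le> P\<^sup>2 / l * \<bar>h\<bar> ^ 3" .
    have "0 \<le> M3 * \<bar>h\<bar> ^ 3" using M3 by simp
    then show ?thesis using t0 t1 t2 by (simp add: C_def algebra_simps)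
  qed
  have "C \<ge> 0" using tail0 M3 by (simp add: C_def)
  then show thesis using that[of C P] P main by (simp add: s1_def)
qed

lemma clamped_drift:
  assumes l: "0 < l" "l \<le> u"
  shows "continuous_on UNIV (\<lambda>y. b (clamp_to l u y))"
    and "\<exists>L\<ge>0. \<forall>x y. \<bar>b (clamp_to l u x) - b (clamp_to l u y)\<bar> \<le> L * \<bar>x - y\<bar>"
proof -
  have mem: "clamp_to l u x \<in> {l..u}" for x using l by (intro clamp_to_mem)
  show "continuous_on UNIV (\<lambda>y. b (clamp_to l u y))"
    by (rule continuous_on_compose2[OF b_continuous clamp_to_continuous]) (use l in \<open>auto simp: clamp_to_def\<close>)
  obtain b' where b': "\<And>x. x > 0 \<Longrightarrow> (b has_real_derivative b' x) (at x)" and b'c: "continuous_on {0<..} b'"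
    using C1 unfolding C1_differentiable_on_def has_real_derivative_iff_has_vector_derivative by auto
  have "continuous_on {l..u} b'" using b'c by (rule continuous_on_subset) (use l in auto)
  then obtain L where L: "L \<ge> 0" "\<And>x. x \<in> {l..u} \<Longrightarrow> \<bar>b' x\<bar> \<le> L" using continuous_bound by blast
  have "\<bar>b (clamp_to l u x) - b (clamp_to l u y)\<bar> \<le> L * \<bar>x - y\<bar>" for x y
  proof -
    have "norm (b (clamp_to l u x) - b (clamp_to l u y)) \<le> L * norm (clamp_to l u x - clamp_to l u y)"
    proof (rule field_differentiable_bound[of "{l..u}" b b'])
      fix z assume "z \<in> {l..u}"
      then show "(b has_real_derivative b' z) (at z within {l..u})" "norm (b' z) \<le> L"
        using b'[of z] l L(2) by (auto intro: has_field_derivative_at_within)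
    qed (use mem in auto)
    also have "\<dots> \<le> L * \<bar>x - y\<bar>" using clamp_to_lipschitz L(1) by (simp add: mult_left_mono)
    finally show ?thesis by simp
  qed
  then show "\<exists>L\<ge>0. \<forall>x y. \<bar>b (clamp_to l u x) - b (clamp_to l u y)\<bar> \<le> L * \<bar>x - y\<bar>" using L(1) by blast
qed

text \<open>Normalised to be 0 at the level 1 where the scheme is stopped: a positive value at the
  end certifies that the scheme has ended above 1.\<close>

definition test_value :: "real \<Rightarrow> real \<Rightarrow> real" where
  "test_value R y = scale (clamp_to (1/2) (2 * R) y) - scale 1"

lemma test_value_continuous:
  assumes "R \<ge> 1" shows "continuous_on UNIV (test_value R)"
proof -
  have "continuous_on UNIV (\<lambda>y. scale (clamp_to (1/2) (2 * R) y))"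
    by (rule continuous_on_compose2[OF scale_continuous clamp_to_continuous]) (auto simp: clamp_to_def)
  then show ?thesis unfolding test_value_def by (intro continuous_intros)
qed

text \<open>\<open>R\<close> is both the upper barrier and the time horizon.\<close>

definition stopped_euler :: "(real \<Rightarrow> 'w \<Rightarrow> real) \<Rightarrow> real \<Rightarrow> nat \<Rightarrow> 'w \<Rightarrow> real" where
  "stopped_euler B R n \<omega> = euler (\<lambda>y. b (clamp_to (1/2) (2 * R) y)) (R / real (Suc n)) 1 R 2
        (\<lambda>i. B (real (Suc i) * (R / real (Suc n))) \<omega> - B (real i * (R / real (Suc n))) \<omega>) (Suc n)"

text \<open>By Taylor expansion the scale function of the Euler scheme is nearly a submartingale.\<close>

lemma euler_scale_lower_bound:
  assumes bm: "brownian_motion M B" and R: "R > 2"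
  obtains K where "K \<ge> 0" "\<And>n. R / real (Suc n) \<le> 1 \<Longrightarrow>
     stopped_euler B R n \<in> borel_measurable M \<and>
     test_value R 2 - K * sqrt (R / real (Suc n)) \<le>
       (LINT \<omega>|M. test_value R (stopped_euler B R n \<omega>))"
proof -
  interpret prob_space M using bm by (simp add: brownian_motion_def)
  define a where "a y = b (clamp_to (1/2) (2 * R) y)" for y
  have R': "(0::real) < 1/2" "2 * (1/2) \<le> R" using R by auto
  obtain C P where C: "C \<ge> 0" and P1: "\<And>y. y \<in> {2 * (1/2)..R} \<Longrightarrow> \<bar>1 / rho b y\<bar> \<le> P"
    and P2: "\<And>y. y \<in> {2 * (1/2)..R} \<Longrightarrow> \<bar>b y\<bar> \<le> P"
    and T: "\<And>y h. y \<in> {2 * (1/2)..R} \<Longrightarrow> scale y + 1 / rho b y * h + 1 / rho b y * b y * h\<^sup>2 - C * \<bar>h\<bar> ^ 3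
        \<le> scale (clamp_to (1/2) (2 * R) (y + h))"
    by (rule scale_Taylor[OF R']) (rule that)
  have P: "P \<ge> 0" using P2[of R] R by auto
  define K0 where "K0 = P ^ 4 + 8 * C + 4 * C * P ^ 3"
  have K0: "K0 \<ge> 0" using C P by (simp add: K0_def)
  have gc: "continuous_on UNIV (test_value R)" using R by (intro test_value_continuous) simp
  then have gm: "test_value R \<in> borel_measurable borel" by (rule borel_measurable_continuous_onI)
  have am: "a \<in> borel_measurable borel" unfolding a_def
    using clamped_drift(1)[of "1/2" "2 * R"] R by (intro borel_measurable_continuous_onI) auto
  have "\<exists>G. \<forall>z. \<bar>test_value R z\<bar> \<le> G"
  proof -
    have "continuous_on {1/2..2*R} scale"
      by (rule continuous_on_subset[OF scale_continuous]) auto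
    then obtain G where G: "\<And>x. x \<in> {1/2..2*R} \<Longrightarrow> \<bar>scale x\<bar> \<le> G" using continuous_bound by blast
    have "clamp_to (1/2) (2*R) z \<in> {1/2..2*R}" for z using R by (intro clamp_to_mem) auto
    then have "\<bar>test_value R z\<bar> \<le> G + \<bar>scale 1\<bar>" for z
      unfolding test_value_def by (intro order_trans[OF abs_triangle_ineq4] add_right_mono G)
    then show ?thesis by (intro exI allI)
  qed
  then obtain G where G: "\<And>z. \<bar>test_value R z\<bar> \<le> G" by blast
  show thesis
  proof (rule that[of "R * K0"])
    show "0 \<le> R * K0" using R K0 by simp
    fix n assume d1: "R / real (Suc n) \<le> 1"
    define d where "d = R / real (Suc n)"
    define \<sigma> where "\<sigma> = sqrt d"
    have d: "d > 0" "d \<le> 1" using R d1 by (simp_all add: d_def)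
    have \<sigma>: "0 < \<sigma>" "\<sigma> \<le> 1" "\<sigma>\<^sup>2 = d" using d by (simp_all add: \<sigma>_def)
    define \<xi> where "\<xi> i \<omega> = B (real (Suc i) * d) \<omega> - B (real i * d) \<omega>" for i \<omega>
    have ind: "indep_vars (\<lambda>_. borel) \<xi> {..<Suc n}"
    proof -
      have "strict_mono (\<lambda>i. real i * d)" using d by (intro strict_monoI) simp
      moreover have ax: "\<forall>(\<tau>::nat \<Rightarrow> real) n. 0 \<le> \<tau> 0 \<and> strict_mono \<tau> \<longrightarrow>
          indep_vars (\<lambda>_. borel) (\<lambda>i \<omega>. B (\<tau> (Suc i)) \<omega> - B (\<tau> i) \<omega>) {..<n}"
        using bm unfolding brownian_motion_def by (elim conjE)
      ultimately show ?thesis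
        using ax[rule_format, of "\<lambda>i. real i * d" "Suc n"] unfolding \<xi>_def[abs_def] by simp
    qed
    have dist: "distributed M lborel (\<xi> i) (\<lambda>z. ennreal (normal_density 0 \<sigma> z))" for i
    proof -
      have "0 \<le> real i * d \<and> real i * d < real (Suc i) * d" using d by simp
      moreover have "\<forall>s t. 0 \<le> s \<and> s < t \<longrightarrow> distributed M lborel (\<lambda>\<omega>. B t \<omega> - B s \<omega>)
          (\<lambda>x. ennreal (normal_density 0 (sqrt (t - s)) x))"
        using bm unfolding brownian_motion_def by (elim conjE)
      ultimately have "distributed M lborel (\<lambda>\<omega>. B (real (Suc i) * d) \<omega> - B (real i * d) \<omega>)
        (\<lambda>z. ennreal (normal_density 0 (sqrt (real (Suc i) * d - real i * d)) z))"
        by simp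
      moreover have "real (Suc i) * d - real i * d = d" by (simp add: algebra_simps)
      ultimately show ?thesis by (simp add: \<xi>_def[abs_def] \<sigma>_def)
    qed
    have step: "test_value R y - K0 * \<sigma> ^ 3 \<le> (\<integral>z. normal_density 0 \<sigma> z * test_value R (y + (z - a y * d)) \<partial>lborel)"
      if y: "1 < y" "y < R" for y
    proof -
      have y': "y \<in> {2 * (1/2)..R}" "y \<in> {1/2..2*R}" using y by auto
      have ay: "a y = b y" using clamp_to_id[OF y'(2)] by (simp add: a_def)
      have gy: "test_value R y = scale y - scale 1" using clamp_to_id[OF y'(2)] by (simp add: test_value_def)
      have "test_value R y + 1 / rho b y * h + 1 / rho b y * b y * h\<^sup>2 - C * \<bar>h\<bar> ^ 3 \<le> test_value R (y + h)" for h
        using T[OF y'(1), of h] unfolding gy by (simp add: test_value_def)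
      from normal_step_lower_bound[OF \<sigma>(1,2) gm G C this P1[OF y'(1)] P2[OF y'(1)]]
      show ?thesis by (simp add: K0_def ay \<sigma>(3))
    qed
    have \<kappa>: "0 \<le> K0 * \<sigma> ^ 3" using K0 \<sigma> by simp
    \<comment> \<open>There are n + 1 steps of length d with (n + 1) d = R, each losing K0 times the
      3/2 power of d; the total R K0 sqrt d tends to 0 as n grows.\<close>
    have eq: "real (Suc n) * (K0 * \<sigma> ^ 3) = R * K0 * sqrt (R / real (Suc n))"
    proof -
      have "\<sigma> ^ 3 = d * \<sigma>" using \<sigma>(3) by (simp add: power3_eq_cube power2_eq_square)
      then have "real (Suc n) * (K0 * \<sigma> ^ 3) = (real (Suc n) * d) * K0 * \<sigma>" by (simp only: mult_ac)
      also have "real (Suc n) * d = R" by (simp add: d_def)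
      finally show ?thesis by (simp only: \<sigma>_def d_def)
    qed
    from euler_expectation[OF ind dist am gm G \<sigma>(1) \<kappa> step order_refl, where x = 2]
    show "stopped_euler B R n \<in> borel_measurable M \<and>
     test_value R 2 - R * K0 * sqrt (R / real (Suc n)) \<le>
       (LINT \<omega>|M. test_value R (stopped_euler B R n \<omega>))"
      unfolding eq \<xi>_def a_def[abs_def] d_def stopped_euler_def[abs_def] .
  qed
qed

end

section \<open>Absorbed paths and the unboundedness of the scale function\<close>

context C1_drift
begin

text \<open>On its way to 0 the path first reaches 1/2 at a time \<theta>, and on [0, \<theta>] it
  stays in a compact part of (0, \<infinity>). For R beyond its maximum and beyond \<theta> the
  truncation of the drift is not felt, and a fine scheme follows the path below 1.\<close>

lemma absorbed_path_euler:
  fixes X :: "real \<Rightarrow> ereal" and B :: "real \<Rightarrow> 'w \<Rightarrow> real" and \<omega> :: 'w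
  assumes B0: "B 0 \<omega> = 0" and X0: "X 0 = ereal 2" and Xc: "continuous_on {0..} X" and nn: "\<And>t. t \<ge> 0 \<Longrightarrow> 0 \<le> X t"
    and sde: "\<And>t. t \<ge> 0 \<Longrightarrow> (\<forall>s\<in>{0..t}. 0 < X s \<and> X s < \<infinity>) \<Longrightarrow>
      X t = ereal (2 + B t \<omega> - (LBINT s=ereal 0..ereal t. b (real_of_ereal (X s))))"
    and absorb: "\<And>s t. 0 \<le> s \<Longrightarrow> s \<le> t \<Longrightarrow> X s = 0 \<or> X s = \<infinity> \<Longrightarrow> X t = X s"
    and hit: "t0 \<ge> 0" "X t0 = 0"
  obtains R0 where "\<And>R. R \<ge> R0 \<Longrightarrow> \<exists>n0. \<forall>n\<ge>n0.
    test_value R (stopped_euler B R n \<omega>) \<le> 0"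
proof -
  define \<beta> where "\<beta> t = B t \<omega>" for t

  have finite: "X t \<noteq> \<infinity>" if "0 \<le> t" "t \<le> t0" for t
    using absorb[OF that] hit(2) by auto
  have Xc': "continuous_on {0..t} X" for t by (rule continuous_on_subset[OF Xc]) auto
  \<comment> \<open>The least element of this compact set is the first time at which the path equals
    1/2.\<close>
  define S where "S = X -` {ereal (1/2)} \<inter> {0..t0}"
  have "closed S"
    using Xc'[of t0] unfolding S_def continuous_on_closed_vimage[OF closed_atLeastAtMost] by simp
  then have "compact ({0..t0} \<inter> S)" by (intro compact_Int_closed compact_Icc)
  moreover have "{0..t0} \<inter> S = S" by (auto simp: S_def)
  ultimately have "compact S" by simp
  moreover have "S \<noteq> {}"
    using IVT2'[of X t0 "ereal (1/2)" 0] hit X0 Xc'[of t0] by (force simp: S_def)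
  ultimately obtain \<theta> where \<theta>: "\<theta> \<in> S" "\<And>t. t \<in> S \<Longrightarrow> \<theta> \<le> t"
    using compact_attains_inf by metis
  have \<theta>0: "0 \<le> \<theta>" "\<theta> \<le> t0" and X\<theta>: "X \<theta> = ereal (1/2)" using \<theta>(1) by (auto simp: S_def)
  have low: "ereal (1/2) \<le> X t" if t: "t \<in> {0..\<theta>}" for t
  proof (rule ccontr)
    assume "\<not> ereal (1/2) \<le> X t"
    then have lt: "X t < ereal (1/2)" by simp
    then obtain u where u: "0 \<le> u" "u \<le> t" "X u = ereal (1/2)"
      using IVT2'[of X t "ereal (1/2)" 0] t X0 Xc'[of t] by force
    then have "u \<in> S" using t \<theta>0 by (auto simp: S_def)
    then have "u = t" using \<theta>(2) u t by force
    then show False using u lt by simp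
  qed
  define x where "x t = real_of_ereal (X t)" for t
  have x: "X t = ereal (x t)" if "t \<in> {0..\<theta>}" for t
    using finite[of t] low[OF that] \<theta>0 that unfolding x_def by (cases "X t") auto
  have xl: "1/2 \<le> x t" if "t \<in> {0..\<theta>}" for t using low[OF that] x[OF that] by simp
  have xc: "continuous_on {0..\<theta>} x"
  proof -
    have "\<bar>X t\<bar> \<noteq> \<infinity>" if "t \<in> {0..\<theta>}" for t using x[OF that] by simp
    then show ?thesis using continuous_on_iff_real[of "{0..\<theta>}" X] Xc'[of \<theta>] by (simp add: x_def[abs_def] o_def)
  qed
  obtain Mx where Mx: "\<And>t. t \<in> {0..\<theta>} \<Longrightarrow> \<bar>x t\<bar> \<le> Mx" using continuous_bound[OF xc] by blast
  have bxc: "continuous_on {0..\<theta>} (\<lambda>s. b (real_of_ereal (X s)))"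
    unfolding x_def[symmetric]
    by (rule continuous_on_compose2[OF b_continuous xc]) (use xl in \<open>force simp: image_subset_iff\<close>)
  have x_sde: "x t = 2 + \<beta> t - (LBINT s=ereal 0..ereal t. b (real_of_ereal (X s)))" if t: "t \<in> {0..\<theta>}" for t
  proof -
    have "0 < X s \<and> X s < \<infinity>" if "s \<in> {0..t}" for s
    proof -
      have "s \<in> {0..\<theta>}" using that t by auto
      then show ?thesis using x xl[of s] by simp
    qed
    then have "X t = ereal (2 + \<beta> t - (LBINT s=ereal 0..ereal t. b (real_of_ereal (X s))))"
      unfolding \<beta>_def using t by (intro sde) auto
    then show ?thesis by (simp add: x_def)
  qed
  \<comment> \<open>By the integral equation the path minus its noise is continuously
    differentiable, although neither of the two need be.\<close>
  have V: "((\<lambda>s. x s - \<beta> s) has_real_derivative - b (x t)) (at t within {0..\<theta>})" if t: "t \<in> {0..\<theta>}" for t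
  proof -
    have "((\<lambda>u. LBINT s=ereal 0..ereal u. b (real_of_ereal (X s))) has_vector_derivative b (real_of_ereal (X t))) (at t within {0..\<theta>})"
      by (rule interval_integral_FTC2[OF order_refl \<theta>0(1) bxc]) (use t in auto)
    then have "((\<lambda>u. LBINT s=ereal 0..ereal u. b (real_of_ereal (X s))) has_real_derivative b (x t)) (at t within {0..\<theta>})"
      by (simp add: has_real_derivative_iff_has_vector_derivative x_def)
    from DERIV_diff[OF DERIV_const[of 2] this]
    have "((\<lambda>u. 2 - (LBINT s=ereal 0..ereal u. b (real_of_ereal (X s)))) has_real_derivative - b (x t)) (at t within {0..\<theta>})" by simp
    then show ?thesis
      by (rule has_field_derivative_transform_within[OF _ zero_less_one t]) (simp add: x_sde)
  qed
  \<comment> \<open>The room above Mx exceeds the tracking error, which is below 1/2; R has to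
    exceed \<theta> because it is also the time horizon.\<close>
  define R0 where "R0 = max (Mx + 2) (max \<theta> 2)"
  show thesis
  proof (rule that[of R0])
    fix R assume R: "R \<ge> R0"
    then have RR: "R \<ge> Mx + 2" "R \<ge> \<theta>" "R \<ge> 2" by (auto simp: R0_def)
    define a where "a y = b (clamp_to (1/2) (2 * R) y)" for y
    obtain L where L: "L \<ge> 0" "\<And>u v. \<bar>a u - a v\<bar> \<le> L * \<bar>u - v\<bar>"
      using clamped_drift(2)[of "1/2" "2 * R"] RR unfolding a_def by auto
    \<comment> \<open>The total error \<eta> + \<eta> exp (L \<theta>) is exactly the gap 1/2
      between the levels 1/2 and 1. The Lipschitz constant L depends on R, so \<eta> is chosen after
      R.\<close>
    define \<eta> where "\<eta> = 1 / (2 * (1 + exp (L * \<theta>)))"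
    have \<eta>: "\<eta> > 0" "\<eta> + \<eta> * exp (L * \<theta>) = 1/2"
    proof -
      have "1 + exp (L * \<theta>) > 0" by (simp add: add_pos_pos)
      then show "\<eta> > 0" by (simp add: \<eta>_def)
      have "\<eta> + \<eta> * exp (L * \<theta>) = \<eta> * (1 + exp (L * \<theta>))" by (simp add: algebra_simps)
      also have "\<dots> = 1/2" using \<open>1 + exp (L * \<theta>) > 0\<close> by (simp add: \<eta>_def)
      finally show "\<eta> + \<eta> * exp (L * \<theta>) = 1/2" .
    qed
    have "uniformly_continuous_on {0..\<theta>} x" by (intro compact_uniformly_continuous xc compact_Icc)
    then obtain \<delta> where \<delta>: "\<delta> > 0" "\<And>s t. s \<in> {0..\<theta>} \<Longrightarrow> t \<in> {0..\<theta>} \<Longrightarrow> dist t s < \<delta> \<Longrightarrow> dist (x t) (x s) < \<eta>"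
      using \<eta>(1) unfolding uniformly_continuous_on_def by meson
    obtain n0 where n0: "R / \<delta> < real n0" using reals_Archimedean2 by blast
    show "\<exists>n0. \<forall>n\<ge>n0. test_value R (stopped_euler B R n \<omega>) \<le> 0"
    proof (intro exI[of _ n0] allI impI)
      fix n assume n: "n \<ge> n0"
      define d where "d = R / real (Suc n)"
      have d: "d > 0" using RR by (simp add: d_def)
      have "R < \<delta> * real n0" using n0 \<delta>(1) by (simp add: field_simps)
      also have "\<dots> \<le> \<delta> * real (Suc n)" using n \<delta>(1) by (intro mult_left_mono) auto
      finally have d\<delta>: "d < \<delta>" by (simp add: d_def divide_less_eq)
      have nd: "real (Suc n) * d = R" by (simp add: d_def)
      have eul: "euler a d 1 R 2 (\<lambda>i. \<beta> (real (Suc i) * d) - \<beta> (real i * d)) (Suc n) \<le> 1"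
      proof (rule euler_reaches[OF L(2) L(1), where X = x and \<theta> = \<theta> and \<eta> = \<eta>])
        fix t assume t: "t \<in> {0..\<theta>}"
        have "x t \<in> {1/2..2 * R}" using xl[OF t] Mx[OF t] RR by auto
        then have "a (x t) = b (x t)" by (simp add: a_def clamp_to_id)
        then show "((\<lambda>s. x s - \<beta> s) has_real_derivative - a (x t)) (at t within {0..\<theta>})" using V[OF t] by simp
        show "x t + \<eta> * exp (L * \<theta>) < R" using Mx[OF t] RR \<eta> by linarith
      next
        show "x 0 = 2" using X0 by (simp add: x_def)
        show "\<bar>x s - x t\<bar> \<le> \<eta>" if "s \<in> {0..\<theta>}" "t \<in> {0..\<theta>}" "\<bar>s - t\<bar> \<le> d" for s t
          using \<delta>(2)[OF that(1,2)] that(3) d\<delta> by (simp add: dist_real_def abs_minus_commute)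
        show "x \<theta> + \<eta> + \<eta> * exp (L * \<theta>) \<le> 1" using X\<theta> \<eta>(2) by (simp add: x_def)
        show "\<theta> \<le> real (Suc n) * d" using RR(2) nd by simp
      qed (use d \<theta>0 in auto)
      have "scale (clamp_to (1/2) (2 * R) y) \<le> scale 1" if "y \<le> 1" for y
        using that RR by (intro scale_mono) (auto simp: clamp_to_def)
      from this[OF eul] show "test_value R (stopped_euler B R n \<omega>) \<le> 0"
        by (simp add: test_value_def stopped_euler_def a_def[abs_def] d_def \<beta>_def)
    qed
  qed
qed

text \<open>If the scale function were bounded, the events \<open>E m n\<close> that the scheme ends above \<open>1\<close> would have
  probabilities bounded away from \<open>0\<close>, hence so would their upper limit \<open>H\<close>, first in the number
  \<open>n\<close> of steps and then in \<open>m\<close>. Absorbed paths do not belong to \<open>H\<close>.\<close>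

lemma absorption_imp_scale_unbounded:
  assumes bm: "brownian_motion M B" and X: "absorbed_diffusion M B b 2 X"
    and hit: "AE \<omega> in M. hitting_time_0 X \<omega> < \<infinity>"
  shows "\<exists>y>0. scale y > K"
proof (rule ccontr)
  assume "\<not> ?thesis"
  then have bdd: "scale y \<le> K" if "y > 0" for y using that by force
  interpret prob_space M using bm by (simp add: brownian_motion_def)
  define \<gamma> where "\<gamma> = scale 2 - scale 1"
  have \<gamma>: "\<gamma> > 0" using scale_less[of 1 2] by (simp add: \<gamma>_def)
  \<comment> \<open>The assumed bound K caps \<open>test_value\<close> at D whatever R is, so the
    lower bound for probabilities below does not depend on m.\<close>
  define D where "D = K - scale 1"
  have D: "D > 0" using \<gamma> bdd[of 2] by (simp add: D_def \<gamma>_def)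
  define R where "R m = real m + 3" for m
  have R: "R m > 2" for m by (simp add: R_def)
  \<comment> \<open>The condition on the step length is part of the event, which makes it measurable
    for every n: it is empty when the step is too long.\<close>
  define E where "E m n = {\<omega> \<in> space M. R m / real (Suc n) \<le> 1 \<and> test_value (R m) (stopped_euler B (R m) n \<omega>) > 0}" for m n
  have E_meas: "E m n \<in> events" for m n
  proof (cases "R m / real (Suc n) \<le> 1")
    case True
    have [measurable]: "stopped_euler B (R m) n \<in> borel_measurable M"
      using euler_scale_lower_bound[OF bm R[of m]] True by metis
    have [measurable]: "test_value (R m) \<in> borel_measurable borel"
      using R[of m] by (intro borel_measurable_continuous_onI test_value_continuous) simp
    show ?thesis unfolding E_def using True by simp
  qed (simp add: E_def)
  have E_prob: "\<exists>n0. \<forall>n\<ge>n0. \<gamma> / (2 * D) \<le> prob (E m n)" for m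
  proof -
    obtain C where C: "C \<ge> 0" and low: "\<And>n. R m / real (Suc n) \<le> 1 \<Longrightarrow> stopped_euler B (R m) n \<in> borel_measurable M \<and>
        test_value (R m) 2 - C * sqrt (R m / real (Suc n)) \<le> expectation (\<lambda>\<omega>. test_value (R m) (stopped_euler B (R m) n \<omega>))"
      using euler_scale_lower_bound[OF bm R[of m]] by metis
    have lim: "(\<lambda>n. R m / real (Suc n)) \<longlonglongrightarrow> 0"
      using LIMSEQ_Suc[OF lim_const_over_n[of "R m"]] by simp
    from tendsto_mult_left[OF tendsto_real_sqrt[OF this], of C]
    have "(\<lambda>n. C * sqrt (R m / real (Suc n))) \<longlonglongrightarrow> 0" by simp
    then have "eventually (\<lambda>n. C * sqrt (R m / real (Suc n)) < \<gamma> / 2) sequentially"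
      using \<gamma> by (intro order_tendstoD) auto
    moreover have "eventually (\<lambda>n. R m / real (Suc n) < 1) sequentially"
      using lim by (rule order_tendstoD) simp
    ultimately have "eventually (\<lambda>n. \<gamma> / (2 * D) \<le> prob (E m n)) sequentially"
    proof eventually_elim
      case (elim n)
      note [measurable] = E_meas[of m n]
      have Ym [measurable]: "stopped_euler B (R m) n \<in> borel_measurable M" using low[of n] elim by simp
      have gm [measurable]: "test_value (R m) \<in> borel_measurable borel"
        using R[of m] by (intro borel_measurable_continuous_onI test_value_continuous) simp
      have "test_value (R m) 2 = \<gamma>"
        using R[of m] by (simp add: test_value_def clamp_to_id \<gamma>_def)
      then have "\<gamma> / 2 \<le> expectation (\<lambda>\<omega>. test_value (R m) (stopped_euler B (R m) n \<omega>))"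
        using low[of n] elim by linarith
      \<comment> \<open>The value is at most D on E m n and at most 0 off it, so a mean of at least
        \<gamma>/2 forces probability at least \<gamma> / (2 D).\<close>
      also have "\<dots> \<le> expectation (\<lambda>\<omega>. D * indicator (E m n) \<omega>)"
      proof (rule integral_mono)
        have tv: "test_value (R m) y \<in> {scale (1/2) - scale 1..D}" for y
        proof -
          have "clamp_to (1/2) (2 * R m) y \<ge> 1/2" by (simp add: clamp_to_def)
          then show ?thesis
            using bdd[of "clamp_to (1/2) (2 * R m) y"] scale_mono[of "1/2" "clamp_to (1/2) (2 * R m) y"]
            by (simp add: test_value_def D_def)
        qed
        show "integrable M (\<lambda>\<omega>. test_value (R m) (stopped_euler B (R m) n \<omega>))"
        proof (rule integrable_const_bound[where B = "\<bar>scale (1/2) - scale 1\<bar> + \<bar>D\<bar>"])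
          show "AE \<omega> in M. norm (test_value (R m) (stopped_euler B (R m) n \<omega>)) \<le> \<bar>scale (1/2) - scale 1\<bar> + \<bar>D\<bar>"
          proof (intro always_eventually allI)
            fix \<omega>
            show "norm (test_value (R m) (stopped_euler B (R m) n \<omega>)) \<le> \<bar>scale (1/2) - scale 1\<bar> + \<bar>D\<bar>"
              using tv[of "stopped_euler B (R m) n \<omega>"] unfolding real_norm_def atLeastAtMost_iff by arith
          qed
        qed simp
        show "integrable M (\<lambda>\<omega>. D * indicator (E m n) \<omega>)"
          by (intro integrable_mult_right integrable_real_indicator E_meas) (simp add: emeasure_eq_measure)
        fix \<omega> assume "\<omega> \<in> space M"
        then show "test_value (R m) (stopped_euler B (R m) n \<omega>) \<le> D * indicator (E m n) \<omega>"
          using tv[of "stopped_euler B (R m) n \<omega>"] elim by (auto simp: E_def indicator_def)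
      qed
      also have "\<dots> = D * prob (E m n)" by simp
      finally show ?case using D by (simp add: field_simps)
    qed
    then show ?thesis by (simp add: eventually_sequentially)
  qed
  \<comment> \<open>For an absorbed path the threshold for n depends on the path and on m, and the
    threshold for m on the path. The iterated upper limits need no uniformity and involve the scheme
    only.\<close>
  define F where "F m = (\<Inter>N. \<Union>n\<in>{N..}. E m n)" for m
  have F: "F m \<in> events" "\<gamma> / (2 * D) \<le> prob (F m)" for m
  proof -
    obtain n0 where "\<And>n. n \<ge> n0 \<Longrightarrow> \<gamma> / (2 * D) \<le> prob (E m n)" using E_prob[of m] by blast
    from prob_limsup_ge[of "E m", OF E_meas this]
    show "F m \<in> events" "\<gamma> / (2 * D) \<le> prob (F m)" by (simp_all add: F_def)
  qed
  define H where "H = (\<Inter>N. \<Union>m\<in>{N..}. F m)"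
  have H: "H \<in> events" "\<gamma> / (2 * D) \<le> prob H"
    unfolding H_def by (rule prob_limsup_ge[where ?n0.0 = 0]; rule F)+
  have "AE \<omega> in M. B 0 \<omega> = 0" using bm unfolding brownian_motion_def by (elim conjE)
  moreover have "AE \<omega> in M.
        X 0 \<omega> = ereal 2 \<and>
        (\<forall>t\<ge>0. 0 \<le> X t \<omega>) \<and>
        continuous_on {0..} (\<lambda>t. X t \<omega>) \<and>
        (\<forall>t\<ge>0. (\<forall>s\<in>{0..t}. 0 < X s \<omega> \<and> X s \<omega> < \<infinity>) \<longrightarrow>
           X t \<omega> = ereal (2 + B t \<omega> - (LBINT s=ereal 0..ereal t. b (real_of_ereal (X s \<omega>))))) \<and>
        (\<forall>s t. 0 \<le> s \<and> s \<le> t \<and> (X s \<omega> = 0 \<or> X s \<omega> = \<infinity>) \<longrightarrow> X t \<omega> = X s \<omega>)"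
    using X unfolding absorbed_diffusion_def by (elim conjE)
  ultimately have "AE \<omega> in M. \<omega> \<notin> H"
    using hit
  proof eventually_elim
    case (elim \<omega>)
    \<comment> \<open>The infimum of the empty set is \<infinity>, so a finite hitting time provides
      an actual zero of the path.\<close>
    have "{ereal t |t. 0 \<le> t \<and> X t \<omega> = 0} \<noteq> {}"
    proof
      assume eq: "{ereal t |t. 0 \<le> t \<and> X t \<omega> = 0} = {}"
      have "hitting_time_0 X \<omega> = \<infinity>" unfolding hitting_time_0_def eq by (simp add: top_ereal_def)
      then show False using elim(3) by simp
    qed
    then obtain t0 where t0: "t0 \<ge> 0" "X t0 \<omega> = 0" by blast
    obtain R0 where R0: "\<And>R. R \<ge> R0 \<Longrightarrow> \<exists>n0. \<forall>n\<ge>n0. test_value R (stopped_euler B R n \<omega>) \<le> 0"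
      by (rule absorbed_path_euler[of B \<omega> "\<lambda>t. X t \<omega>" t0]) (use elim t0 in blast)+
    obtain m0 where m0: "R0 < real m0" using reals_Archimedean2 by blast
    have "\<omega> \<notin> F m" if "m \<ge> m0" for m
    proof -
      have "R m \<ge> R0" using m0 that by (simp add: R_def)
      then obtain n0 where "\<forall>n\<ge>n0. test_value (R m) (stopped_euler B (R m) n \<omega>) \<le> 0" using R0 by blast
      then have "\<omega> \<notin> E m n" if "n \<ge> n0" for n using that by (force simp: E_def)
      then show ?thesis by (force simp: F_def)
    qed
    then show ?case by (force simp: H_def)
  qed
  then have "prob H = 0" using H(1) by (simp add: prob_eq_0)
  then show False using H(2) \<gamma> D by (simp add: divide_le_0_iff)
qed

end

section \<open>The bottom of the spectrum\<close>

context C1_drift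
begin

lemma lambda0_pos_imp_Hardy:
  assumes "0 < lambda0 b"
  obtains C where "C \<ge> 0" "\<And>\<phi>. \<phi> \<in> test_functions \<Longrightarrow>
    (L2_norm (rho_measure b) \<phi>)\<^sup>2 \<le> C * (L2_norm (rho_measure b) (dv \<phi>))\<^sup>2"
proof -
  interpret closable_form "rho_measure b" test_functions "energy b" by (rule closable_form_energy)
  have "0 \<notin> spectrum (rho_measure b) (generator b)"
  proof
    assume "0 \<in> spectrum (rho_measure b) (generator b)"
    then have "lambda0 b \<le> ereal (Re 0)" unfolding lambda0_def by (rule INF_lower)
    then show False using assms by (simp add: zero_ereal_def[symmetric])
  qed
  then have "0 \<in> resolvent_set (rho_measure b) (form_operator (rho_measure b) test_functions (energy b))"
    by (simp add: spectrum_def generator_def)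
  then obtain C where C: "C \<ge> 0" "\<And>v. v \<in> test_functions \<Longrightarrow> (L2_norm (rho_measure b) v)\<^sup>2 \<le> C * Re (energy b v v)"
    using zero_resolvent_imp_lower_bound by blast
  show thesis
  proof (rule that[of "C / 2"])
    show "(L2_norm (rho_measure b) \<phi>)\<^sup>2 \<le> C / 2 * (L2_norm (rho_measure b) (dv \<phi>))\<^sup>2"
      if "\<phi> \<in> test_functions" for \<phi>
      using C(2)[OF that] by (simp add: energy_eq_L2_norm[OF that])
  qed (use C(1) in simp)
qed

lemma Hardy_imp_lambda0_pos:
  assumes C: "C > 0" "\<And>\<phi>. \<phi> \<in> test_functions \<Longrightarrow>
    (L2_norm (rho_measure b) \<phi>)\<^sup>2 \<le> C * (L2_norm (rho_measure b) (dv \<phi>))\<^sup>2"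
  shows "0 < lambda0 b"
proof -
  interpret closable_form "rho_measure b" test_functions "energy b" by (rule closable_form_energy)
  \<comment> \<open>The 2 compensates the factor 1/2 in the energy.\<close>
  define c where "c = 1 / (2 * C)"
  have c: "c > 0" using C(1) by (simp add: c_def)
  have lower: "c * (L2_norm (rho_measure b) \<phi>)\<^sup>2 \<le> Re (energy b \<phi> \<phi>)" if "\<phi> \<in> test_functions" for \<phi>
    using C(2)[OF that] C(1) by (simp add: energy_eq_L2_norm[OF that] c_def field_simps)
  have "ereal c \<le> lambda0 b"
    unfolding lambda0_def
  proof (rule INF_greatest)
    fix z assume "z \<in> spectrum (rho_measure b) (generator b)"
    then have "z \<notin> resolvent_set (rho_measure b) (form_operator (rho_measure b) test_functions (energy b))"
      by (simp add: spectrum_def generator_def)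
    then have "\<not> Re z < c" using half_plane_resolvent[OF c lower] by blast
    then show "ereal c \<le> ereal (Re z)" by simp
  qed
  then show ?thesis using c by (metis ereal_less(2) less_le_trans)
qed

end

theorem proposition1p10:
  fixes b :: "real \<Rightarrow> real"
    and M :: "'w measure"
    and B :: "real \<Rightarrow> 'w \<Rightarrow> real"
    and X :: "real \<Rightarrow> real \<Rightarrow> 'w \<Rightarrow> ereal"
  assumes "b C1_differentiable_on {0<..}"
    and "brownian_motion M B"
    and "\<And>x. x > 0 \<Longrightarrow> absorbed_diffusion M B b x (X x)"
    and "exit_boundary b"
    and "absorption_certain M X"
  shows "(0 < lambda0 b \<longleftrightarrow> (\<exists>a>0. A_const b a < \<infinity>)) \<and>
         (0 < lambda0 b \<longrightarrow> (\<integral>\<^sup>+y\<in>{1<..}. ennreal (rho b y) \<partial>lborel) < \<infinity>)"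
proof -
  interpret C1_drift b by unfold_locales (rule assms(1))
  have "AE \<omega> in M. hitting_time_0 (X 2) \<omega> < \<infinity>"
    using assms(5) unfolding absorption_certain_def by simp
  then have unbounded: "\<exists>y>0. K < scale y" for K
    using absorption_imp_scale_unbounded[OF assms(2) assms(3)] by simp
  \<comment> \<open>The choice a = 1 gives the equivalence and, through \<open>speed_finite\<close>,
    the integrability of rho at \<infinity>.\<close>
  have necessary: "A_const b 1 < \<infinity>" if pos: "0 < lambda0 b"
  proof -
    obtain C where C: "C \<ge> 0" "\<And>\<phi>. \<phi> \<in> test_functions \<Longrightarrow>
        (L2_norm (rho_measure b) \<phi>)\<^sup>2 \<le> C * (L2_norm (rho_measure b) (dv \<phi>))\<^sup>2"
      using lambda0_pos_imp_Hardy[OF pos] by blast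
    show ?thesis
      by (rule A_const_finite[OF Muckenhoupt_necessary[OF C unbounded zero_less_one] zero_less_one C(1)])
  qed
  have sufficient: "0 < lambda0 b" if a: "a > 0" "A_const b a < \<infinity>" for a
  proof -
    obtain C where "C > 0" "\<And>\<phi>. \<phi> \<in> test_functions \<Longrightarrow>
        (L2_norm (rho_measure b) \<phi>)\<^sup>2 \<le> C * (L2_norm (rho_measure b) (dv \<phi>))\<^sup>2"
      using Hardy_inequality[OF assms(4) a] by blast
    then show ?thesis by (rule Hardy_imp_lambda0_pos)
  qed
  show ?thesis
    using necessary sufficient speed_finite[OF zero_less_one] zero_less_one by blast
qed

end
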